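(* Let $K$ be a field of characteristic different from $2$ and $3$. Let $\widetilde L$ be a finitely presented Lie superalgebra over $K$, and let $I$ be an ideal of $\widetilde L$ such that $\widetilde L/I$ is a free Lie superalgebra on one homogeneous generator. Assume further that $\widetilde L$ does not contain a non-abelian free Lie superalgebra (as a subalgebra). Then $I$ is finitely generated as a Lie superalgebra. In particular, the result holds for soluble $\widetilde L$: if $\widetilde L$ is a finitely presented, soluble Lie superalgebra over $K$ and $I$ is an ideal of $\widetilde L$ such that $\widetilde L/I$ is a free Lie superalgebra on one homogeneous generator, then $I$ is finitely generated as a Lie superalgebra.
   Context: A Lie superalgebra over $K$ is a $\mathbb Z_2$-graded vector space $L=L_0\oplus L_1$ with a bilinear graded bracket satisfying $[x,y]=-(-1)^{|x||y|}[y,x]$ and $[x,[y,z]]=[[x,y],z]+(-1)^{|x||y|}[y,[x,z]]$ for homogeneous elements. All subalgebras and ideals are $\mathbb Z_2$-homogeneous. The free Lie superalgebra on a set $X=X_0\cup X_1$ of even generators $X_0$ and odd generators $X_1$ is the universal Lie superalgebra generated by $X$ with these parities. A Lie superalgebra is finitely presented if it is isomorphic to the quotient of a free Lie superalgebra on a finite set of homogeneous generators by an ideal generated (as an ideal) by finitely many homogeneous elements. The free Lie superalgebra on one generator $c$ is one-dimensional, spanned by $c$, if $c$ is even, and two-dimensional, spanned by $c$ and $[c,c]$, if $c$ is odd. *)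

theory Defs
  imports
    "HOL-Algebra.QuotRing"
    "HOL-Algebra.Algebraic_Closure_Type"
    "HOL-Library.Z2"
begin

section \<open>Superalgebras over a field\<close>

text \<open>
  The scalars are a field \<^typ>\<open>'k\<close> in the sense of the type class, turned into a ring record by
  \<^const>\<open>ring_of_type_algebra\<close>; the parities are the elements of the two-element field
  \<^typ>\<open>bit\<close>. The field \<^const>\<open>monoid.mult\<close> of the record holds the (nonassociative) product,
  i.e. the bracket for Lie superalgebras. The field \<^const>\<open>one\<close>, inherited from the record
  type of rings, has no meaning.
\<close>

record ('k, 'a) superalgebra = "('k, 'a) module" +
  grade :: "bit \<Rightarrow> 'a set"

abbreviation subspace_of :: "'a set \<Rightarrow> ('k::field, 'a) superalgebra \<Rightarrow> bool"
  where "subspace_of V L \<equiv> submodule V (ring_of_type_algebra :: 'k ring) L"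

definition homogeneous :: "('k, 'a) superalgebra \<Rightarrow> 'a set"
  where "homogeneous L = grade L 0 \<union> grade L 1"

locale superalgebra = module "ring_of_type_algebra :: 'k::field ring" L
  for L :: "('k::field, 'a) superalgebra" (structure) +
  assumes grade_subspace: "subspace_of (grade L p) L"
    and grade_sum: "grade L 0 <+>\<^bsub>L\<^esub> grade L 1 = carrier L"
    and grade_Int: "grade L 0 \<inter> grade L 1 = {\<zero>}"
    and grade_mult: "\<lbrakk>x \<in> grade L p; y \<in> grade L q\<rbrakk> \<Longrightarrow> x \<otimes> y \<in> grade L (p + q)"
    and add_mult: "\<lbrakk>x \<in> carrier L; y \<in> carrier L; z \<in> carrier L\<rbrakk>
          \<Longrightarrow> (x \<oplus> y) \<otimes> z = x \<otimes> z \<oplus> y \<otimes> z"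
    and mult_add: "\<lbrakk>x \<in> carrier L; y \<in> carrier L; z \<in> carrier L\<rbrakk>
          \<Longrightarrow> x \<otimes> (y \<oplus> z) = x \<otimes> y \<oplus> x \<otimes> z"
    and smult_mult: "\<lbrakk>x \<in> carrier L; y \<in> carrier L\<rbrakk> \<Longrightarrow> (c \<odot> x) \<otimes> y = c \<odot> (x \<otimes> y)"
    and mult_smult: "\<lbrakk>x \<in> carrier L; y \<in> carrier L\<rbrakk> \<Longrightarrow> x \<otimes> (c \<odot> y) = c \<odot> (x \<otimes> y)"

text \<open>The sign $(-1)^{pq}$.\<close>

definition super_sign :: "bit \<Rightarrow> bit \<Rightarrow> 'k::field"
  where "super_sign p q = (if p = 1 \<and> q = 1 then - 1 else 1)"

locale lie_superalgebra = superalgebra +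
  assumes super_skew: "\<lbrakk>x \<in> grade L p; y \<in> grade L q\<rbrakk>
          \<Longrightarrow> x \<otimes> y = \<ominus> (super_sign p q \<odot> (y \<otimes> x))"
    and super_jacobi: "\<lbrakk>x \<in> grade L p; y \<in> grade L q; z \<in> grade L r\<rbrakk>
          \<Longrightarrow> x \<otimes> (y \<otimes> z) = (x \<otimes> y) \<otimes> z \<oplus> super_sign p q \<odot> (y \<otimes> (x \<otimes> z))"


section \<open>Subalgebras, ideals, quotients, homomorphisms\<close>

definition graded_subspace :: "'a set \<Rightarrow> ('k::field, 'a) superalgebra \<Rightarrow> bool"
  where "graded_subspace V L \<longleftrightarrow>
    subspace_of V L \<and> V = (V \<inter> grade L 0) <+>\<^bsub>L\<^esub> (V \<inter> grade L 1)"

definition subsuperalgebra :: "'a set \<Rightarrow> ('k::field, 'a) superalgebra \<Rightarrow> bool"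
  where "subsuperalgebra S L \<longleftrightarrow>
    graded_subspace S L \<and> (\<forall>x\<in>S. \<forall>y\<in>S. x \<otimes>\<^bsub>L\<^esub> y \<in> S)"

definition superideal :: "'a set \<Rightarrow> ('k::field, 'a) superalgebra \<Rightarrow> bool"
  where "superideal I L \<longleftrightarrow>
    graded_subspace I L \<and> (\<forall>x\<in>I. \<forall>y\<in>carrier L. x \<otimes>\<^bsub>L\<^esub> y \<in> I \<and> y \<otimes>\<^bsub>L\<^esub> x \<in> I)"

definition subalgebra_gen :: "('k::field, 'a) superalgebra \<Rightarrow> 'a set \<Rightarrow> 'a set"
  where "subalgebra_gen L S = \<Inter>{T. subsuperalgebra T L \<and> S \<subseteq> T}"

definition ideal_gen :: "('k::field, 'a) superalgebra \<Rightarrow> 'a set \<Rightarrow> 'a set"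
  where "ideal_gen L S = \<Inter>{I. superideal I L \<and> S \<subseteq> I}"

definition restrict_to :: "('k, 'a) superalgebra \<Rightarrow> 'a set \<Rightarrow> ('k, 'a) superalgebra"
  where "restrict_to L S = L\<lparr>carrier := S, grade := (\<lambda>p. grade L p \<inter> S)\<rparr>"

definition quotient_superalgebra :: "('k, 'a) superalgebra \<Rightarrow> 'a set \<Rightarrow> ('k, 'a set) superalgebra"
  where "quotient_superalgebra L I =
    \<lparr>carrier = a_rcosets\<^bsub>L\<^esub> I,
     monoid.mult = rcoset_mult L I,
     one = I,
     zero = I,
     add = set_add L,
     module.smult = (\<lambda>c A. \<Union>x\<in>A. I +>\<^bsub>L\<^esub> (c \<odot>\<^bsub>L\<^esub> x)),
     grade = (\<lambda>p. (\<lambda>x. I +>\<^bsub>L\<^esub> x) ` grade L p)\<rparr>"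

definition superalgebra_hom ::
    "('k, 'a) superalgebra \<Rightarrow> ('k, 'b) superalgebra \<Rightarrow> ('a \<Rightarrow> 'b) set"
  where "superalgebra_hom L M =
    {h. h \<in> carrier L \<rightarrow> carrier M
      \<and> (\<forall>x\<in>carrier L. \<forall>y\<in>carrier L. h (x \<oplus>\<^bsub>L\<^esub> y) = h x \<oplus>\<^bsub>M\<^esub> h y)
      \<and> (\<forall>c. \<forall>x\<in>carrier L. h (c \<odot>\<^bsub>L\<^esub> x) = c \<odot>\<^bsub>M\<^esub> h x)
      \<and> (\<forall>x\<in>carrier L. \<forall>y\<in>carrier L. h (x \<otimes>\<^bsub>L\<^esub> y) = h x \<otimes>\<^bsub>M\<^esub> h y)
      \<and> (\<forall>p. h ` grade L p \<subseteq> grade M p)}"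

definition superalgebra_iso :: "('k, 'a) superalgebra \<Rightarrow> ('k, 'b) superalgebra \<Rightarrow> bool"
  where "superalgebra_iso L M \<longleftrightarrow>
    (\<exists>h \<in> superalgebra_hom L M. bij_betw h (carrier L) (carrier M))"


section \<open>Free Lie superalgebras\<close>

text \<open>
  The free nonassociative superalgebra on a set \<open>G\<close> of generators with parities \<open>d\<close> consists of
  the finitely supported functions on nonassociative monomials in \<open>G\<close>, the function standing for
  the linear combination with these coefficients. As every monomial is uniquely a generator or a
  product of two monomials, the coefficient of \<open>Prod s t\<close> in a product \<open>f g\<close> is \<open>f s * g t\<close>.
\<close>

datatype 'x monomial = Gen 'x | Prod "'x monomial" "'x monomial"

primrec parity :: "('x \<Rightarrow> bit) \<Rightarrow> 'x monomial \<Rightarrow> bit" where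
  "parity d (Gen x) = d x"
| "parity d (Prod s t) = parity d s + parity d t"

primrec nonassoc_mult ::
    "('x monomial \<Rightarrow> 'k::field) \<Rightarrow> ('x monomial \<Rightarrow> 'k) \<Rightarrow> 'x monomial \<Rightarrow> 'k" where
  "nonassoc_mult f g (Gen x) = 0"
| "nonassoc_mult f g (Prod s t) = f s * g t"

definition free_nonassoc ::
    "'x set \<Rightarrow> ('x \<Rightarrow> bit) \<Rightarrow> ('k::field, 'x monomial \<Rightarrow> 'k) superalgebra"
  where "free_nonassoc G d =
    \<lparr>carrier = {f. finite {t. f t \<noteq> 0} \<and> (\<forall>t. f t \<noteq> 0 \<longrightarrow> set_monomial t \<subseteq> G)},
     monoid.mult = nonassoc_mult,
     one = (\<lambda>t. 0),
     zero = (\<lambda>t. 0),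
     add = (\<lambda>f g t. f t + g t),
     module.smult = (\<lambda>c f t. c * f t),
     grade = (\<lambda>p. {f. finite {t. f t \<noteq> 0} \<and>
       (\<forall>t. f t \<noteq> 0 \<longrightarrow> set_monomial t \<subseteq> G \<and> parity d t = p)})\<rparr>"

definition lie_relators :: "('k::field, 'a) superalgebra \<Rightarrow> 'a set"
  where "lie_relators A =
    {x \<otimes>\<^bsub>A\<^esub> y \<oplus>\<^bsub>A\<^esub> super_sign p q \<odot>\<^bsub>A\<^esub> (y \<otimes>\<^bsub>A\<^esub> x) | x y p q.
       x \<in> grade A p \<and> y \<in> grade A q}
    \<union> {x \<otimes>\<^bsub>A\<^esub> (y \<otimes>\<^bsub>A\<^esub> z)
         \<ominus>\<^bsub>A\<^esub> ((x \<otimes>\<^bsub>A\<^esub> y) \<otimes>\<^bsub>A\<^esub> z \<oplus>\<^bsub>A\<^esub> super_sign p q \<odot>\<^bsub>A\<^esub> (y \<otimes>\<^bsub>A\<^esub> (x \<otimes>\<^bsub>A\<^esub> z))) | x y z p q r.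
       x \<in> grade A p \<and> y \<in> grade A q \<and> z \<in> grade A r}"

definition free_lie ::
    "'x set \<Rightarrow> ('x \<Rightarrow> bit) \<Rightarrow> ('k::field, ('x monomial \<Rightarrow> 'k) set) superalgebra"
  where "free_lie G d =
    quotient_superalgebra (free_nonassoc G d) (ideal_gen (free_nonassoc G d) (lie_relators (free_nonassoc G d)))"


section \<open>Finiteness, solubility, free subalgebras\<close>

definition finitely_generated :: "('k::field, 'a) superalgebra \<Rightarrow> bool"
  where "finitely_generated L \<longleftrightarrow>
    (\<exists>S. finite S \<and> S \<subseteq> homogeneous L \<and> subalgebra_gen L S = carrier L)"

text \<open>Finite sets of generators may be taken to consist of natural numbers.\<close>

definition finitely_presented :: "('k::field, 'a) superalgebra \<Rightarrow> bool"
  where "finitely_presented L \<longleftrightarrow>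
    (\<exists>(G :: nat set) d R. finite G \<and> finite R \<and> R \<subseteq> homogeneous (free_lie G d)
       \<and> superalgebra_iso L (quotient_superalgebra (free_lie G d) (ideal_gen (free_lie G d) R)))"

definition free_on_one_generator :: "('k::field, 'a) superalgebra \<Rightarrow> bool"
  where "free_on_one_generator L \<longleftrightarrow>
    (\<exists>p. superalgebra_iso L (free_lie {()} (\<lambda>_. p)))"

definition abelian :: "('k, 'a) superalgebra \<Rightarrow> bool"
  where "abelian L \<longleftrightarrow> (\<forall>x\<in>carrier L. \<forall>y\<in>carrier L. x \<otimes>\<^bsub>L\<^esub> y = \<zero>\<^bsub>L\<^esub>)"

text \<open>
  The free Lie superalgebra on one odd generator \<open>c\<close> has a nonzero bracket \<open>[c,c]\<close> but is soluble
  of dimension two. Containing a non-abelian free Lie superalgebra refers to those on other than one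
  generator; counting the one on \<open>c\<close> as well would force \<open>[x,x] = 0\<close> for all odd \<open>x\<close>, which fails
  for soluble Lie superalgebras and for those with a free quotient on one odd generator. The free
  generators correspond to distinct elements of \<open>L\<close>, so that subsets of the type of elements of
  \<open>L\<close> suffice as sets of generators.
\<close>

definition contains_nonabelian_free :: "('k::field, 'a) superalgebra \<Rightarrow> bool"
  where "contains_nonabelian_free L \<longleftrightarrow>
    (\<exists>S (G :: 'a set) d. subsuperalgebra S L \<and> superalgebra_iso (restrict_to L S) (free_lie G d)
       \<and> \<not> abelian (restrict_to L S) \<and> (\<nexists>c. G = {c}))"

definition linear_span :: "('k::field, 'a) superalgebra \<Rightarrow> 'a set \<Rightarrow> 'a set"
  where "linear_span L S = \<Inter>{V. subspace_of V L \<and> S \<subseteq> V}"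

primrec derived_series :: "('k::field, 'a) superalgebra \<Rightarrow> nat \<Rightarrow> 'a set" where
  "derived_series L 0 = carrier L"
| "derived_series L (Suc n) =
     linear_span L {x \<otimes>\<^bsub>L\<^esub> y | x y. x \<in> derived_series L n \<and> y \<in> derived_series L n}"

definition soluble :: "('k::field, 'a) superalgebra \<Rightarrow> bool"
  where "soluble L \<longleftrightarrow> (\<exists>n. derived_series L n = {\<zero>\<^bsub>L\<^esub>})"

end

theory Submission
  imports Defs "HOL-Library.Poly_Mapping"
begin

text \<open>Choose a homogeneous element t of L over the generator of L/I. Since [t,[t,t]] = 0 in
  characteristic other than 3, L is the sum of K t, K [t,t] and I, and t (for odd t also [t,t]) is
  independent modulo I. Hence each of the finitely many generators of L is a combination of t and
  [t,t] plus a homogeneous element b_g of I. Let C_n be the subalgebra generated by all ad(t)^j b_g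
  with j <= n. As ad(t) is a superderivation, it maps C_n into C_{n+1}.

  If C_n = C_{n+1} for some n, then K t + K [t,t] + C_n is closed under brackets and contains the
  generators, so it is L; comparing components modulo I gives I = C_n, which is finitely generated.

  Otherwise the chain increases strictly. Evaluating the finitely many relators of L uses only
  brackets inside B = C_{N+1} and brackets of t with A = C_N, for some N. So the relators already
  hold in the HNN extension of B in which t acts on A as the derivation A -> B. Some b = ad(t)^{N+1}
  b_g lies in B but not in A, and [t,b], [t,[t,b]] generate a free Lie superalgebra.

  The HNN extension enters only through its universal envelope: words in a basis of B adapted to A
  and one more letter for t, modulo the relations for brackets in B and for [t,a] with a in A. The
  letters of A are the smallest and t is the largest; then every overlap of reductions involves only
  brackets that have prescribed values, and the Jacobi identity resolves it. This diamond lemma is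
  \<open>confluent\<close> in the locale \<open>quadratic_linear\<close>, applied in
  \<open>hnn_basis\<close>; normal words are then independent modulo the ideal \<open>J\<close>. The
  degenerate case A = 0, t = 0 is a Poincare-Birkhoff-Witt theorem and embeds free Lie superalgebras
  in free associative algebras (\<open>free_lie_embedding\<close>).

  To pass from L to the envelope, \<open>assignment\<close> records which values a homomorphism
  would have to take on t, [t,t] and a member of the chain. Brackets of assigned elements are
  assigned one stage later (\<open>assignment_mult\<close>), so the relators of L evaluate into
  \<open>J\<close>, and the presentation yields a map from L to the envelope modulo \<open>J\<close>
  (\<open>super_rep_presentation\<close>). The images of [t,b] and [t,[t,b]] have leading words t b
  and t t b, which form a code whose products are all normal. So these images are free associative
  generators (\<open>subst_hom_injective\<close>), and the two elements of L are free Lie generators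
  (\<open>free_subalgebra\<close>, \<open>contains_free\<close>). Solubility is excluded by the same
  leading words: iterated brackets with nonzero normal leading words occur in every term of the
  derived series (\<open>not_soluble\<close>). The dichotomy is put together in
  \<open>finitely_generated_or_contains_free\<close>.\<close>

section \<open>Linear algebra and gradings in superalgebras\<close>

lemma ring_of_type_algebra_simps [simp]:
  "carrier ring_of_type_algebra = UNIV"
  "x \<otimes>\<^bsub>ring_of_type_algebra\<^esub> y = x * y"
  "x \<oplus>\<^bsub>ring_of_type_algebra\<^esub> y = x + y"
  "\<one>\<^bsub>ring_of_type_algebra\<^esub> = 1"
  "\<zero>\<^bsub>ring_of_type_algebra\<^esub> = 0"
  by (simp_all add: ring_of_type_algebra_def)

text \<open>Parities are added in the group \<open>bit\<close>, so their sums must stay visible to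
  the simplifier.\<close>

declare add_bit_eq_xor [simp del]

context superalgebra
begin

lemma smult_in [simp]: "x \<in> carrier L \<Longrightarrow> c \<odot> x \<in> carrier L"
  by (rule smult_closed[of c x, unfolded ring_of_type_algebra_simps, OF UNIV_I])

lemma add_smult: "x \<in> carrier L \<Longrightarrow> (a + b) \<odot> x = a \<odot> x \<oplus> b \<odot> x"
  by (rule smult_l_distr[of a b x, unfolded ring_of_type_algebra_simps, OF UNIV_I UNIV_I])

lemma smult_add: "x \<in> carrier L \<Longrightarrow> y \<in> carrier L \<Longrightarrow> c \<odot> (x \<oplus> y) = c \<odot> x \<oplus> c \<odot> y"
  by (rule smult_r_distr[of c x y, unfolded ring_of_type_algebra_simps, OF UNIV_I])

lemma mult_smult_assoc: "x \<in> carrier L \<Longrightarrow> (a * b) \<odot> x = a \<odot> (b \<odot> x)"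
  by (rule smult_assoc1[of a b x, unfolded ring_of_type_algebra_simps, OF UNIV_I UNIV_I])

lemma one_smult [simp]: "x \<in> carrier L \<Longrightarrow> 1 \<odot> x = x"
  by (rule smult_one[of x, unfolded ring_of_type_algebra_simps])

lemma zero_smult [simp]: "x \<in> carrier L \<Longrightarrow> 0 \<odot> x = \<zero>"
  by (rule smult_l_null[of x, unfolded ring_of_type_algebra_simps])

lemma smult_zero [simp]: "c \<odot> \<zero> = \<zero>"
  by (rule smult_r_null[of c, unfolded ring_of_type_algebra_simps, OF UNIV_I])

lemma minus_smult: 
  assumes "x \<in> carrier L" shows "(- c) \<odot> x = \<ominus> (c \<odot> x)"
proof -
  have "(- c) \<odot> x \<oplus> c \<odot> x = \<zero>"
    using add_smult[OF assms, of "-c" c] assms by simp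
  then show ?thesis
    using assms M.minus_equality by simp
qed

lemma a_inv_eq: "x \<in> carrier L \<Longrightarrow> \<ominus> x = (- 1) \<odot> x"
  using minus_smult[of x 1] by simp

lemma eq_if_minus_zero:
  assumes "x \<ominus> y = \<zero>" "x \<in> carrier L" "y \<in> carrier L"
  shows "x = y"
  using assms M.minus_equality[of x "\<ominus> y"] by (simp add: a_minus_def)

lemma subspace_iff: "subspace_of V L \<longleftrightarrow> V \<subseteq> carrier L \<and> \<zero> \<in> V
    \<and> (\<forall>x\<in>V. \<forall>y\<in>V. x \<oplus> y \<in> V) \<and> (\<forall>c. \<forall>x\<in>V. c \<odot> x \<in> V)"
  (is "_ \<longleftrightarrow> ?P")
proof
  assume V: "subspace_of V L"
  then have "subgroup V (add_monoid L)"
    by (rule submodule.axioms)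
  then have "\<zero> \<in> V"
    by (intro additive_subgroup.zero_closed additive_subgroupI)
  then show ?P
    using submoduleE(1,4,5)[OF V] by auto
next
  assume ?P
  then show "subspace_of V L"
    by (intro submoduleI) (auto simp: subset_eq a_inv_eq)
qed

lemma subspaceI:
  assumes "V \<subseteq> carrier L" "\<zero> \<in> V" "\<And>x y. x \<in> V \<Longrightarrow> y \<in> V \<Longrightarrow> x \<oplus> y \<in> V"
    "\<And>c x. x \<in> V \<Longrightarrow> c \<odot> x \<in> V"
  shows "subspace_of V L"
  using assms by (simp add: subspace_iff)

lemma subspaceD:
  assumes "subspace_of V L"
  shows "V \<subseteq> carrier L" "x \<in> V \<Longrightarrow> x \<in> carrier L" "\<zero> \<in> V" 
    "x \<in> V \<Longrightarrow> y \<in> V \<Longrightarrow> x \<oplus> y \<in> V" "x \<in> V \<Longrightarrow> c \<odot> x \<in> V"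
    "x \<in> V \<Longrightarrow> \<ominus> x \<in> V" "x \<in> V \<Longrightarrow> y \<in> V \<Longrightarrow> x \<ominus> y \<in> V"
  using assms by (auto simp: subspace_iff subset_eq a_inv_eq a_minus_def)

lemma subspace_carrier: "subspace_of (carrier L) L"
  by (rule subspaceI) auto

lemmas gradeD = subspaceD[OF grade_subspace]

lemma grade_in [simp]: "x \<in> grade L p \<Longrightarrow> x \<in> carrier L"
  by (rule gradeD)

text \<open>Closure under the product is not an axiom of \<open>superalgebra\<close>; it follows
  from \<open>grade_mult\<close> on homogeneous components by biadditivity.\<close>

lemma mult_in [simp]:
  assumes "x \<in> carrier L" "y \<in> carrier L"
  shows "x \<otimes> y \<in> carrier L"
proof -
  obtain x0 x1 where x: "x = x0 \<oplus> x1" "x0 \<in> grade L 0" "x1 \<in> grade L 1"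
    using assms(1) unfolding grade_sum[symmetric] set_add_def' by blast
  obtain y0 y1 where y: "y = y0 \<oplus> y1" "y0 \<in> grade L 0" "y1 \<in> grade L 1"
    using assms(2) unfolding grade_sum[symmetric] set_add_def' by blast
  have "xi \<otimes> yj \<in> carrier L" if "xi \<in> grade L p" "yj \<in> grade L q" for xi yj p q
    using grade_mult[OF that] by simp
  then show ?thesis
    using x y by (simp add: add_mult mult_add)
qed

lemma decomp:
  assumes "x \<in> carrier L"
  obtains x0 x1 where "x = x0 \<oplus> x1" "x0 \<in> grade L 0" "x1 \<in> grade L 1"
  using assms unfolding grade_sum[symmetric] set_add_def' by blast

lemma decomp_zero:
  assumes "x0 \<oplus> x1 = \<zero>" "x0 \<in> grade L 0" "x1 \<in> grade L 1"
  shows "x0 = \<zero> \<and> x1 = \<zero>"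
proof -
  have "x0 = \<ominus> x1"
    using assms M.minus_equality[of x0 x1] by auto
  then have "x0 \<in> grade L 1"
    using assms gradeD(6) by auto
  then have "x0 = \<zero>"
    using assms grade_Int by auto
  then show ?thesis
    using assms by auto
qed

lemma decomp_unique:
  assumes "x0 \<oplus> x1 = y0 \<oplus> y1" "x0 \<in> grade L 0" "x1 \<in> grade L 1" "y0 \<in> grade L 0" "y1 \<in> grade L 1"
  shows "x0 = y0 \<and> x1 = y1"
proof -
  have c: "x0 \<in> carrier L" "x1 \<in> carrier L" "y0 \<in> carrier L" "y1 \<in> carrier L"
    using assms by auto
  have "(x0 \<ominus> y0) \<oplus> (x1 \<ominus> y1) = (x0 \<oplus> x1) \<ominus> (y0 \<oplus> y1)"
    using c by (simp add: a_minus_def M.minus_add M.a_ac)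
  also have "\<dots> = \<zero>"
    unfolding assms(1) using c by (simp add: a_minus_def M.r_neg)
  finally have "x0 \<ominus> y0 = \<zero> \<and> x1 \<ominus> y1 = \<zero>"
    using assms by (intro decomp_zero) (auto intro: gradeD)
  then show ?thesis
    using c eq_if_minus_zero by blast
qed

lemma grade_disjoint: "x \<in> grade L p \<Longrightarrow> x \<in> grade L q \<Longrightarrow> p \<noteq> q \<Longrightarrow> x = \<zero>"
  using grade_Int by (cases p; cases q) auto

lemma zero_mult [simp]: "x \<in> carrier L \<Longrightarrow> \<zero> \<otimes> x = \<zero>"
  using smult_mult[of \<zero> x 0] by simp

lemma mult_zero [simp]: "x \<in> carrier L \<Longrightarrow> x \<otimes> \<zero> = \<zero>"
  using mult_smult[of x \<zero> 0] by simp

lemma neg_mult: "x \<in> carrier L \<Longrightarrow> y \<in> carrier L \<Longrightarrow> (\<ominus> x) \<otimes> y = \<ominus> (x \<otimes> y)"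
  by (simp add: a_inv_eq smult_mult)

lemma mult_neg: "x \<in> carrier L \<Longrightarrow> y \<in> carrier L \<Longrightarrow> x \<otimes> (\<ominus> y) = \<ominus> (x \<otimes> y)"
  by (simp add: a_inv_eq mult_smult)

text \<open>Being the sum of its homogeneous parts amounts, by uniqueness of decompositions, to
  containing the components of each element. All ideals and subalgebras below are checked in this
  form.\<close>

lemma graded_subspace_iff:
  "graded_subspace V L \<longleftrightarrow> subspace_of V L
    \<and> (\<forall>x0\<in>grade L 0. \<forall>x1\<in>grade L 1. x0 \<oplus> x1 \<in> V \<longrightarrow> x0 \<in> V \<and> x1 \<in> V)"
proof (cases "subspace_of V L")
  case True
  note V = subspaceD[OF True]
  have "V = set_add L (V \<inter> grade L 0) (V \<inter> grade L 1) \<longleftrightarrow>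
    (\<forall>x0\<in>grade L 0. \<forall>x1\<in>grade L 1. x0 \<oplus> x1 \<in> V \<longrightarrow> x0 \<in> V \<and> x1 \<in> V)" (is "?l \<longleftrightarrow> ?r")
  proof
    assume l: ?l
    show ?r
    proof (intro ballI impI)
      fix x0 x1 assume x: "x0 \<in> grade L 0" "x1 \<in> grade L 1" "x0 \<oplus> x1 \<in> V"
      obtain y0 y1 where "x0 \<oplus> x1 = y0 \<oplus> y1" "y0 \<in> V \<inter> grade L 0" "y1 \<in> V \<inter> grade L 1"
        using x(3) l unfolding set_add_def' by blast
      then show "x0 \<in> V \<and> x1 \<in> V"
        using decomp_unique[of x0 x1 y0 y1] x by auto
    qed
  next
    assume r: ?r
    show ?l
    proof (intro equalityI subsetI)
      fix x assume x: "x \<in> V"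
      obtain x0 x1 where "x = x0 \<oplus> x1" "x0 \<in> grade L 0" "x1 \<in> grade L 1"
        using V(2)[OF x] decomp by blast
      then show "x \<in> set_add L (V \<inter> grade L 0) (V \<inter> grade L 1)"
        using r x unfolding set_add_def' by blast
    next
      fix x assume "x \<in> set_add L (V \<inter> grade L 0) (V \<inter> grade L 1)"
      then show "x \<in> V"
        using V(4) unfolding set_add_def' by blast
    qed
  qed
  then show ?thesis
    unfolding graded_subspace_def using True by simp
qed (simp add: graded_subspace_def)

lemma superidealI:
  assumes "subspace_of I L"
    "\<And>x0 x1. x0 \<in> grade L 0 \<Longrightarrow> x1 \<in> grade L 1 \<Longrightarrow> x0 \<oplus> x1 \<in> I \<Longrightarrow> x0 \<in> I \<and> x1 \<in> I"
    "\<And>x y. x \<in> I \<Longrightarrow> y \<in> carrier L \<Longrightarrow> x \<otimes> y \<in> I \<and> y \<otimes> x \<in> I"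
  shows "superideal I L"
  using assms unfolding superideal_def graded_subspace_iff by simp

lemma subsuperalgebraI:
  assumes "subspace_of S L"
    "\<And>x0 x1. x0 \<in> grade L 0 \<Longrightarrow> x1 \<in> grade L 1 \<Longrightarrow> x0 \<oplus> x1 \<in> S \<Longrightarrow> x0 \<in> S \<and> x1 \<in> S"
    "\<And>x y. x \<in> S \<Longrightarrow> y \<in> S \<Longrightarrow> x \<otimes> y \<in> S"
  shows "subsuperalgebra S L"
  using assms unfolding subsuperalgebra_def graded_subspace_iff by simp

lemma subsuperalgebra_carrier: "subsuperalgebra (carrier L) L"
  unfolding subsuperalgebra_def graded_subspace_iff using subspace_carrier mult_in grade_in by blast

lemma superideal_carrier: "superideal (carrier L) L"
  unfolding superideal_def graded_subspace_iff using subspace_carrier mult_in grade_in by blast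

lemma graded_subspace_Inter:
  assumes T: "\<And>T. T \<in> \<T> \<Longrightarrow> graded_subspace T L" and "\<T> \<noteq> {}"
  shows "graded_subspace (\<Inter>\<T>) L"
proof -
  have sub: "subspace_of T L" if "T \<in> \<T>" for T
    using T[OF that] by (simp add: graded_subspace_iff)
  have "subspace_of (\<Inter>\<T>) L"
  proof (rule subspaceI)
    show "\<Inter>\<T> \<subseteq> carrier L"
      using assms(2) subspaceD(1)[OF sub] by blast
  qed (auto intro: subspaceD[OF sub])
  moreover have "x0 \<in> T \<and> x1 \<in> T"
    if "T \<in> \<T>" "x0 \<in> grade L 0" "x1 \<in> grade L 1" "x0 \<oplus> x1 \<in> \<Inter>\<T>" for T x0 x1
    using T[OF that(1)] that unfolding graded_subspace_iff by blast
  ultimately show ?thesis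
    unfolding graded_subspace_iff by blast
qed

lemma subsuperalgebra_Inter:
  assumes "\<And>T. T \<in> \<T> \<Longrightarrow> subsuperalgebra T L" "\<T> \<noteq> {}"
  shows "subsuperalgebra (\<Inter>\<T>) L"
  using assms graded_subspace_Inter[of \<T>] unfolding subsuperalgebra_def by blast

lemma superideal_Inter:
  assumes "\<And>T. T \<in> \<T> \<Longrightarrow> superideal T L" "\<T> \<noteq> {}"
  shows "superideal (\<Inter>\<T>) L"
  using assms graded_subspace_Inter[of \<T>] unfolding superideal_def by blast

lemma subalgebra_gen:
  assumes "S \<subseteq> carrier L"
  shows "subsuperalgebra (subalgebra_gen L S) L"
  unfolding subalgebra_gen_def using assms subsuperalgebra_carrier
  by (intro subsuperalgebra_Inter) auto

lemma ideal_gen: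
  assumes "S \<subseteq> carrier L"
  shows "superideal (ideal_gen L S) L"
  unfolding ideal_gen_def using assms superideal_carrier
  by (intro superideal_Inter) auto

end

lemma subset_subalgebra_gen: "S \<subseteq> subalgebra_gen L S"
  by (auto simp: subalgebra_gen_def)

lemma subalgebra_gen_least: "subsuperalgebra T L \<Longrightarrow> S \<subseteq> T \<Longrightarrow> subalgebra_gen L S \<subseteq> T"
  by (auto simp: subalgebra_gen_def)

lemma subset_ideal_gen: "S \<subseteq> ideal_gen L S"
  by (auto simp: ideal_gen_def)

lemma ideal_gen_least: "superideal T L \<Longrightarrow> S \<subseteq> T \<Longrightarrow> ideal_gen L S \<subseteq> T"
  by (auto simp: ideal_gen_def)

section \<open>Quotients and homomorphisms\<close>

context superalgebra
begin

lemma mem_coset_iff: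
  assumes "subspace_of I L" "x \<in> carrier L"
  shows "y \<in> I +> x \<longleftrightarrow> y \<in> carrier L \<and> y \<ominus> x \<in> I"
proof
  assume "y \<in> I +> x"
  then obtain h where h: "h \<in> I" "y = h \<oplus> x"
    unfolding a_r_coset_def' by blast
  then have "h \<in> carrier L"
    using subspaceD(1)[OF assms(1)] by blast
  then show "y \<in> carrier L \<and> y \<ominus> x \<in> I"
    using h assms(2) by (simp add: a_minus_def M.a_assoc M.r_neg)
next
  assume y: "y \<in> carrier L \<and> y \<ominus> x \<in> I"
  then have "y = (y \<ominus> x) \<oplus> x"
    using assms(2) by (simp add: a_minus_def M.a_assoc M.l_neg)
  then show "y \<in> I +> x"
    unfolding a_r_coset_def' using y by blast
qed

lemma coset_eq_iff:
  assumes "subspace_of I L" "x \<in> carrier L" "y \<in> carrier L"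
  shows "I +> x = I +> y \<longleftrightarrow> x \<ominus> y \<in> I"
proof
  assume "I +> x = I +> y"
  moreover have "x \<in> I +> x"
    using assms by (simp add: mem_coset_iff a_minus_def M.r_neg subspaceD(3))
  ultimately show "x \<ominus> y \<in> I"
    using assms mem_coset_iff by blast
next
  assume xy: "x \<ominus> y \<in> I"
  then have yx: "y \<ominus> x \<in> I"
    using subspaceD(6)[OF assms(1) xy] assms by (simp add: a_minus_def M.minus_add M.a_comm)
  have "(z \<ominus> x \<in> I) = (z \<ominus> y \<in> I)" if "z \<in> carrier L" for z
  proof -
    have "u \<ominus> w = (u \<ominus> v) \<oplus> (v \<ominus> w)"
      if "u \<in> carrier L" "v \<in> carrier L" "w \<in> carrier L" for u v w
      using that by (simp add: a_minus_def M.a_assoc M.r_neg1)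
    then have "z \<ominus> y = (z \<ominus> x) \<oplus> (x \<ominus> y)" "z \<ominus> x = (z \<ominus> y) \<oplus> (y \<ominus> x)"
      using assms that by blast+
    then show ?thesis
      using subspaceD(4)[OF assms(1)] xy yx by metis
  qed
  then show "I +> x = I +> y"
    using assms by (auto simp: mem_coset_iff)
qed

lemma coset_zero:
  assumes "subspace_of I L"
  shows "I +> \<zero> = I"
  using subspaceD(1)[OF assms] by simp

lemma coset_eq_zero_iff:
  assumes "subspace_of I L" "x \<in> carrier L"
  shows "I +> x = I \<longleftrightarrow> x \<in> I"
proof -
  have "x \<ominus> \<zero> = x"
    using assms by (simp add: a_minus_def a_inv_eq)
  then show ?thesis
    using coset_eq_iff[OF assms M.zero_closed] assms by (simp add: coset_zero)
qed

lemma superidealD: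
  assumes "superideal I L"
  shows "subspace_of I L" "x \<in> I \<Longrightarrow> y \<in> carrier L \<Longrightarrow> x \<otimes> y \<in> I"
    "x \<in> I \<Longrightarrow> y \<in> carrier L \<Longrightarrow> y \<otimes> x \<in> I"
    "x0 \<in> grade L 0 \<Longrightarrow> x1 \<in> grade L 1 \<Longrightarrow> x0 \<oplus> x1 \<in> I \<Longrightarrow> x0 \<in> I \<and> x1 \<in> I"
  using assms unfolding superideal_def graded_subspace_iff by blast+

lemma subsuperalgebraD:
  assumes "subsuperalgebra S L"
  shows "subspace_of S L" "x \<in> S \<Longrightarrow> y \<in> S \<Longrightarrow> x \<otimes> y \<in> S"
    "x0 \<in> grade L 0 \<Longrightarrow> x1 \<in> grade L 1 \<Longrightarrow> x0 \<oplus> x1 \<in> S \<Longrightarrow> x0 \<in> S \<and> x1 \<in> S"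
  using assms unfolding subsuperalgebra_def graded_subspace_iff by blast+

lemma superideal_subsuperalgebra: "superideal I L \<Longrightarrow> subsuperalgebra I L"
  unfolding superideal_def subsuperalgebra_def graded_subspace_iff subspace_iff by blast

context
  fixes I
  assumes I: "superideal I L"
begin

lemmas I_sub = superidealD(1)[OF I]

lemma quotient_carrier: "carrier (quotient_superalgebra L I) = (\<lambda>x. I +> x) ` carrier L"
  by (auto simp: quotient_superalgebra_def A_RCOSETS_def')

lemma quotient_grade: "grade (quotient_superalgebra L I) p = (\<lambda>x. I +> x) ` grade L p"
  by (simp add: quotient_superalgebra_def)

lemma quotient_carrierE:
  assumes "W \<in> carrier (quotient_superalgebra L I)"
  obtains x where "x \<in> carrier L" "W = I +> x"
  using assms unfolding quotient_carrier by blast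

lemma quotient_gradeE:
  assumes "W \<in> grade (quotient_superalgebra L I) p"
  obtains x where "x \<in> grade L p" "W = I +> x"
  using assms unfolding quotient_grade by blast

lemma quotient_zero: "\<zero>\<^bsub>quotient_superalgebra L I\<^esub> = I +> \<zero>"
  by (simp add: quotient_superalgebra_def coset_zero[OF I_sub])

lemma quotient_add:
  assumes "x \<in> carrier L" "y \<in> carrier L"
  shows "(I +> x) \<oplus>\<^bsub>quotient_superalgebra L I\<^esub> (I +> y) = I +> (x \<oplus> y)"
proof -
  have "additive_subgroup I L"
    using I_sub by (intro additive_subgroupI submodule.axioms)
  then interpret abelian_subgroup I L
    by (rule abelian_subgroupI3) (rule M.abelian_group_axioms)
  show ?thesis
    using a_rcos_sum[OF assms] by (simp add: quotient_superalgebra_def)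
qed

lemma quotient_smult:
  assumes "x \<in> carrier L"
  shows "c \<odot>\<^bsub>quotient_superalgebra L I\<^esub> (I +> x) = I +> (c \<odot> x)"
proof -
  have "I +> (c \<odot> y) = I +> (c \<odot> x)" if "y \<in> I +> x" for y
  proof -
    have y: "y \<in> carrier L" "y \<ominus> x \<in> I"
      using that assms by (auto simp: mem_coset_iff[OF I_sub])
    have "c \<odot> y \<ominus> c \<odot> x = c \<odot> (y \<ominus> x)"
      using y assms by (simp add: a_minus_def smult_add a_inv_eq flip: mult_smult_assoc)
    then show ?thesis
      using y assms subspaceD(5)[OF I_sub] by (subst coset_eq_iff[OF I_sub]) auto
  qed
  moreover have "x \<in> I +> x"
    using assms by (simp add: mem_coset_iff[OF I_sub] a_minus_def M.r_neg subspaceD(3)[OF I_sub])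
  ultimately have "(\<Union>y\<in>I +> x. I +> (c \<odot> y)) = I +> (c \<odot> x)"
    by blast
  then show ?thesis
    by (simp add: quotient_superalgebra_def)
qed

lemma quotient_mult:
  assumes "x \<in> carrier L" "y \<in> carrier L"
  shows "(I +> x) \<otimes>\<^bsub>quotient_superalgebra L I\<^esub> (I +> y) = I +> (x \<otimes> y)"
proof -
  have "I +> (a \<otimes> b) = I +> (x \<otimes> y)" if "a \<in> I +> x" "b \<in> I +> y" for a b
  proof -
    have a: "a \<in> carrier L" "a \<ominus> x \<in> I" and b: "b \<in> carrier L" "b \<ominus> y \<in> I"
      using that assms by (auto simp: mem_coset_iff[OF I_sub])
    have "a \<otimes> b \<ominus> x \<otimes> y = (a \<ominus> x) \<otimes> b \<oplus> x \<otimes> (b \<ominus> y)"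
      using a b assms by (simp add: a_minus_def add_mult mult_add neg_mult mult_neg M.a_assoc M.r_neg1)
    also have "\<dots> \<in> I"
      using a b assms superidealD(2,3)[OF I] subspaceD(4)[OF I_sub] by blast
    finally show ?thesis
      using a b assms by (subst coset_eq_iff[OF I_sub]) auto
  qed
  moreover have "x \<in> I +> x" "y \<in> I +> y"
    using assms by (auto simp add: mem_coset_iff[OF I_sub] a_minus_def M.r_neg subspaceD(3)[OF I_sub])
  ultimately have "(\<Union>a\<in>I +> x. \<Union>b\<in>I +> y. I +> (a \<otimes> b)) = I +> (x \<otimes> y)"
    by blast
  then show ?thesis
    by (simp add: quotient_superalgebra_def rcoset_mult_def)
qed

lemmas quotient_simps = quotient_carrier quotient_grade quotient_zero quotient_add quotient_smult quotient_mult

lemma quotient_hom: "(\<lambda>x. I +> x) \<in> superalgebra_hom L (quotient_superalgebra L I)"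
  unfolding superalgebra_hom_def
  by (intro CollectI conjI ballI allI funcsetI) (simp_all add: quotient_simps)

lemma quotient_superalgebra: "superalgebra (quotient_superalgebra L I)"
proof -
  let ?Q = "quotient_superalgebra L I"
  have "\<exists>y\<in>carrier ?Q. y \<oplus>\<^bsub>?Q\<^esub> W = \<zero>\<^bsub>?Q\<^esub>" if W: "W \<in> carrier ?Q" for W
  proof -
    obtain x where "x \<in> carrier L" "W = I +> x"
      using W by (rule quotient_carrierE)
    then show ?thesis
      by (intro bexI[of _ "I +> (\<ominus> x)"]) (auto simp: quotient_simps M.l_neg)
  qed
  then have ag: "abelian_group ?Q"
    by (intro abelian_groupI) (auto simp: quotient_simps M.a_ac)
  interpret Q: module "ring_of_type_algebra" ?Q
    by (intro moduleI ag cring_from_type_algebra)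
       (auto simp: quotient_simps smult_add add_smult mult_smult_assoc)
  have sub: "subspace_of (grade ?Q p) ?Q" for p
  proof (rule Q.submoduleI)
    fix W assume "W \<in> grade ?Q p"
    then obtain x where x: "x \<in> grade L p" "W = I +> x"
      by (elim quotient_gradeE) simp
    have "\<ominus>\<^bsub>?Q\<^esub> W = I +> (\<ominus> x)"
      using x by (intro Q.M.minus_equality) (auto simp: quotient_simps M.l_neg)
    then show "\<ominus>\<^bsub>?Q\<^esub> W \<in> grade ?Q p"
      using x by (auto simp: quotient_grade gradeD)
  next
    fix W Y assume "W \<in> grade ?Q p" "Y \<in> grade ?Q p"
    then obtain x y where "x \<in> grade L p" "W = I +> x" "y \<in> grade L p" "Y = I +> y"
      by (elim quotient_gradeE) simp
    then show "W \<oplus>\<^bsub>?Q\<^esub> Y \<in> grade ?Q p"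
      using gradeD(4)[of x p y] by (auto simp: quotient_add quotient_grade)
  next
    fix c W assume "W \<in> grade ?Q p"
    then obtain x where "x \<in> grade L p" "W = I +> x"
      by (elim quotient_gradeE) simp
    then show "c \<odot>\<^bsub>?Q\<^esub> W \<in> grade ?Q p"
      using gradeD(5)[of x p c] by (auto simp: quotient_smult quotient_grade)
  qed (auto simp: quotient_carrier quotient_grade quotient_zero gradeD)
  have sum: "grade ?Q 0 <+>\<^bsub>?Q\<^esub> grade ?Q 1 = carrier ?Q"
  proof (intro equalityI subsetI)
    fix W assume "W \<in> carrier ?Q"
    then obtain x where x: "x \<in> carrier L" "W = I +> x"
      by (elim quotient_carrierE) simp
    then obtain x0 x1 where "x = x0 \<oplus> x1" "x0 \<in> grade L 0" "x1 \<in> grade L 1"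
      using decomp by blast
    then have "W = (I +> x0) \<oplus>\<^bsub>?Q\<^esub> (I +> x1)" "I +> x0 \<in> grade ?Q 0" "I +> x1 \<in> grade ?Q 1"
      using x by (auto simp: quotient_add quotient_grade)
    then show "W \<in> grade ?Q 0 <+>\<^bsub>?Q\<^esub> grade ?Q 1"
      unfolding set_add_def' by blast
  qed (auto simp: set_add_def' quotient_simps)
  have int: "grade ?Q 0 \<inter> grade ?Q 1 = {\<zero>\<^bsub>?Q\<^esub>}"
  proof (intro equalityI subsetI)
    fix W assume "W \<in> grade ?Q 0 \<inter> grade ?Q 1"
    then obtain x0 x1 where x: "W = I +> x0" "W = I +> x1" "x0 \<in> grade L 0" "x1 \<in> grade L 1"
      unfolding quotient_grade by blast
    then have "x0 \<ominus> x1 \<in> I"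
      using coset_eq_iff[OF I_sub, of x0 x1] by simp
    \<comment> \<open>\<open>x0\<close> and \<open>\<ominus> x1\<close> are the homogeneous
      components of an element of the graded ideal \<open>I\<close>.\<close>
    then have "x0 \<in> I"
      using superidealD(4)[OF I, of x0 "\<ominus> x1"] x gradeD(6) by (simp add: a_minus_def)
    then show "W \<in> {\<zero>\<^bsub>?Q\<^esub>}"
      using x coset_eq_zero_iff[OF I_sub, of x0] by (simp add: quotient_zero coset_zero[OF I_sub])
  qed (auto simp: quotient_grade quotient_zero gradeD)
  have mult: "W \<otimes>\<^bsub>?Q\<^esub> V \<in> grade ?Q (p + q)" if "W \<in> grade ?Q p" "V \<in> grade ?Q q" for W V p q
    using that grade_mult by (elim quotient_gradeE) (simp only: quotient_mult quotient_grade grade_in imageI)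
  show ?thesis
    by (intro superalgebra.intro superalgebra_axioms.intro Q.module_axioms sub sum int mult;
        (elim quotient_carrierE)?;
        simp add: quotient_simps add_mult mult_add smult_mult mult_smult)
qed

lemma quotient_lie_superalgebra:
  assumes "lie_relators L \<subseteq> I"
  shows "lie_superalgebra (quotient_superalgebra L I)"
proof -
  let ?Q = "quotient_superalgebra L I"
  interpret Q: superalgebra ?Q
    by (rule quotient_superalgebra)
  show ?thesis
  proof
    fix W Y p q assume "W \<in> grade ?Q p" "Y \<in> grade ?Q q"
    then obtain x y where x: "x \<in> grade L p" "W = I +> x" "y \<in> grade L q" "Y = I +> y"
      by (elim quotient_gradeE) simp
    then have "x \<otimes> y \<oplus> super_sign p q \<odot> (y \<otimes> x) \<in> I"
      using assms unfolding lie_relators_def by blast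
    then have "W \<otimes>\<^bsub>?Q\<^esub> Y \<oplus>\<^bsub>?Q\<^esub> super_sign p q \<odot>\<^bsub>?Q\<^esub> (Y \<otimes>\<^bsub>?Q\<^esub> W) = \<zero>\<^bsub>?Q\<^esub>"
      using x coset_eq_zero_iff[OF I_sub] by (simp add: quotient_simps coset_zero[OF I_sub])
    then show "W \<otimes>\<^bsub>?Q\<^esub> Y = \<ominus>\<^bsub>?Q\<^esub> (super_sign p q \<odot>\<^bsub>?Q\<^esub> (Y \<otimes>\<^bsub>?Q\<^esub> W))"
      using Q.M.minus_equality[symmetric, of "W \<otimes>\<^bsub>?Q\<^esub> Y"] x by (auto simp: quotient_simps)
  next
    fix W Y Z p q r assume "W \<in> grade ?Q p" "Y \<in> grade ?Q q" "Z \<in> grade ?Q r"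
    then obtain x y z where x: "x \<in> grade L p" "W = I +> x" "y \<in> grade L q" "Y = I +> y"
        "z \<in> grade L r" "Z = I +> z"
      by (elim quotient_gradeE) simp
    then have "x \<otimes> (y \<otimes> z) \<ominus> ((x \<otimes> y) \<otimes> z \<oplus> super_sign p q \<odot> (y \<otimes> (x \<otimes> z))) \<in> I"
      using assms unfolding lie_relators_def by blast
    then have "I +> (x \<otimes> (y \<otimes> z)) = I +> ((x \<otimes> y) \<otimes> z \<oplus> super_sign p q \<odot> (y \<otimes> (x \<otimes> z)))"
      using x by (intro coset_eq_iff[OF I_sub, THEN iffD2]) auto
    then show "W \<otimes>\<^bsub>?Q\<^esub> (Y \<otimes>\<^bsub>?Q\<^esub> Z) = (W \<otimes>\<^bsub>?Q\<^esub> Y) \<otimes>\<^bsub>?Q\<^esub> Z \<oplus>\<^bsub>?Q\<^esub>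
        super_sign p q \<odot>\<^bsub>?Q\<^esub> (Y \<otimes>\<^bsub>?Q\<^esub> (W \<otimes>\<^bsub>?Q\<^esub> Z))"
      using x by (auto simp: quotient_simps)
  qed
qed

end

end

lemma superalgebra_homD:
  assumes "h \<in> superalgebra_hom L M"
  shows "x \<in> carrier L \<Longrightarrow> h x \<in> carrier M"
    "x \<in> carrier L \<Longrightarrow> y \<in> carrier L \<Longrightarrow> h (x \<oplus>\<^bsub>L\<^esub> y) = h x \<oplus>\<^bsub>M\<^esub> h y"
    "x \<in> carrier L \<Longrightarrow> h (c \<odot>\<^bsub>L\<^esub> x) = c \<odot>\<^bsub>M\<^esub> h x"
    "x \<in> carrier L \<Longrightarrow> y \<in> carrier L \<Longrightarrow> h (x \<otimes>\<^bsub>L\<^esub> y) = h x \<otimes>\<^bsub>M\<^esub> h y"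
    "x \<in> grade L p \<Longrightarrow> h x \<in> grade M p"
  using assms unfolding superalgebra_hom_def by blast+

lemma superalgebra_hom_comp:
  assumes "g \<in> superalgebra_hom L M" "h \<in> superalgebra_hom M N"
  shows "(\<lambda>x. h (g x)) \<in> superalgebra_hom L N"
  unfolding superalgebra_hom_def
  by (intro CollectI conjI ballI allI funcsetI image_subsetI)
    (simp_all add: superalgebra_homD[OF assms(1)] superalgebra_homD[OF assms(2)])

locale superalgebra_homomorphism = L: superalgebra L + M: superalgebra M
  for L :: "('k::field, 'a) superalgebra" and M :: "('k, 'b) superalgebra" +
  fixes h
  assumes hom: "h \<in> superalgebra_hom L M"
begin

lemmas homD [simp] = superalgebra_homD[OF hom]

lemma hom_zero [simp]: "h \<zero>\<^bsub>L\<^esub> = \<zero>\<^bsub>M\<^esub>"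
  using homD(3)[of "\<zero>\<^bsub>L\<^esub>" 0] homD(1)[of "\<zero>\<^bsub>L\<^esub>"] by (simp del: homD)

lemma hom_minus:
  assumes "x \<in> carrier L" "y \<in> carrier L"
  shows "h (x \<ominus>\<^bsub>L\<^esub> y) = h x \<ominus>\<^bsub>M\<^esub> h y"
  using assms by (simp add: a_minus_def L.a_inv_eq M.a_inv_eq)

lemma vimage_superideal:
  assumes "superideal J M"
  shows "superideal {x \<in> carrier L. h x \<in> J} L"
proof (rule L.superidealI)
  note J = M.superidealD[OF assms] M.subspaceD[OF M.superidealD(1)[OF assms]]
  show "subspace_of {x \<in> carrier L. h x \<in> J} L"
  proof (rule L.subspaceI)
    show "{x \<in> carrier L. h x \<in> J} \<subseteq> carrier L"
      by (rule Collect_restrict)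
    show "\<zero>\<^bsub>L\<^esub> \<in> {x \<in> carrier L. h x \<in> J}"
      using J(7) by simp
    show "x \<oplus>\<^bsub>L\<^esub> y \<in> {x \<in> carrier L. h x \<in> J}"
      if "x \<in> {x \<in> carrier L. h x \<in> J}" "y \<in> {x \<in> carrier L. h x \<in> J}" for x y
      using J(8)[of "h x" "h y"] that by simp
    show "c \<odot>\<^bsub>L\<^esub> x \<in> {x \<in> carrier L. h x \<in> J}"
      if "x \<in> {x \<in> carrier L. h x \<in> J}" for c x
      using J(9)[of "h x" c] that by simp
  qed
  show "x0 \<in> {x \<in> carrier L. h x \<in> J} \<and> x1 \<in> {x \<in> carrier L. h x \<in> J}"
    if x: "x0 \<in> grade L 0" "x1 \<in> grade L 1" "x0 \<oplus>\<^bsub>L\<^esub> x1 \<in> {x \<in> carrier L. h x \<in> J}" for x0 x1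
    using J(4)[of "h x0" "h x1"] x by simp
  show "x \<otimes>\<^bsub>L\<^esub> y \<in> {x \<in> carrier L. h x \<in> J} \<and> y \<otimes>\<^bsub>L\<^esub> x \<in> {x \<in> carrier L. h x \<in> J}"
    if "x \<in> {x \<in> carrier L. h x \<in> J}" "y \<in> carrier L" for x y
    using that J(2)[of "h x" "h y"] J(3)[of "h x" "h y"] by simp
qed

lemma zero_superideal: "superideal {\<zero>\<^bsub>M\<^esub>} M"
proof (intro M.superidealI M.subspaceI)
  show "x0 \<in> {\<zero>\<^bsub>M\<^esub>} \<and> x1 \<in> {\<zero>\<^bsub>M\<^esub>}"
    if "x0 \<in> grade M 0" "x1 \<in> grade M 1" "x0 \<oplus>\<^bsub>M\<^esub> x1 \<in> {\<zero>\<^bsub>M\<^esub>}" for x0 x1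
    using M.decomp_zero[of x0 x1] that by simp
qed simp_all

lemma kernel_superideal: "superideal {x \<in> carrier L. h x = \<zero>\<^bsub>M\<^esub>} L"
  using vimage_superideal[OF zero_superideal] by simp

text \<open>Surjectivity is what allows every multiplier from \<open>M\<close> to be lifted to
  \<open>L\<close>.\<close>

lemma image_superideal:
  assumes J: "superideal J L" and onto: "h ` carrier L = carrier M"
  shows "superideal (h ` J) M"
proof -
  note J' = L.superidealD[OF J] L.subspaceD[OF L.superidealD(1)[OF J]]
  have sub: "subspace_of (h ` J) M"
  proof (rule M.subspaceI)
    fix u v assume "u \<in> h ` J" "v \<in> h ` J"
    then obtain x y where "x \<in> J" "y \<in> J" "u = h x" "v = h y"
      by blast
    then show "u \<oplus>\<^bsub>M\<^esub> v \<in> h ` J"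
      using J'(8)[of x y] by (auto intro!: rev_image_eqI[of "x \<oplus>\<^bsub>L\<^esub> y"] simp: J'(6))
  next
    fix c u assume "u \<in> h ` J"
    then obtain x where "x \<in> J" "u = h x"
      by blast
    then show "c \<odot>\<^bsub>M\<^esub> u \<in> h ` J"
      using J'(9)[of x c] by (auto intro!: rev_image_eqI[of "c \<odot>\<^bsub>L\<^esub> x"] simp: J'(6))
  next
    show "\<zero>\<^bsub>M\<^esub> \<in> h ` J"
      using J'(7) by (auto intro!: rev_image_eqI[of "\<zero>\<^bsub>L\<^esub>"])
  qed (auto simp: J'(6))
  have mult: "u \<otimes>\<^bsub>M\<^esub> v \<in> h ` J \<and> v \<otimes>\<^bsub>M\<^esub> u \<in> h ` J" if uv: "u \<in> h ` J" "v \<in> carrier M" for u v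
  proof -
    obtain x y where "x \<in> J" "y \<in> carrier L" "u = h x" "v = h y"
      using uv unfolding onto[symmetric] by blast
    then show ?thesis
      using J'(2)[of x y] J'(3)[of x y]
        rev_image_eqI[of "x \<otimes>\<^bsub>L\<^esub> y" J "u \<otimes>\<^bsub>M\<^esub> v" h] rev_image_eqI[of "y \<otimes>\<^bsub>L\<^esub> x" J "v \<otimes>\<^bsub>M\<^esub> u" h]
      by (simp add: J'(6))
  qed
  have "u0 \<in> h ` J \<and> u1 \<in> h ` J"
    if u: "u0 \<in> grade M 0" "u1 \<in> grade M 1" "u0 \<oplus>\<^bsub>M\<^esub> u1 \<in> h ` J" for u0 u1
  proof -
    obtain x where x: "x \<in> J" "u0 \<oplus>\<^bsub>M\<^esub> u1 = h x"
      using u by blast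
    then obtain x0 x1 where xx: "x = x0 \<oplus>\<^bsub>L\<^esub> x1" "x0 \<in> grade L 0" "x1 \<in> grade L 1"
      using L.decomp[OF J'(6)[OF x(1)]] by blast
    have "u0 \<oplus>\<^bsub>M\<^esub> u1 = h x0 \<oplus>\<^bsub>M\<^esub> h x1"
      using x xx by simp
    then have "u0 = h x0 \<and> u1 = h x1"
      using xx u by (intro M.decomp_unique) auto
    then show ?thesis
      using J'(4)[of x0 x1] xx x by simp
  qed
  then show ?thesis
    using sub mult by (intro M.superidealI)
qed

lemma image_subsuperalgebra: "subsuperalgebra (h ` carrier L) M"
proof (intro M.subsuperalgebraI M.subspaceI)
  fix u v assume "u \<in> h ` carrier L" "v \<in> h ` carrier L"
  then obtain x y where "x \<in> carrier L" "y \<in> carrier L" "u = h x" "v = h y"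
    by blast
  then show "u \<oplus>\<^bsub>M\<^esub> v \<in> h ` carrier L" "u \<otimes>\<^bsub>M\<^esub> v \<in> h ` carrier L"
    using rev_image_eqI[of "x \<oplus>\<^bsub>L\<^esub> y" "carrier L" "u \<oplus>\<^bsub>M\<^esub> v" h]
      rev_image_eqI[of "x \<otimes>\<^bsub>L\<^esub> y" "carrier L" "u \<otimes>\<^bsub>M\<^esub> v" h]
    by simp_all
next
  fix c u assume "u \<in> h ` carrier L"
  then obtain x where "x \<in> carrier L" "u = h x"
    by blast
  then show "c \<odot>\<^bsub>M\<^esub> u \<in> h ` carrier L"
    by (auto intro!: rev_image_eqI[of "c \<odot>\<^bsub>L\<^esub> x"])
next
  show "\<zero>\<^bsub>M\<^esub> \<in> h ` carrier L"
    by (auto intro!: rev_image_eqI[of "\<zero>\<^bsub>L\<^esub>"])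
next
  fix u0 u1 assume u: "u0 \<in> grade M 0" "u1 \<in> grade M 1" "u0 \<oplus>\<^bsub>M\<^esub> u1 \<in> h ` carrier L"
  then obtain x where "x \<in> carrier L" "u0 \<oplus>\<^bsub>M\<^esub> u1 = h x"
    by blast
  moreover obtain x0 x1 where xx: "x = x0 \<oplus>\<^bsub>L\<^esub> x1" "x0 \<in> grade L 0" "x1 \<in> grade L 1"
    using L.decomp calculation(1) by blast
  ultimately have "u0 \<oplus>\<^bsub>M\<^esub> u1 = h x0 \<oplus>\<^bsub>M\<^esub> h x1"
    by simp
  then have "u0 = h x0 \<and> u1 = h x1"
    using xx u by (intro M.decomp_unique) auto
  then show "u0 \<in> h ` carrier L \<and> u1 \<in> h ` carrier L"
    using xx by simp
qed auto

text \<open>The inverse isomorphism sends an element of the image to its fibre, which is a coset of the kernel.\<close>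

lemma first_isomorphism:
  assumes K: "K = {x \<in> carrier L. h x = \<zero>\<^bsub>M\<^esub>}"
  shows "superalgebra_iso (restrict_to M (h ` carrier L)) (quotient_superalgebra L K)"
proof -
  let ?Q = "quotient_superalgebra L K" and ?S = "restrict_to M (h ` carrier L)"
  have K_ideal: "superideal K L"
    unfolding K by (rule kernel_superideal)
  note Q = L.quotient_simps[OF K_ideal]
  define g where "g u = {x \<in> carrier L. h x = u}" for u
  have g: "g (h x) = K +>\<^bsub>L\<^esub> x" if "x \<in> carrier L" for x
  proof -
    have "h y = h x \<longleftrightarrow> y \<ominus>\<^bsub>L\<^esub> x \<in> K" if y: "y \<in> carrier L" for y
    proof -
      have "h (y \<ominus>\<^bsub>L\<^esub> x) = \<zero>\<^bsub>M\<^esub> \<longleftrightarrow> h y = h x"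
        using y \<open>x \<in> carrier L\<close> M.eq_if_minus_zero[of "h y" "h x"] M.M.r_neg[of "h x"]
        unfolding hom_minus[OF y \<open>x \<in> carrier L\<close>] by (auto simp: a_minus_def)
      then show ?thesis
        using y \<open>x \<in> carrier L\<close> by (simp add: K)
    qed
    then show ?thesis
      using that by (auto simp: g_def L.mem_coset_iff[OF L.superidealD(1)[OF K_ideal]])
  qed
  have S: "carrier ?S = h ` carrier L" "grade ?S p = grade M p \<inter> h ` carrier L"
    "x \<oplus>\<^bsub>?S\<^esub> y = x \<oplus>\<^bsub>M\<^esub> y" "x \<otimes>\<^bsub>?S\<^esub> y = x \<otimes>\<^bsub>M\<^esub> y" "c \<odot>\<^bsub>?S\<^esub> x = c \<odot>\<^bsub>M\<^esub> x" for p x y c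
    by (simp_all add: restrict_to_def)
  have "g \<in> superalgebra_hom ?S ?Q"
    unfolding superalgebra_hom_def
  proof (intro CollectI conjI ballI allI)
    show "g \<in> carrier ?S \<rightarrow> carrier ?Q"
      by (auto simp: S Q g)
  next
    fix u v assume "u \<in> carrier ?S" "v \<in> carrier ?S"
    then obtain x y where xy: "x \<in> carrier L" "y \<in> carrier L" "u = h x" "v = h y"
      by (auto simp: S)
    then show "g (u \<oplus>\<^bsub>?S\<^esub> v) = g u \<oplus>\<^bsub>?Q\<^esub> g v"
      using g[of "x \<oplus>\<^bsub>L\<^esub> y"] by (simp add: S Q g)
    show "g (u \<otimes>\<^bsub>?S\<^esub> v) = g u \<otimes>\<^bsub>?Q\<^esub> g v"
      using g[of "x \<otimes>\<^bsub>L\<^esub> y"] xy by (simp add: S Q g)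
  next
    fix c u assume "u \<in> carrier ?S"
    then obtain x where "x \<in> carrier L" "u = h x"
      by (auto simp: S)
    then show "g (c \<odot>\<^bsub>?S\<^esub> u) = c \<odot>\<^bsub>?Q\<^esub> g u"
      using g[of "c \<odot>\<^bsub>L\<^esub> x"] by (simp add: S Q g)
  next
    fix p show "g ` grade ?S p \<subseteq> grade ?Q p"
    proof
      fix U assume "U \<in> g ` grade ?S p"
      then obtain x where x: "x \<in> carrier L" "h x \<in> grade M p" "U = g (h x)"
        by (auto simp: S)
      obtain x0 x1 where xx: "x = x0 \<oplus>\<^bsub>L\<^esub> x1" "x0 \<in> grade L 0" "x1 \<in> grade L 1"
        using L.decomp x(1) by blast
      \<comment> \<open>A preimage of a homogeneous element need not be homogeneous, but its
        component of the right parity is again a preimage, because decompositions in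
        \<open>M\<close> are unique.\<close>
      have "\<exists>y \<in> grade L p. h y = h x"
      proof (cases p)
        case zero
        then have "h x0 \<oplus>\<^bsub>M\<^esub> h x1 = h x \<oplus>\<^bsub>M\<^esub> \<zero>\<^bsub>M\<^esub>"
          using xx x by simp
        then have "h x0 = h x"
          using M.decomp_unique[of "h x0" "h x1" "h x" "\<zero>\<^bsub>M\<^esub>"] xx x zero M.gradeD(3) by auto
        then show ?thesis
          using xx zero by blast
      next
        case one
        then have "h x0 \<oplus>\<^bsub>M\<^esub> h x1 = \<zero>\<^bsub>M\<^esub> \<oplus>\<^bsub>M\<^esub> h x"
          using xx x by simp
        then have "h x1 = h x"
          using M.decomp_unique[of "h x0" "h x1" "\<zero>\<^bsub>M\<^esub>" "h x"] xx x one M.gradeD(3) by auto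
        then show ?thesis
          using xx one by blast
      qed
      then obtain y where y: "y \<in> grade L p" "h y = h x"
        by blast
      then have "U = K +>\<^bsub>L\<^esub> y"
        using x(3) g[of y] by simp
      then show "U \<in> grade ?Q p"
        using y by (simp add: Q(2))
    qed
  qed
  moreover have "bij_betw g (carrier ?S) (carrier ?Q)"
  proof (rule bij_betw_imageI)
    show "inj_on g (carrier ?S)"
      unfolding S g_def by (intro inj_onI) blast
    have "g ` h ` carrier L = (\<lambda>x. K +>\<^bsub>L\<^esub> x) ` carrier L"
      unfolding image_image by (intro image_cong refl g)
    then show "g ` carrier ?S = carrier ?Q"
      by (simp add: S Q(1))
  qed
  ultimately show ?thesis
    unfolding superalgebra_iso_def by blast
qed

end

section \<open>Linear combinations and adapted bases\<close>

abbreviation (input) "lookup \<equiv> Poly_Mapping.lookup"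
abbreviation (input) "single \<equiv> Poly_Mapping.single"
abbreviation (input) "keys \<equiv> Poly_Mapping.keys"

definition scl :: "'k::field \<Rightarrow> ('i \<Rightarrow>\<^sub>0 'k) \<Rightarrow> 'i \<Rightarrow>\<^sub>0 'k"
  where "scl c a = Poly_Mapping.map ((*) c) a"

lemma lookup_scl [simp]: "lookup (scl c a) i = c * lookup a i"
  unfolding scl_def Poly_Mapping.map.rep_eq by (simp add: when_def)

lemma scl_single [simp]: "scl c (single i a) = single i (c * a)"
  by (rule poly_mapping_eqI) (simp add: lookup_single when_def)

lemma keys_scl: "keys (scl c a) \<subseteq> keys a"
  by (auto simp: in_keys_iff)

text \<open>Carriers of superalgebras are only subsets of a type. Extension of independent sets is
  therefore carried out in the space of formal combinations, which is a whole type, and transported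
  to \<open>L\<close> by evaluation.\<close>

global_interpretation pm: vector_space "scl :: 'k::field \<Rightarrow> ('i \<Rightarrow>\<^sub>0 'k) \<Rightarrow> _"
  by unfold_locales (auto intro!: poly_mapping_eqI simp: lookup_add algebra_simps)

global_interpretation pm_pair: vector_space_pair
    "scl :: 'k::field \<Rightarrow> ('i \<Rightarrow>\<^sub>0 'k) \<Rightarrow> _" "scl :: 'k \<Rightarrow> ('j \<Rightarrow>\<^sub>0 'k) \<Rightarrow> _"
  ..

definition lin :: "('k::field, 'a) superalgebra \<Rightarrow> ('i \<Rightarrow> 'a) \<Rightarrow> ('i \<Rightarrow>\<^sub>0 'k) \<Rightarrow> 'a"
  where "lin L \<phi> a = finsum L (\<lambda>i. lookup a i \<odot>\<^bsub>L\<^esub> \<phi> i) (keys a)"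

context superalgebra
begin

lemma lin_superset:
  assumes "finite F" "keys a \<subseteq> F" "\<And>i. i \<in> F \<Longrightarrow> \<phi> i \<in> carrier L"
  shows "lin L \<phi> a = finsum L (\<lambda>i. lookup a i \<odot> \<phi> i) F"
  unfolding lin_def
  by (rule M.add.finprod_mono_neutral_cong_left)
    (use assms in \<open>auto simp: in_keys_iff subset_eq\<close>)

lemma lin_subspace:
  assumes U: "subspace_of U L" and "\<And>i. i \<in> keys a \<Longrightarrow> \<phi> i \<in> U"
  shows "lin L \<phi> a \<in> U"
proof -
  have "finsum L (\<lambda>i. lookup a i \<odot> \<phi> i) F \<in> U" if "finite F" "F \<subseteq> keys a" for F
    using that
  proof (induction F)
    case empty
    then show ?case
      using subspaceD(3)[OF U] by simp
  next
    case (insert i F)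
    then have "\<phi> j \<in> carrier L" if "j \<in> insert i F" for j
      using that assms(2) subspaceD(2)[OF U] by blast
    then have "finsum L (\<lambda>i. lookup a i \<odot> \<phi> i) (insert i F) =
        lookup a i \<odot> \<phi> i \<oplus> finsum L (\<lambda>i. lookup a i \<odot> \<phi> i) F"
      using insert by (intro M.finsum_insert) auto
    moreover have "lookup a i \<odot> \<phi> i \<in> U"
      using insert assms(2) subspaceD(5)[OF U] by simp
    ultimately show ?case
      using insert subspaceD(4)[OF U] by simp
  qed
  then show ?thesis
    unfolding lin_def by simp
qed

lemma lin_in: "(\<And>i. i \<in> keys a \<Longrightarrow> \<phi> i \<in> carrier L) \<Longrightarrow> lin L \<phi> a \<in> carrier L"
  by (rule lin_subspace[OF subspace_carrier])

lemma lin_add: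
  assumes "\<And>i. i \<in> keys a \<Longrightarrow> \<phi> i \<in> carrier L" "\<And>i. i \<in> keys b \<Longrightarrow> \<phi> i \<in> carrier L"
  shows "lin L \<phi> (a + b) = lin L \<phi> a \<oplus> lin L \<phi> b"
proof -
  let ?F = "keys a \<union> keys b"
  have F: "finite ?F" "\<And>i. i \<in> ?F \<Longrightarrow> \<phi> i \<in> carrier L"
    using assms by auto
  have "lin L \<phi> (a + b) = finsum L (\<lambda>i. lookup (a + b) i \<odot> \<phi> i) ?F"
    using keys_add[of a b] F by (intro lin_superset) auto
  also have "\<dots> = finsum L (\<lambda>i. lookup a i \<odot> \<phi> i \<oplus> lookup b i \<odot> \<phi> i) ?F"
    by (rule M.finsum_cong') (use F in \<open>auto simp: lookup_add add_smult\<close>)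
  also have "\<dots> = finsum L (\<lambda>i. lookup a i \<odot> \<phi> i) ?F \<oplus> finsum L (\<lambda>i. lookup b i \<odot> \<phi> i) ?F"
    using F by (intro M.finsum_addf) auto
  also have "\<dots> = lin L \<phi> a \<oplus> lin L \<phi> b"
    using F lin_superset[of ?F a \<phi>] lin_superset[of ?F b \<phi>] by simp
  finally show ?thesis .
qed

lemma lin_scl:
  assumes "\<And>i. i \<in> keys a \<Longrightarrow> \<phi> i \<in> carrier L"
  shows "lin L \<phi> (scl c a) = c \<odot> lin L \<phi> a"
proof -
  have "lin L \<phi> (scl c a) = finsum L (\<lambda>i. lookup (scl c a) i \<odot> \<phi> i) (keys a)"
    using assms keys_scl[of c a] by (intro lin_superset) auto
  also have "\<dots> = finsum L (\<lambda>i. c \<odot> (lookup a i \<odot> \<phi> i)) (keys a)"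
    by (rule M.finsum_cong') (use assms in \<open>auto simp: mult_smult_assoc\<close>)
  also have "\<dots> = c \<odot> lin L \<phi> a"
    unfolding lin_def using assms by (intro finsum_smult_ldistr[symmetric]) auto
  finally show ?thesis .
qed

lemma lin_single: "\<phi> i \<in> carrier L \<Longrightarrow> lin L \<phi> (single i c) = c \<odot> \<phi> i"
  by (subst lin_superset[of "{i}"]) (auto simp: M.finsum_insert)

lemma lin_zero [simp]: "lin L \<phi> 0 = \<zero>"
  by (simp add: lin_def)

text \<open>A basis of the free vector space on \<open>V\<close> relative to the kernel \<open>N\<close> of the evaluation map
  to \<open>L\<close> is the same thing as a basis of \<open>V\<close>.\<close>

lemma adapted_basis:
  assumes A: "subspace_of A L" and V: "subspace_of V L" and AV: "A \<subseteq> V"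
    and E: "E = {} \<or> (\<exists>b. E = {b})" "E \<subseteq> V - A"
  obtains B \<iota> where "B \<subseteq> V" "E \<subseteq> B"
    "\<And>U. subspace_of U L \<Longrightarrow> B \<subseteq> U \<Longrightarrow> V \<subseteq> U"
    "\<And>U. subspace_of U L \<Longrightarrow> B \<inter> A \<subseteq> U \<Longrightarrow> A \<subseteq> U"
    "\<And>x y. x \<in> V \<Longrightarrow> y \<in> V \<Longrightarrow> \<iota> (x \<oplus> y) = \<iota> x + \<iota> y"
    "\<And>c x. x \<in> V \<Longrightarrow> \<iota> (c \<odot> x) = scl c (\<iota> x)"
    "\<And>x. x \<in> B \<Longrightarrow> \<iota> x = single x 1"
    "\<And>x. x \<in> V \<Longrightarrow> \<iota> x = 0 \<Longrightarrow> x = \<zero>"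
proof -
  define ev where "ev = lin L (\<lambda>x. x)"
  define sg where "sg x = (single x 1 :: 'a \<Rightarrow>\<^sub>0 'k)" for x
  define P where "P U = {c. keys c \<subseteq> V \<and> ev c \<in> U}" for U
  note V' = subspaceD[OF V] and A' = subspaceD[OF A]
  have ev_add: "ev (a + b) = ev a \<oplus> ev b" if "keys a \<subseteq> V" "keys b \<subseteq> V" for a b
    unfolding ev_def using that V'(1) by (intro lin_add) auto
  have ev_scl: "ev (scl c a) = c \<odot> ev a" if "keys a \<subseteq> V" for a c
    unfolding ev_def using that V'(1) by (intro lin_scl) auto
  have ev_sg: "ev (sg x) = x" if "x \<in> V" for x
    unfolding ev_def sg_def using that V'(2) by (simp add: lin_single)
  have ev_in: "ev a \<in> carrier L" if "keys a \<subseteq> V" for a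
    unfolding ev_def using that V'(1) by (intro lin_in) auto
  have P: "pm.subspace (P U)" if U: "subspace_of U L" for U
  proof (rule pm.subspaceI)
    show "0 \<in> P U"
      using subspaceD(3)[OF U] by (simp add: P_def ev_def)
    show "a + b \<in> P U" if "a \<in> P U" "b \<in> P U" for a b
      using that keys_add[of a b] subspaceD(4)[OF U] by (auto simp: P_def ev_add)
    show "scl c a \<in> P U" if "a \<in> P U" for c a
      using that keys_scl[of c a] subspaceD(5)[OF U] by (auto simp: P_def ev_scl)
  qed
  have Z: "subspace_of {\<zero>} L"
    by (rule subspaceI) auto
  \<comment> \<open>Working modulo the kernel \<open>N\<close> of evaluation replaces
    \<open>V\<close> by formal combinations. An independent set grows in three stages: a basis
    \<open>NB\<close> of \<open>N\<close>, then symbols of elements of \<open>A\<close> (giving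
    \<open>S1\<close>), then \<open>E\<close> and symbols of elements of \<open>V\<close> (giving
    \<open>S3\<close>).\<close>
  define N where "N = P {\<zero>}"
  have N: "pm.subspace N"
    unfolding N_def using Z by (rule P)
  obtain NB where NB: "NB \<subseteq> N" "pm.independent NB" "N \<subseteq> pm.span NB"
    using pm.maximal_independent_subset[of N] by blast
  obtain S1 where S1: "NB \<subseteq> S1" "S1 \<subseteq> NB \<union> sg ` A" "pm.independent S1" "NB \<union> sg ` A \<subseteq> pm.span S1"
    using pm.maximal_independent_subset_extend[of NB "NB \<union> sg ` A"] NB(2) by blast
  have "N \<subseteq> P A"
    using A'(3) by (auto simp: N_def P_def)
  moreover have "sg ` A \<subseteq> P A"
    using AV ev_sg by (auto simp: P_def sg_def)
  ultimately have "S1 \<subseteq> P A"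
    using S1(2) NB(1) by blast
  then have S1P: "pm.span S1 \<subseteq> P A"
    using P[OF A] by (rule pm.span_minimal)
  have E_notin: "sg b \<notin> pm.span S1" if "b \<in> E" for b
  proof
    assume "sg b \<in> pm.span S1"
    then have "ev (sg b) \<in> A"
      using S1P by (auto simp: P_def)
    moreover have "ev (sg b) = b"
      using that E(2) by (intro ev_sg) blast
    ultimately show False
      using that E(2) by auto
  qed
  have "pm.independent (S1 \<union> sg ` E)"
    using E(1) E_notin S1(3) pm.independent_insertI by fastforce
  then obtain S3 where S3: "S1 \<union> sg ` E \<subseteq> S3" "S3 \<subseteq> (S1 \<union> sg ` E) \<union> sg ` V" "pm.independent S3"
      "(S1 \<union> sg ` E) \<union> sg ` V \<subseteq> pm.span S3"
    using pm.maximal_independent_subset_extend[of "S1 \<union> sg ` E" "(S1 \<union> sg ` E) \<union> sg ` V"] by blast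
  \<comment> \<open>The members of \<open>S3\<close> outside \<open>NB\<close> are symbols
    \<open>sg x\<close>; these \<open>x\<close> form the desired basis of \<open>V\<close>.\<close>
  define B where "B = {x \<in> V. sg x \<in> S3 - NB}"
  have S3_eq: "s \<in> NB \<or> (\<exists>x\<in>B. s = sg x)" if "s \<in> S3" for s
    using that S3(2) S1(2) AV E(2) unfolding B_def by blast
  \<comment> \<open>\<open>\<kappa>\<close> is the projection along \<open>N\<close> onto the span
    of the symbols of \<open>B\<close>. It is constant on fibres of evaluation, so
    \<open>\<kappa> (sg z)\<close> is the coordinate vector of \<open>z\<close>.\<close>
  obtain \<kappa> :: "('a \<Rightarrow>\<^sub>0 'k) \<Rightarrow> ('a \<Rightarrow>\<^sub>0 'k)" where
    lin\<kappa>: "Vector_Spaces.linear scl scl \<kappa>" and \<kappa>: "\<And>s. s \<in> S3 \<Longrightarrow> \<kappa> s = (if s \<in> NB then 0 else s)"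
    using pm_pair.linear_independent_extend[OF S3(3), of "\<lambda>s. if s \<in> NB then 0 else s"] by blast
  have \<kappa>_add: "\<kappa> (a + b) = \<kappa> a + \<kappa> b" and \<kappa>_scl: "\<kappa> (scl c a) = scl c (\<kappa> a)" for a b c
    using lin\<kappa> by (auto simp: Vector_Spaces.linear_iff)
  have \<kappa>_zero: "\<kappa> 0 = 0"
    using \<kappa>_scl[of 0 0] by simp
  have \<kappa>_minus: "\<kappa> (a - b) = \<kappa> a - \<kappa> b" for a b
    using \<kappa>_add[of "a - b" b] by simp
  have \<kappa>N: "\<kappa> c = 0" if "c \<in> N" for c
  proof -
    have "pm.span NB \<subseteq> {c. \<kappa> c = 0}"
      using S1(1) S3(1) by (intro pm.span_minimal pm.subspaceI) (auto simp: \<kappa> \<kappa>_add \<kappa>_scl \<kappa>_zero)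
    then show ?thesis
      using that NB(3) by blast
  qed
  have \<kappa>_in: "\<kappa> c \<in> P U" if "c \<in> pm.span S" "S \<subseteq> S3" "subspace_of U L" "\<And>x. x \<in> B \<Longrightarrow> sg x \<in> S \<Longrightarrow> x \<in> U" for c S U
  proof -
    have "\<kappa> s \<in> P U" if "s \<in> S" for s
    proof (cases "s \<in> NB")
      case True
      then show ?thesis
        using \<open>S \<subseteq> S3\<close> \<open>s \<in> S\<close> pm.subspace_0[OF P[OF \<open>subspace_of U L\<close>]] by (auto simp: \<kappa>)
    next
      case False
      then obtain x where x: "x \<in> B" "s = sg x"
        using S3_eq \<open>S \<subseteq> S3\<close> \<open>s \<in> S\<close> by blast
      then have "x \<in> U" "x \<in> V"
        using \<open>\<And>x. x \<in> B \<Longrightarrow> sg x \<in> S \<Longrightarrow> x \<in> U\<close> \<open>s \<in> S\<close> by (auto simp: B_def)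
      then have "sg x \<in> P U"
        by (simp add: P_def ev_sg) (simp add: sg_def)
      then show ?thesis
        using False x \<open>S \<subseteq> S3\<close> \<open>s \<in> S\<close> by (auto simp: \<kappa>)
    qed
    moreover have "pm.subspace {c. \<kappa> c \<in> P U}"
      using P[OF \<open>subspace_of U L\<close>] by (auto simp: pm.subspace_def \<kappa>_add \<kappa>_scl \<kappa>_zero)
    ultimately have "pm.span S \<subseteq> {c. \<kappa> c \<in> P U}"
      by (intro pm.span_minimal) auto
    then show ?thesis
      using that(1) by blast
  qed
  have S3V: "sg z \<in> pm.span S3" if "z \<in> V" for z
    using that S3(4) by blast
  \<comment> \<open>Projecting changes a symbol only by an element of the kernel, so evaluation
    recovers \<open>z\<close> from its coordinates.\<close>
  have \<kappa>_diff: "sg z - \<kappa> (sg z) \<in> N" if "z \<in> V" for z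
  proof -
    have "s - \<kappa> s \<in> N" if "s \<in> S3" for s
      using that NB(1) pm.subspace_0[OF N] by (auto simp: \<kappa>)
    moreover have "pm.subspace {c. c - \<kappa> c \<in> N}"
    proof (rule pm.subspaceI)
      show "a + b \<in> {c. c - \<kappa> c \<in> N}" if "a \<in> {c. c - \<kappa> c \<in> N}" "b \<in> {c. c - \<kappa> c \<in> N}" for a b
        using pm.subspace_add[OF N, of "a - \<kappa> a" "b - \<kappa> b"] that by (simp add: \<kappa>_add algebra_simps)
      show "scl c a \<in> {c. c - \<kappa> c \<in> N}" if "a \<in> {c. c - \<kappa> c \<in> N}" for c a
        using pm.subspace_scale[OF N, of "a - \<kappa> a" c] that by (simp add: \<kappa>_scl pm.scale_right_diff_distrib)
    qed (simp add: \<kappa>_zero pm.subspace_0[OF N])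
    ultimately have "pm.span S3 \<subseteq> {c. c - \<kappa> c \<in> N}"
      by (intro pm.span_minimal) auto
    then show ?thesis
      using S3V[OF that] by blast
  qed
  have ev\<kappa>: "ev (\<kappa> (sg z)) = z" if "z \<in> V" for z
  proof -
    have k: "\<kappa> (sg z) \<in> P (carrier L)"
      using S3V[OF that] subspace_carrier V'(1) by (intro \<kappa>_in[of _ S3]) (auto simp: B_def)
    have d: "keys (sg z - \<kappa> (sg z)) \<subseteq> V" "ev (sg z - \<kappa> (sg z)) = \<zero>"
      using \<kappa>_diff[OF that] by (simp_all add: N_def P_def)
    have k': "keys (\<kappa> (sg z)) \<subseteq> V"
      using k by (simp add: P_def)
    have "ev ((sg z - \<kappa> (sg z)) + \<kappa> (sg z)) = ev (\<kappa> (sg z))"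
      using ev_add[OF d(1) k'] d(2) ev_in[OF k'] by simp
    then show ?thesis
      using ev_sg[OF that] by simp
  qed
  show thesis
  proof (rule that[of B "\<lambda>z. \<kappa> (sg z)"])
    show "B \<subseteq> V"
      by (auto simp: B_def)
    show "E \<subseteq> B"
    proof
      fix b assume b: "b \<in> E"
      then have "sg b \<notin> NB"
        using E_notin[OF b] S1(1) pm.span_base[of "sg b" S1] by blast
      then show "b \<in> B"
        using b E(2) S3(1) by (auto simp: B_def)
    qed
    show "V \<subseteq> U" if U: "subspace_of U L" "B \<subseteq> U" for U
    proof
      fix z assume z: "z \<in> V"
      have "\<kappa> (sg z) \<in> P U"
        using S3V[OF z] U by (intro \<kappa>_in[of _ S3]) auto
      then show "z \<in> U"
        using ev\<kappa>[OF z] by (simp add: P_def)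
    qed
    show "A \<subseteq> U" if U: "subspace_of U L" "B \<inter> A \<subseteq> U" for U
    proof
      fix z assume z: "z \<in> A"
      have inj: "x = y" if "sg x = sg y" for x y
        using arg_cong[OF that, of keys] by (simp add: sg_def)
      have "x \<in> A" if "x \<in> B" "sg x \<in> S1" for x
        using that S1(2) inj by (auto simp: B_def)
      then have "\<kappa> (sg z) \<in> P U"
        using z S1(4) S3(1) U by (intro \<kappa>_in[of _ S1]) auto
      then show "z \<in> U"
        using ev\<kappa>[of z] z AV by (auto simp: P_def)
    qed
    show "\<kappa> (sg (x \<oplus> y)) = \<kappa> (sg x) + \<kappa> (sg y)" if xy: "x \<in> V" "y \<in> V" for x y
    proof -
      have k: "keys (sg u) \<subseteq> V" if "u \<in> V" for u
        using that by (simp add: sg_def)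
      have xyV: "x \<oplus> y \<in> V" "x \<in> carrier L" "y \<in> carrier L"
        using xy V' by auto
      have eq: "sg (x \<oplus> y) - (sg x + sg y) = sg (x \<oplus> y) + scl (- 1) (sg x + sg y)"
        by (rule poly_mapping_eqI) (simp add: lookup_add lookup_minus)
      have kk: "keys (sg x + sg y) \<subseteq> V"
        using keys_add[of "sg x" "sg y"] k[OF xy(1)] k[OF xy(2)] by blast
      have kkk: "keys (scl (- 1) (sg x + sg y)) \<subseteq> V"
        by (rule order_trans[OF keys_scl kk])
      have "ev (sg (x \<oplus> y) + scl (- 1) (sg x + sg y)) = (x \<oplus> y) \<oplus> (- 1) \<odot> (x \<oplus> y)"
        using ev_add[OF k[OF xyV(1)] kkk] ev_scl[OF kk] ev_add[OF k[OF xy(1)] k[OF xy(2)]]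
        by (simp only: ev_sg xy xyV)
      also have "\<dots> = \<zero>"
        using xyV M.r_neg[of "x \<oplus> y"] a_inv_eq[of "x \<oplus> y"] by simp
      finally have "sg (x \<oplus> y) - (sg x + sg y) \<in> N"
        unfolding eq using keys_add[of "sg (x \<oplus> y)" "scl (- 1) (sg x + sg y)"] kkk k[OF xyV(1)]
        by (auto simp: N_def P_def)
      then have "\<kappa> (sg (x \<oplus> y)) - (\<kappa> (sg x) + \<kappa> (sg y)) = 0"
        using \<kappa>N by (simp flip: \<kappa>_add \<kappa>_minus)
      then show ?thesis
        by simp
    qed
    show "\<kappa> (sg (c \<odot> x)) = scl c (\<kappa> (sg x))" if x: "x \<in> V" for c x
    proof -
      have k: "keys (sg u) \<subseteq> V" if "u \<in> V" for u
        using that by (simp add: sg_def)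
      have cx: "c \<odot> x \<in> V" "x \<in> carrier L"
        using x V' by auto
      have eq: "sg (c \<odot> x) - scl c (sg x) = sg (c \<odot> x) + scl (- c) (sg x)"
        by (rule poly_mapping_eqI) (simp add: lookup_add lookup_minus)
      have kk: "keys (scl (- c) (sg x)) \<subseteq> V"
        by (rule order_trans[OF keys_scl k[OF x]])
      have "ev (sg (c \<odot> x) + scl (- c) (sg x)) = c \<odot> x \<oplus> (- c) \<odot> x"
        using ev_add[OF k[OF cx(1)] kk] ev_scl[OF k[OF x]] by (simp only: ev_sg x cx)
      also have "\<dots> = \<zero>"
        using cx M.r_neg[of "c \<odot> x"] by (simp add: minus_smult)
      finally have "sg (c \<odot> x) - scl c (sg x) \<in> N"
        unfolding eq using keys_add[of "sg (c \<odot> x)" "scl (- c) (sg x)"] kk k[OF cx(1)]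
        by (auto simp: N_def P_def)
      then have "\<kappa> (sg (c \<odot> x)) - scl c (\<kappa> (sg x)) = 0"
        using \<kappa>N by (simp flip: \<kappa>_scl \<kappa>_minus)
      then show ?thesis
        by simp
    qed
    show "\<kappa> (sg x) = single x 1" if "x \<in> B" for x
      using that by (simp add: B_def \<kappa>) (simp add: sg_def)
    show "x = \<zero>" if "x \<in> V" "\<kappa> (sg x) = 0" for x
      using ev\<kappa>[OF that(1)] that(2) by (simp add: ev_def)
  qed
qed

end

section \<open>The free nonassociative superalgebra\<close>

definition unit_fun :: "'m \<Rightarrow> 'm \<Rightarrow> 'k::field"
  where "unit_fun m = (\<lambda>t. if t = m then 1 else 0)"

lemma finite_support_unit_fun [simp]: "finite {t. unit_fun m t \<noteq> (0::'k::field)}"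
  by (rule finite_subset[of _ "{m}"]) (auto simp: unit_fun_def)

lemma finite_support_add:
  fixes f g :: "'m \<Rightarrow> 'k::field"
  shows "finite {t. f t \<noteq> 0} \<Longrightarrow> finite {t. g t \<noteq> 0} \<Longrightarrow> finite {t. f t + g t \<noteq> 0}"
  by (rule finite_subset[of _ "{t. f t \<noteq> 0} \<union> {t. g t \<noteq> 0}"]) auto

lemma finite_support_scale:
  fixes f :: "'m \<Rightarrow> 'k::field"
  shows "finite {t. f t \<noteq> 0} \<Longrightarrow> finite {t. c * f t \<noteq> 0}"
  by (rule finite_subset[of _ "{t. f t \<noteq> 0}"]) auto

lemma nonassoc_mult_nonzero:
  assumes "nonassoc_mult f g t \<noteq> 0"
  obtains s u where "t = Prod s u" "f s \<noteq> 0" "g u \<noteq> 0"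
  using assms by (cases t) auto

lemma finite_support_nonassoc_mult:
  fixes f g :: "'x monomial \<Rightarrow> 'k::field"
  assumes "finite {t. f t \<noteq> 0}" "finite {t. g t \<noteq> 0}"
  shows "finite {t. nonassoc_mult f g t \<noteq> 0}"
proof (rule finite_subset)
  show "{t. nonassoc_mult f g t \<noteq> 0} \<subseteq> (\<lambda>(s, u). Prod s u) ` ({t. f t \<noteq> 0} \<times> {t. g t \<noteq> 0})"
    by (auto elim!: nonassoc_mult_nonzero)
qed (use assms in auto)

lemma nonassoc_mult_unit_fun:
  "nonassoc_mult (unit_fun m) (unit_fun n) = (unit_fun (Prod m n) :: 'x monomial \<Rightarrow> 'k::field)"
proof
  fix t show "nonassoc_mult (unit_fun m) (unit_fun n) t = (unit_fun (Prod m n) t :: 'k)"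
    by (cases t) (auto simp: unit_fun_def)
qed

lemma nonassoc_mult_linear:
  "nonassoc_mult (\<lambda>t. f t + g t) h = (\<lambda>t. nonassoc_mult f h t + nonassoc_mult g h t)"
  "nonassoc_mult h (\<lambda>t. f t + g t) = (\<lambda>t. nonassoc_mult h f t + nonassoc_mult h g t)"
  "nonassoc_mult (\<lambda>t. c * f t) h = (\<lambda>t. c * nonassoc_mult f h t)"
  "nonassoc_mult h (\<lambda>t. c * f t) = (\<lambda>t. c * nonassoc_mult h f t)"
proof -
  show "nonassoc_mult (\<lambda>t. f t + g t) h = (\<lambda>t. nonassoc_mult f h t + nonassoc_mult g h t)"
    by (rule ext, rename_tac t, case_tac t) (simp_all add: algebra_simps)
  show "nonassoc_mult h (\<lambda>t. f t + g t) = (\<lambda>t. nonassoc_mult h f t + nonassoc_mult h g t)"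
    by (rule ext, rename_tac t, case_tac t) (simp_all add: algebra_simps)
  show "nonassoc_mult (\<lambda>t. c * f t) h = (\<lambda>t. c * nonassoc_mult f h t)"
    by (rule ext, rename_tac t, case_tac t) simp_all
  show "nonassoc_mult h (\<lambda>t. c * f t) = (\<lambda>t. c * nonassoc_mult h f t)"
    by (rule ext, rename_tac t, case_tac t) simp_all
qed

lemma free_nonassoc_simps:
  "carrier (free_nonassoc G d) = {f. finite {t. f t \<noteq> 0} \<and> (\<forall>t. f t \<noteq> 0 \<longrightarrow> set_monomial t \<subseteq> G)}"
  "f \<otimes>\<^bsub>free_nonassoc G d\<^esub> g = nonassoc_mult f g"
  "\<zero>\<^bsub>free_nonassoc G d\<^esub> = (\<lambda>t. 0)"
  "f \<oplus>\<^bsub>free_nonassoc G d\<^esub> g = (\<lambda>t. f t + g t)"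
  "c \<odot>\<^bsub>free_nonassoc G d\<^esub> f = (\<lambda>t. c * f t)"
  "grade (free_nonassoc G d) p = {f. finite {t. f t \<noteq> 0} \<and>
       (\<forall>t. f t \<noteq> 0 \<longrightarrow> set_monomial t \<subseteq> G \<and> parity d t = p)}"
  by (simp_all add: free_nonassoc_def)

lemma superalgebra_free_nonassoc:
  "superalgebra (free_nonassoc G d :: ('k::field, 'x monomial \<Rightarrow> 'k) superalgebra)"
proof -
  let ?A = "free_nonassoc G d :: ('k, 'x monomial \<Rightarrow> 'k) superalgebra"
  note simps = free_nonassoc_simps[of G d]
  have add: "f \<oplus>\<^bsub>?A\<^esub> g \<in> carrier ?A" if "f \<in> carrier ?A" "g \<in> carrier ?A" for f g
  proof -
    have "set_monomial t \<subseteq> G" if "f t + g t \<noteq> 0" for t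
      using that \<open>f \<in> carrier ?A\<close> \<open>g \<in> carrier ?A\<close> by (cases "f t = 0") (auto simp: simps)
    then show ?thesis
      using that by (simp add: simps finite_support_add)
  qed
  have scale: "c \<odot>\<^bsub>?A\<^esub> f \<in> carrier ?A" if "f \<in> carrier ?A" for c f
    using that by (simp add: simps finite_support_scale)
  have ag: "abelian_group ?A"
  proof (rule abelian_groupI)
    fix f assume f: "f \<in> carrier ?A"
    have "(- 1) \<odot>\<^bsub>?A\<^esub> f \<oplus>\<^bsub>?A\<^esub> f = \<zero>\<^bsub>?A\<^esub>"
      by (simp add: simps)
    then show "\<exists>g\<in>carrier ?A. g \<oplus>\<^bsub>?A\<^esub> f = \<zero>\<^bsub>?A\<^esub>"
      using scale[OF f] by blast
  qed (assumption | rule add | simp add: simps add_ac)+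
  interpret module "ring_of_type_algebra" ?A
    by (intro moduleI ag cring_from_type_algebra scale) (auto simp: simps algebra_simps)
  have sub: "subspace_of (grade ?A p) ?A" for p
  proof (rule submoduleI)
    fix f g assume fg: "f \<in> grade ?A p" "g \<in> grade ?A p"
    have "set_monomial t \<subseteq> G \<and> parity d t = p" if "f t + g t \<noteq> 0" for t
      using that fg by (cases "f t = 0") (auto simp: simps)
    then show "f \<oplus>\<^bsub>?A\<^esub> g \<in> grade ?A p"
      using fg by (simp add: simps finite_support_add)
  next
    fix f assume f: "f \<in> grade ?A p"
    have "(- 1) \<odot>\<^bsub>?A\<^esub> f \<oplus>\<^bsub>?A\<^esub> f = \<zero>\<^bsub>?A\<^esub>"
      by (simp add: simps)
    moreover have "f \<in> carrier ?A" "(- 1) \<odot>\<^bsub>?A\<^esub> f \<in> carrier ?A"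
      using f by (auto simp: simps)
    ultimately have "\<ominus>\<^bsub>?A\<^esub> f = (- 1) \<odot>\<^bsub>?A\<^esub> f"
      by (rule M.minus_equality)
    then show "\<ominus>\<^bsub>?A\<^esub> f \<in> grade ?A p"
      using f by (simp add: simps)
  qed (auto simp: simps finite_support_scale)
  have sum: "grade ?A 0 <+>\<^bsub>?A\<^esub> grade ?A 1 = carrier ?A"
  proof (intro equalityI subsetI)
    fix f assume f: "f \<in> carrier ?A"
    define part where "part p = (\<lambda>t. if parity d t = p then f t else 0)" for p
    have "part p \<in> grade ?A p" for p
    proof -
      have "finite {t. part p t \<noteq> 0}"
        by (rule finite_subset[of _ "{t. f t \<noteq> 0}"]) (use f in \<open>auto simp: part_def simps\<close>)
      then show ?thesis
        using f by (auto simp: simps part_def)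
    qed
    moreover have "part 0 \<oplus>\<^bsub>?A\<^esub> part 1 = f"
    proof
      fix t show "(part 0 \<oplus>\<^bsub>?A\<^esub> part 1) t = f t"
        by (cases "parity d t") (simp_all add: simps part_def)
    qed
    ultimately show "f \<in> grade ?A 0 <+>\<^bsub>?A\<^esub> grade ?A 1"
      unfolding set_add_def' by blast
  next
    fix f assume "f \<in> grade ?A 0 <+>\<^bsub>?A\<^esub> grade ?A 1"
    then obtain g h where "g \<in> grade ?A 0" "h \<in> grade ?A 1" "f = g \<oplus>\<^bsub>?A\<^esub> h"
      unfolding set_add_def' by blast
    then show "f \<in> carrier ?A"
      using add[of g h] by (simp add: simps)
  qed
  have int: "grade ?A 0 \<inter> grade ?A 1 = {\<zero>\<^bsub>?A\<^esub>}"
  proof (intro equalityI subsetI)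
    fix f assume "f \<in> grade ?A 0 \<inter> grade ?A 1"
    then have "f t = 0" for t
      by (cases "f t = 0") (auto simp: simps)
    then show "f \<in> {\<zero>\<^bsub>?A\<^esub>}"
      by (auto simp: simps)
  qed (auto simp: simps)
  have mult: "f \<otimes>\<^bsub>?A\<^esub> g \<in> grade ?A (p + q)" if fg: "f \<in> grade ?A p" "g \<in> grade ?A q" for f g p q
  proof -
    have "set_monomial t \<subseteq> G \<and> parity d t = p + q" if "nonassoc_mult f g t \<noteq> 0" for t
      using that fg by (elim nonassoc_mult_nonzero) (simp add: simps)
    then show ?thesis
      using fg finite_support_nonassoc_mult[of f g] by (simp add: simps)
  qed
  show ?thesis
    by (intro superalgebra.intro superalgebra_axioms.intro module_axioms sub sum int mult)
      (simp_all only: simps nonassoc_mult_linear)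
qed

lemma unit_fun_in_grade:
  "set_monomial m \<subseteq> G \<Longrightarrow> unit_fun m \<in> grade (free_nonassoc G d) (parity d m)"
  by (simp add: free_nonassoc_simps) (simp add: unit_fun_def)

lemma unit_fun_in_carrier: "set_monomial m \<subseteq> G \<Longrightarrow> unit_fun m \<in> carrier (free_nonassoc G d)"
  by (simp add: free_nonassoc_simps) (simp add: unit_fun_def)

lemma free_nonassoc_span:
  fixes f :: "'x monomial \<Rightarrow> 'k::field"
  assumes U: "subspace_of U (free_nonassoc G d)"
    and "finite {t. f t \<noteq> 0}" "\<And>m. f m \<noteq> 0 \<Longrightarrow> unit_fun m \<in> U"
  shows "f \<in> U"
proof -
  interpret superalgebra "free_nonassoc G d"
    by (rule superalgebra_free_nonassoc)
  have "\<forall>f :: 'x monomial \<Rightarrow> 'k. {t. f t \<noteq> 0} \<subseteq> F \<longrightarrow> (\<forall>m. f m \<noteq> 0 \<longrightarrow> unit_fun m \<in> U) \<longrightarrow> f \<in> U" if "finite F" for F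
    using that
  proof (induction F)
    case empty
    then show ?case
      using subspaceD(3)[OF U] by (auto simp: free_nonassoc_simps dest!: ext)
  next
    case (insert m F)
    show ?case
    proof (intro allI impI)
      fix f :: "'x monomial \<Rightarrow> 'k"
      assume f: "{t. f t \<noteq> 0} \<subseteq> insert m F" "\<forall>m. f m \<noteq> 0 \<longrightarrow> unit_fun m \<in> U"
      have "f(m := 0) \<in> U"
        by (rule insert.IH[rule_format]) (use f in \<open>auto split: if_splits\<close>)
      moreover have "(\<lambda>t. f m * unit_fun m t) \<in> U"
      proof (cases "f m = 0")
        case True
        then show ?thesis
          using subspaceD(3)[OF U] by (simp add: free_nonassoc_simps)
      next
        case False
        then show ?thesis
          using subspaceD(5)[OF U, of "unit_fun m" "f m"] f by (simp add: free_nonassoc_simps)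
      qed
      moreover have "f = (\<lambda>t. (f(m := 0)) t + f m * unit_fun m t)"
        by (auto simp: unit_fun_def)
      ultimately show "f \<in> U"
        using subspaceD(4)[OF U, of "f(m := 0)" "\<lambda>t. f m * unit_fun m t"]
        by (simp add: free_nonassoc_simps)
    qed
  qed
  then show ?thesis
    using assms by blast
qed

primrec eval_monomial :: "('k, 'a) superalgebra \<Rightarrow> ('x \<Rightarrow> 'a) \<Rightarrow> 'x monomial \<Rightarrow> 'a" where
  "eval_monomial L x (Gen g) = x g"
| "eval_monomial L x (Prod s t) = eval_monomial L x s \<otimes>\<^bsub>L\<^esub> eval_monomial L x t"

definition eval_free :: "('k::field, 'a) superalgebra \<Rightarrow> ('x \<Rightarrow> 'a) \<Rightarrow> ('x monomial \<Rightarrow> 'k) \<Rightarrow> 'a"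
  where "eval_free L x f = lin L (eval_monomial L x) (Abs_poly_mapping f)"

lemma lookup_Abs: "finite {t. f t \<noteq> 0} \<Longrightarrow> lookup (Abs_poly_mapping f) = f"
  by simp

lemma keys_Abs: "finite {t. f t \<noteq> 0} \<Longrightarrow> keys (Abs_poly_mapping f) = {t. f t \<noteq> 0}"
  by (auto simp: in_keys_iff)

lemma Abs_poly_mapping_add:
  fixes f g :: "'m \<Rightarrow> 'k::field"
  assumes "finite {t. f t \<noteq> 0}" "finite {t. g t \<noteq> 0}"
  shows "Abs_poly_mapping (\<lambda>t. f t + g t) = Abs_poly_mapping f + Abs_poly_mapping g"
  using assms by (intro poly_mapping_eqI) (simp add: lookup_add finite_support_add)

lemma Abs_poly_mapping_scale:
  fixes f :: "'m \<Rightarrow> 'k::field"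
  assumes "finite {t. f t \<noteq> 0}"
  shows "Abs_poly_mapping (\<lambda>t. c * f t) = scl c (Abs_poly_mapping f)"
  by (intro poly_mapping_eqI) (simp add: assms lookup_Abs[OF finite_support_scale[OF assms]])

lemma Abs_poly_mapping_unit_fun: "Abs_poly_mapping (unit_fun m) = single m (1::'k::field)"
  by (intro poly_mapping_eqI) (simp add: lookup_single, simp add: unit_fun_def when_def)

context superalgebra
begin

lemma eval_monomial_grade:
  assumes "\<And>g. g \<in> G \<Longrightarrow> x g \<in> grade L (d g)" "set_monomial m \<subseteq> G"
  shows "eval_monomial L x m \<in> grade L (parity d m)"
  using assms(2) by (induction m) (auto intro: assms(1) grade_mult)

context
  fixes G d x
  assumes x: "\<And>g. g \<in> G \<Longrightarrow> x g \<in> grade L (d g)"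
begin

lemma eval_free_unit_fun:
  "set_monomial m \<subseteq> G \<Longrightarrow> eval_free L x (unit_fun m) = eval_monomial L x m"
  using grade_in[OF eval_monomial_grade[of G x d m]] x unfolding eval_free_def Abs_poly_mapping_unit_fun
  by (subst lin_single) simp_all

lemma eval_free_gen: "g \<in> G \<Longrightarrow> eval_free L x (unit_fun (Gen g)) = x g"
  by (simp add: eval_free_unit_fun)

text \<open>The universal property. Multiplicativity holds on monomials by definition; it is
  extended linearly in the right factor with a monomial on the left, and then in the left
  factor.\<close>

lemma eval_free_hom: "eval_free L x \<in> superalgebra_hom (free_nonassoc G d) L"
proof -
  let ?A = "free_nonassoc G d :: ('k, _) superalgebra" and ?e = "eval_free L x"
  interpret A: superalgebra ?A
    by (rule superalgebra_free_nonassoc)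
  note simps = free_nonassoc_simps[of G d]
  have grade: "?e f \<in> grade L p" if "f \<in> grade ?A p" for f p
    unfolding eval_free_def
  proof (rule lin_subspace[OF grade_subspace])
    fix m assume "m \<in> keys (Abs_poly_mapping f)"
    then show "eval_monomial L x m \<in> grade L p"
      using that eval_monomial_grade[of G x d m] x by (auto simp: simps keys_Abs)
  qed
  have mon: "eval_monomial L x m \<in> carrier L" if "set_monomial m \<subseteq> G" for m
    using eval_monomial_grade[of G x d m] x that by simp
  have cl: "?e f \<in> carrier L" if "f \<in> carrier ?A" for f
    unfolding eval_free_def by (rule lin_in) (use that mon in \<open>auto simp: simps keys_Abs\<close>)
  have add: "?e (f \<oplus>\<^bsub>?A\<^esub> g) = ?e f \<oplus> ?e g" if "f \<in> carrier ?A" "g \<in> carrier ?A" for f g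
  proof -
    have "Abs_poly_mapping (f \<oplus>\<^bsub>?A\<^esub> g) = Abs_poly_mapping f + Abs_poly_mapping g"
      using that by (simp add: simps Abs_poly_mapping_add)
    then show ?thesis
      unfolding eval_free_def by (simp only:) (rule lin_add; use that mon in \<open>simp add: simps keys_Abs\<close>)
  qed
  have scale: "?e (c \<odot>\<^bsub>?A\<^esub> f) = c \<odot> ?e f" if "f \<in> carrier ?A" for f c
  proof -
    have "Abs_poly_mapping (c \<odot>\<^bsub>?A\<^esub> f) = scl c (Abs_poly_mapping f)"
      using that by (simp add: simps Abs_poly_mapping_scale)
    then show ?thesis
      unfolding eval_free_def by (simp only:) (rule lin_scl; use that mon in \<open>simp add: simps keys_Abs\<close>)
  qed
  have "?e \<zero>\<^bsub>?A\<^esub> = \<zero>"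
    by (simp add: eval_free_def simps)
  note ezero = this
  have mult_unit: "?e (unit_fun m \<otimes>\<^bsub>?A\<^esub> g) = ?e (unit_fun m) \<otimes> ?e g"
    if m: "set_monomial m \<subseteq> G" and g: "g \<in> carrier ?A" for m g
  proof -
    have um: "unit_fun m \<in> carrier ?A"
      using m by (rule unit_fun_in_carrier)
    let ?U = "{g \<in> carrier ?A. ?e (unit_fun m \<otimes>\<^bsub>?A\<^esub> g) = ?e (unit_fun m) \<otimes> ?e g}"
    have sub: "subspace_of ?U ?A"
      by (rule A.subspaceI)
        (use um in \<open>auto simp: A.mult_add A.mult_smult add scale mult_add mult_smult cl ezero\<close>)
    have unit: "unit_fun n \<in> ?U" if "g n \<noteq> 0" for n
    proof -
      have n: "set_monomial n \<subseteq> G"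
        using g that by (simp add: simps)
      have "unit_fun m \<otimes>\<^bsub>?A\<^esub> unit_fun n = unit_fun (Prod m n)"
        by (simp add: simps nonassoc_mult_unit_fun)
      then show ?thesis
        using m n by (simp add: eval_free_unit_fun unit_fun_in_carrier)
    qed
    have "finite {t. g t \<noteq> 0}"
      using g by (simp add: simps)
    from free_nonassoc_span[OF sub this unit] have "g \<in> ?U" .
    then show ?thesis
      by simp
  qed
  have mult: "?e (f \<otimes>\<^bsub>?A\<^esub> g) = ?e f \<otimes> ?e g" if f: "f \<in> carrier ?A" and g: "g \<in> carrier ?A" for f g
  proof -
    let ?U = "{f \<in> carrier ?A. ?e (f \<otimes>\<^bsub>?A\<^esub> g) = ?e f \<otimes> ?e g}"
    have sub: "subspace_of ?U ?A"
      by (rule A.subspaceI)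
        (use g in \<open>auto simp: A.add_mult A.smult_mult add scale add_mult smult_mult cl ezero\<close>)
    have unit: "unit_fun m \<in> ?U" if "f m \<noteq> 0" for m
    proof -
      have m: "set_monomial m \<subseteq> G"
        using f that by (simp add: simps)
      then show ?thesis
        using mult_unit[OF m g] by (simp add: unit_fun_in_carrier)
    qed
    have "finite {t. f t \<noteq> 0}"
      using f by (simp add: simps)
    from free_nonassoc_span[OF sub this unit] have "f \<in> ?U" .
    then show ?thesis
      by simp
  qed
  show ?thesis
    unfolding superalgebra_hom_def
    by (intro CollectI conjI ballI allI funcsetI image_subsetI grade cl add scale mult)
qed

end

end

section \<open>The free associative algebra\<close>

text \<open>With concatenation as the monoid operation, the convolution product makes
  \<open>'x list \<Rightarrow>\<^sub>0 'k\<close> the free associative algebra on the letters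
  \<open>'x\<close>.\<close>

instantiation list :: (type) monoid_add
begin

definition zero_list :: "'a list" where "zero_list = []"

definition plus_list :: "'a list \<Rightarrow> 'a list \<Rightarrow> 'a list" where "plus_list = (@)"

instance
  by standard (simp_all add: zero_list_def plus_list_def)

end

lemma poly_mapping_induct_single [case_names zero single add]:
  fixes a :: "'i \<Rightarrow>\<^sub>0 'k::field"
  assumes "P 0" "\<And>i c. P (single i c)" "\<And>a b. P a \<Longrightarrow> P b \<Longrightarrow> P (a + b)"
  shows "P a"
proof -
  have "a = (\<Sum>i\<in>keys a. single i (lookup a i))"
    by (rule poly_mapping_eqI) (auto simp: lookup_sum lookup_single when_def in_keys_iff)
  moreover have "P (\<Sum>i\<in>F. single i (lookup a i))" if "finite F" for F
    using that by (induction F) (simp_all add: assms)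
  ultimately show ?thesis
    using finite_keys by metis
qed

lemma scl_conv_mult: "scl c a = single 0 c * a"
  by (simp add: scl_def mult_map_scale_conv_mult)

lemma scl_mult_left: "scl c a * b = scl c (a * b)"
  by (simp add: scl_conv_mult mult.assoc)

lemma scl_mult_right: "a * scl c b = scl c (a * (b :: 'w::monoid_add \<Rightarrow>\<^sub>0 'k::field))"
proof -
  have "a * single 0 c = single 0 c * a"
    by (induction a rule: poly_mapping_induct_single) (simp_all add: mult_single algebra_simps)
  then show ?thesis
    by (simp add: scl_conv_mult mult.assoc[symmetric])
qed

lemmas scl_simps = pm.scale_right_distrib pm.scale_left_distrib pm.scale_right_diff_distrib
  pm.scale_left_diff_distrib scl_mult_left scl_mult_right

lemma scl_neg_one [simp]: "scl (- 1) a = - a"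
  by simp

definition lext :: "('i \<Rightarrow> 'j \<Rightarrow>\<^sub>0 'k::field) \<Rightarrow> ('i \<Rightarrow>\<^sub>0 'k) \<Rightarrow> 'j \<Rightarrow>\<^sub>0 'k"
  where "lext \<phi> a = (\<Sum>i\<in>keys a. scl (lookup a i) (\<phi> i))"

lemma lext_superset:
  "finite F \<Longrightarrow> keys a \<subseteq> F \<Longrightarrow> lext \<phi> a = (\<Sum>i\<in>F. scl (lookup a i) (\<phi> i))"
  unfolding lext_def by (rule sum.mono_neutral_left) (auto simp: in_keys_iff)

lemma lext_add: "lext \<phi> (a + b) = lext \<phi> a + lext \<phi> b"
  using keys_add[of a b]
  by (simp add: lext_superset[of "keys a \<union> keys b"] lookup_add pm.scale_left_distrib sum.distrib)

lemma lext_scl: "lext \<phi> (scl c a) = scl c (lext \<phi> a)"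
  using keys_scl[of c a] by (simp add: lext_superset[of "keys a"] pm.scale_sum_right)

lemma lext_single: "lext \<phi> (single i c) = scl c (\<phi> i)"
  by (simp add: lext_superset[of "{i}"])

lemma lext_zero [simp]: "lext \<phi> 0 = 0"
  by (simp add: lext_def)

lemma lext_uminus: "lext \<phi> (- a) = - lext \<phi> a"
  using lext_scl[of \<phi> "- 1" a] by simp

lemma lext_diff: "lext \<phi> (a - b) = lext \<phi> a - lext \<phi> b"
  using lext_add[of \<phi> a "- b"] by (simp add: lext_uminus)

text \<open>Uniqueness of linear extensions. It serves to reduce statements that are linear in one
  argument to words or letters.\<close>

lemma lext_eqI:
  assumes "\<And>i. f (single i 1) = \<phi> i" "\<And>a b. f (a + b) = f a + f b" "\<And>c a. f (scl c a) = scl c (f a)"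
  shows "f a = lext \<phi> a"
proof (induction a rule: poly_mapping_induct_single)
  case zero
  then show ?case
    using assms(3)[of 0 0] by simp
next
  case (single i c)
  then show ?case
    using assms(3)[of c "single i 1"] by (simp add: assms(1) lext_single)
qed (simp_all add: assms(2) lext_add)

abbreviation word :: "'x list \<Rightarrow> 'x list \<Rightarrow>\<^sub>0 'k::field"
  where "word w \<equiv> single w 1"

lemma word_mult: "word u * word v = (word (u @ v) :: 'x list \<Rightarrow>\<^sub>0 'k::field)"
  by (simp add: mult_single plus_list_def)

lemma word_Nil: "word [] = (1 :: 'x list \<Rightarrow>\<^sub>0 'k::field)"
  by (simp flip: zero_list_def)

text \<open>The parities are arguments since the associative algebra is given no grading here. The
  sign and Jacobi laws below then hold for arbitrary elements with arbitrary parity labels.\<close>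

definition supercomm :: "bit \<Rightarrow> bit \<Rightarrow> ('w::monoid_add \<Rightarrow>\<^sub>0 'k::field) \<Rightarrow> ('w \<Rightarrow>\<^sub>0 'k) \<Rightarrow> 'w \<Rightarrow>\<^sub>0 'k"
  where "supercomm p q a b = a * b - scl (super_sign p q) (b * a)"

lemma supercomm_add_left: "supercomm p q (a + b) c = supercomm p q a c + supercomm p q b c"
  and supercomm_add_right: "supercomm p q c (a + b) = supercomm p q c a + supercomm p q c b"
  and supercomm_diff_left: "supercomm p q (a - b) c = supercomm p q a c - supercomm p q b c"
  and supercomm_diff_right: "supercomm p q c (a - b) = supercomm p q c a - supercomm p q c b"
  and supercomm_scl_left: "supercomm p q (scl k a) c = scl k (supercomm p q a c)"
  and supercomm_scl_right: "supercomm p q c (scl k a) = scl k (supercomm p q c a)"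
  by (simp_all add: supercomm_def algebra_simps scl_simps pm.scale_left_commute)

lemma supercomm_zero [simp]: "supercomm p q 0 c = 0" "supercomm p q c 0 = 0"
  by (simp_all add: supercomm_def)

lemma supercomm_skew: "supercomm p q a b + scl (super_sign p q) (supercomm q p b a) = 0"
  by (cases p; cases q) (simp_all add: supercomm_def super_sign_def algebra_simps)

lemma supercomm_jacobi:
  "supercomm p (q + r) a (supercomm q r b c) =
    supercomm (p + q) r (supercomm p q a b) c + scl (super_sign p q) (supercomm q (p + r) b (supercomm p r a c))"
  by (cases p; cases q; cases r) (simp_all add: supercomm_def super_sign_def algebra_simps)

definition two_sided_ideal :: "'r::ring_1 set \<Rightarrow> bool"
  where "two_sided_ideal J \<longleftrightarrow> 0 \<in> J \<and> (\<forall>a\<in>J. \<forall>b\<in>J. a + b \<in> J) \<and> (\<forall>a\<in>J. \<forall>u. u * a \<in> J \<and> a * u \<in> J)"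

lemma two_sided_idealD:
  assumes "two_sided_ideal J"
  shows "0 \<in> J" "a \<in> J \<Longrightarrow> b \<in> J \<Longrightarrow> a + b \<in> J" "a \<in> J \<Longrightarrow> u * a \<in> J" "a \<in> J \<Longrightarrow> a * u \<in> J"
    "a \<in> J \<Longrightarrow> - a \<in> J" "a \<in> J \<Longrightarrow> b \<in> J \<Longrightarrow> a - b \<in> J"
proof -
  show u: "- a \<in> J" if "a \<in> J" for a
  proof -
    have "(- 1) * a \<in> J"
      using assms that unfolding two_sided_ideal_def by blast
    then show ?thesis
      by simp
  qed
  show "a - b \<in> J" if "a \<in> J" "b \<in> J"
  proof -
    have "a + (- b) \<in> J"
      using assms that(1) u[OF that(2)] unfolding two_sided_ideal_def by blast
    then show ?thesis
      by simp
  qed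
qed (use assms[unfolded two_sided_ideal_def] in blast)+

lemma two_sided_ideal_scl:
  fixes J :: "('w::monoid_add \<Rightarrow>\<^sub>0 'k::field) set"
  shows "two_sided_ideal J \<Longrightarrow> a \<in> J \<Longrightarrow> scl c a \<in> J"
  unfolding scl_conv_mult by (rule two_sided_idealD)

lemma two_sided_ideal_supercomm:
  fixes J :: "('w::monoid_add \<Rightarrow>\<^sub>0 'k::field) set"
  assumes "two_sided_ideal J" "a \<in> J \<or> b \<in> J"
  shows "supercomm p q a b \<in> J"
proof -
  have "a * b \<in> J" "b * a \<in> J"
    using assms(2) two_sided_idealD(3,4)[OF assms(1)] by auto
  then show ?thesis
    unfolding supercomm_def by (intro two_sided_idealD(6)[OF assms(1)] two_sided_ideal_scl[OF assms(1)])
qed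

lemma two_sided_ideal_zero: "two_sided_ideal {0}"
  by (simp add: two_sided_ideal_def)

primrec assoc_monomial :: "('x \<Rightarrow> bit) \<Rightarrow> ('x \<Rightarrow> 'w::monoid_add \<Rightarrow>\<^sub>0 'k::field) \<Rightarrow> 'x monomial \<Rightarrow> 'w \<Rightarrow>\<^sub>0 'k" where
  "assoc_monomial d h (Gen g) = h g"
| "assoc_monomial d h (Prod s t) =
    supercomm (parity d s) (parity d t) (assoc_monomial d h s) (assoc_monomial d h t)"

definition assoc_eval :: "('x \<Rightarrow> bit) \<Rightarrow> ('x \<Rightarrow> 'w::monoid_add \<Rightarrow>\<^sub>0 'k::field) \<Rightarrow> ('x monomial \<Rightarrow> 'k) \<Rightarrow> 'w \<Rightarrow>\<^sub>0 'k"
  where "assoc_eval d h f = lext (assoc_monomial d h) (Abs_poly_mapping f)"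

lemma assoc_eval_unit_fun: "assoc_eval d h (unit_fun m) = assoc_monomial d h m"
  by (simp add: assoc_eval_def Abs_poly_mapping_unit_fun lext_single)

lemma assoc_eval_add:
  "f \<in> carrier (free_nonassoc G d) \<Longrightarrow> g \<in> carrier (free_nonassoc G d) \<Longrightarrow>
    assoc_eval d h (f \<oplus>\<^bsub>free_nonassoc G d\<^esub> g) = assoc_eval d h f + assoc_eval d h g"
  by (simp add: assoc_eval_def free_nonassoc_simps Abs_poly_mapping_add lext_add)

lemma assoc_eval_smult:
  "f \<in> carrier (free_nonassoc G d) \<Longrightarrow>
    assoc_eval d h (c \<odot>\<^bsub>free_nonassoc G d\<^esub> f) = scl c (assoc_eval d h f)"
  by (simp add: assoc_eval_def free_nonassoc_simps Abs_poly_mapping_scale lext_scl)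

lemma assoc_eval_zero: "assoc_eval d h \<zero>\<^bsub>free_nonassoc G d\<^esub> = 0"
proof -
  have "Abs_poly_mapping (\<lambda>t. 0) = 0"
    by simp
  then show ?thesis
    by (simp add: assoc_eval_def free_nonassoc_simps)
qed

lemma free_nonassoc_grade_span:
  fixes f :: "'x monomial \<Rightarrow> 'k::field"
  assumes U: "subspace_of U (free_nonassoc G d)" and f: "f \<in> grade (free_nonassoc G d) p"
    and m: "\<And>m. set_monomial m \<subseteq> G \<Longrightarrow> parity d m = p \<Longrightarrow> unit_fun m \<in> U"
  shows "f \<in> U"
proof -
  have "finite {t. f t \<noteq> 0}"
    using f by (simp add: free_nonassoc_simps)
  moreover have "unit_fun t \<in> U" if "f t \<noteq> 0" for t
    using f that by (intro m) (simp_all add: free_nonassoc_simps)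
  ultimately show ?thesis
    by (rule free_nonassoc_span[OF U])
qed

lemma assoc_eval_mult:
  fixes f g :: "'x monomial \<Rightarrow> 'k::field"
  assumes f: "f \<in> grade (free_nonassoc G d) p" and g: "g \<in> grade (free_nonassoc G d) q"
  shows "assoc_eval d h (f \<otimes>\<^bsub>free_nonassoc G d\<^esub> g) = supercomm p q (assoc_eval d h f) (assoc_eval d h g)"
proof -
  let ?A = "free_nonassoc G d :: ('k, _) superalgebra" and ?e = "assoc_eval d h"
  interpret A: superalgebra ?A
    by (rule superalgebra_free_nonassoc)
  have unit: "?e (unit_fun m \<otimes>\<^bsub>?A\<^esub> g) = supercomm p q (?e (unit_fun m)) (?e g)"
    if m: "set_monomial m \<subseteq> G" "parity d m = p" for m
  proof -
    let ?U = "{g \<in> grade ?A q. ?e (unit_fun m \<otimes>\<^bsub>?A\<^esub> g) = supercomm p q (?e (unit_fun m)) (?e g)}"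
    have um: "unit_fun m \<in> carrier ?A"
      using m(1) by (rule unit_fun_in_carrier)
    have "subspace_of ?U ?A"
    proof (rule A.subspaceI)
      show "x \<oplus>\<^bsub>?A\<^esub> y \<in> ?U" if "x \<in> ?U" "y \<in> ?U" for x y
        using that um A.gradeD(4)[of x q y] A.grade_in[of x q] A.grade_in[of y q]
        by (simp add: A.mult_add assoc_eval_add supercomm_add_right)
      show "c \<odot>\<^bsub>?A\<^esub> x \<in> ?U" if "x \<in> ?U" for c x
        using that um A.gradeD(5)[of x q c] A.grade_in[of x q]
        by (simp add: A.mult_smult assoc_eval_smult supercomm_scl_right)
    qed (use um A.gradeD(3) in \<open>auto simp: assoc_eval_zero\<close>)
    then have "g \<in> ?U"
    proof (rule free_nonassoc_grade_span[OF _ g])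
      fix n assume n: "set_monomial n \<subseteq> G" "parity d n = q"
      have "unit_fun m \<otimes>\<^bsub>?A\<^esub> unit_fun n = unit_fun (Prod m n)"
        by (simp add: free_nonassoc_simps nonassoc_mult_unit_fun)
      then show "unit_fun n \<in> ?U"
        using m n unit_fun_in_grade[OF n(1), of d] by (simp add: assoc_eval_unit_fun)
    qed
    then show ?thesis
      by simp
  qed
  let ?U = "{f \<in> grade ?A p. ?e (f \<otimes>\<^bsub>?A\<^esub> g) = supercomm p q (?e f) (?e g)}"
  have gc: "g \<in> carrier ?A"
    using g by (rule A.grade_in)
  have "subspace_of ?U ?A"
  proof (rule A.subspaceI)
    show "x \<oplus>\<^bsub>?A\<^esub> y \<in> ?U" if "x \<in> ?U" "y \<in> ?U" for x y
      using that gc A.gradeD(4)[of x p y] A.grade_in[of x p] A.grade_in[of y p]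
      by (simp add: A.add_mult assoc_eval_add supercomm_add_left)
    show "c \<odot>\<^bsub>?A\<^esub> x \<in> ?U" if "x \<in> ?U" for c x
      using that gc A.gradeD(5)[of x p c] A.grade_in[of x p]
      by (simp add: A.smult_mult assoc_eval_smult supercomm_scl_left)
  qed (use gc A.gradeD(3) in \<open>auto simp: assoc_eval_zero\<close>)
  then have "f \<in> ?U"
  proof (rule free_nonassoc_grade_span[OF _ f])
    fix m assume m: "set_monomial m \<subseteq> G" "parity d m = p"
    then show "unit_fun m \<in> ?U"
      using unit[OF m] unit_fun_in_grade[OF m(1), of d] by simp
  qed
  then show ?thesis
    by simp
qed

text \<open>A way to build a graded ideal from data in each parity. It is needed for kernels of maps
  whose bracket rule makes sense only for homogeneous arguments.\<close>

lemma (in superalgebra) superideal_sum: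
  assumes sub: "\<And>p. subspace_of (K p) L" "\<And>p. K p \<subseteq> grade L p"
    and mult: "\<And>p q x y. x \<in> K p \<Longrightarrow> y \<in> grade L q \<Longrightarrow> x \<otimes> y \<in> K (p + q) \<and> y \<otimes> x \<in> K (q + p)"
  shows "superideal {x \<oplus> y | x y. x \<in> K 0 \<and> y \<in> K 1} L" (is "superideal ?K L")
proof (rule superidealI)
  note K = subspaceD[OF sub(1)]
  have add: "u \<oplus> v \<in> ?K" if uv: "u \<in> ?K" "v \<in> ?K" for u v
  proof -
    obtain x y x' y' where "u = x \<oplus> y" "v = x' \<oplus> y'" "x \<in> K 0" "y \<in> K 1" "x' \<in> K 0" "y' \<in> K 1"
      using uv by blast
    moreover from this have "u \<oplus> v = (x \<oplus> x') \<oplus> (y \<oplus> y')"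
      using K(2) by (simp add: M.a_ac)
    ultimately show ?thesis
      using K(4) by blast
  qed
  show "subspace_of ?K L"
  proof (rule subspaceI)
    show "?K \<subseteq> carrier L"
      using K(2) by auto
    show "\<zero> \<in> ?K"
      using K(3) by force
    show "c \<odot> u \<in> ?K" if u: "u \<in> ?K" for c u
    proof -
      obtain x y where "u = x \<oplus> y" "x \<in> K 0" "y \<in> K 1"
        using u by blast
      moreover from this have "c \<odot> u = c \<odot> x \<oplus> c \<odot> y"
        using K(2) by (simp add: smult_add)
      ultimately show ?thesis
        using K(5) by blast
    qed
  qed (rule add)
  show "x0 \<in> ?K \<and> x1 \<in> ?K" if x: "x0 \<in> grade L 0" "x1 \<in> grade L 1" "x0 \<oplus> x1 \<in> ?K" for x0 x1
  proof -
    obtain x y where xy: "x0 \<oplus> x1 = x \<oplus> y" "x \<in> K 0" "y \<in> K 1"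
      using x by blast
    then have "x0 = x \<and> x1 = y"
      using x sub(2) by (intro decomp_unique) auto
    moreover have "x = x \<oplus> \<zero>" "y = \<zero> \<oplus> y"
      using xy K(2) by auto
    ultimately show ?thesis
      using xy K(3) by blast
  qed
  have hom: "x \<in> ?K" if x: "x \<in> K p" for x p
  proof -
    have "x = x \<oplus> \<zero>" "x = \<zero> \<oplus> x"
      using x K(2) by auto
    then show ?thesis
      using x K(3) by (cases p) blast+
  qed
  show "u \<otimes> v \<in> ?K \<and> v \<otimes> u \<in> ?K" if u: "u \<in> ?K" and v: "v \<in> carrier L" for u v
  proof -
    obtain x y where u': "u = x \<oplus> y" "x \<in> K 0" "y \<in> K 1"
      using u by blast
    obtain v0 v1 where v': "v = v0 \<oplus> v1" "v0 \<in> grade L 0" "v1 \<in> grade L 1"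
      using decomp[OF v] .
    have c: "x \<in> carrier L" "y \<in> carrier L" "v0 \<in> carrier L" "v1 \<in> carrier L"
      using u' v' K(2) by auto
    have "u \<otimes> v = (x \<otimes> v0 \<oplus> x \<otimes> v1) \<oplus> (y \<otimes> v0 \<oplus> y \<otimes> v1)"
      "v \<otimes> u = (v0 \<otimes> x \<oplus> v0 \<otimes> y) \<oplus> (v1 \<otimes> x \<oplus> v1 \<otimes> y)"
      using c u'(1) v'(1) by (simp_all add: add_mult mult_add M.a_ac)
    moreover have "x \<otimes> v0 \<in> ?K" "x \<otimes> v1 \<in> ?K" "y \<otimes> v0 \<in> ?K" "y \<otimes> v1 \<in> ?K"
      "v0 \<otimes> x \<in> ?K" "v0 \<otimes> y \<in> ?K" "v1 \<otimes> x \<in> ?K" "v1 \<otimes> y \<in> ?K"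
      using mult[OF u'(2) v'(2)] mult[OF u'(2) v'(3)] mult[OF u'(3) v'(2)] mult[OF u'(3) v'(3)] hom
      by blast+
    ultimately show ?thesis
      using add by simp
  qed
qed

definition assoc_kernel ::
    "'x set \<Rightarrow> ('x \<Rightarrow> bit) \<Rightarrow> ('x \<Rightarrow> 'w::monoid_add \<Rightarrow>\<^sub>0 'k::field) \<Rightarrow> ('w \<Rightarrow>\<^sub>0 'k) set \<Rightarrow> bit \<Rightarrow> ('x monomial \<Rightarrow> 'k) set"
  where "assoc_kernel G d h J p = {f \<in> grade (free_nonassoc G d) p. assoc_eval d h f \<in> J}"

text \<open>Supercommutators satisfy the super sign and Jacobi laws, so the kernel modulo
  \<open>J\<close> contains all Lie relators. Membership is described for homogeneous elements only,
  as the ideal is assembled from its two parts. With such a \<open>K\<close>, checking the finitely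
  many relators of a presentation is enough to control its whole kernel.\<close>

lemma assoc_kernel_superideal:
  fixes J :: "('w::monoid_add \<Rightarrow>\<^sub>0 'k::field) set" and G :: "'x set"
  assumes J: "two_sided_ideal J"
  obtains K where "superideal K (free_nonassoc G d)" "lie_relators (free_nonassoc G d) \<subseteq> K"
    "\<And>f p. f \<in> grade (free_nonassoc G d) p \<Longrightarrow> f \<in> K \<longleftrightarrow> assoc_eval d h f \<in> J"
proof -
  let ?A = "free_nonassoc G d :: ('k, _) superalgebra" and ?K = "assoc_kernel G d h J" and ?e = "assoc_eval d h"
  interpret A: superalgebra ?A
    by (rule superalgebra_free_nonassoc)
  let ?I = "{x \<oplus>\<^bsub>?A\<^esub> y | x y. x \<in> ?K 0 \<and> y \<in> ?K 1}"
  note J' = two_sided_idealD[OF J] two_sided_ideal_scl[OF J]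
  have sub: "subspace_of (?K p) ?A" for p
  proof (rule A.subspaceI)
    show "x \<oplus>\<^bsub>?A\<^esub> y \<in> ?K p" if "x \<in> ?K p" "y \<in> ?K p" for x y
      using that J'(2) A.gradeD(4)[of x p y] A.grade_in[of x p] A.grade_in[of y p] by (simp add: assoc_kernel_def assoc_eval_add)
    show "c \<odot>\<^bsub>?A\<^esub> x \<in> ?K p" if "x \<in> ?K p" for c x
      using that J'(7) A.gradeD(5)[of x p c] A.grade_in[of x p] by (simp add: assoc_kernel_def assoc_eval_smult)
  qed (use J'(1) A.gradeD(3) in \<open>auto simp: assoc_kernel_def assoc_eval_zero\<close>)
  have I: "superideal ?I ?A"
  proof (rule A.superideal_sum[OF sub])
    show "x \<otimes>\<^bsub>?A\<^esub> y \<in> ?K (p + q) \<and> y \<otimes>\<^bsub>?A\<^esub> x \<in> ?K (q + p)" if x: "x \<in> ?K p" and y: "y \<in> grade ?A q" for p q x y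
    proof -
      have x': "x \<in> grade ?A p" "?e x \<in> J"
        using x by (simp_all add: assoc_kernel_def)
      show ?thesis
        using A.grade_mult[OF x'(1) y] A.grade_mult[OF y x'(1)] x'(2)
          assoc_eval_mult[OF x'(1) y, of h] assoc_eval_mult[OF y x'(1), of h]
        by (simp add: assoc_kernel_def two_sided_ideal_supercomm[OF J])
    qed
  qed (auto simp: assoc_kernel_def)
  have mem: "f \<in> ?I \<longleftrightarrow> ?e f \<in> J" if f: "f \<in> grade ?A p" for f p
  proof
    assume "f \<in> ?I"
    then obtain x y where xy: "f = x \<oplus>\<^bsub>?A\<^esub> y" "x \<in> ?K 0" "y \<in> ?K 1"
      by blast
    then show "?e f \<in> J"
      using J'(2) A.grade_in[of x 0] A.grade_in[of y 1] by (simp add: assoc_kernel_def assoc_eval_add)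
  next
    assume "?e f \<in> J"
    then have "f \<in> ?K p"
      using f by (simp add: assoc_kernel_def)
    moreover have "f = f \<oplus>\<^bsub>?A\<^esub> \<zero>\<^bsub>?A\<^esub>" "f = \<zero>\<^bsub>?A\<^esub> \<oplus>\<^bsub>?A\<^esub> f"
      using f by auto
    ultimately show "f \<in> ?I"
      using A.subspaceD(3)[OF sub] by (cases p) blast+
  qed
  have "lie_relators ?A \<subseteq> ?I"
  proof
    fix r assume "r \<in> lie_relators ?A"
    then consider
      (skew) x y p q where "r = x \<otimes>\<^bsub>?A\<^esub> y \<oplus>\<^bsub>?A\<^esub> super_sign p q \<odot>\<^bsub>?A\<^esub> (y \<otimes>\<^bsub>?A\<^esub> x)"
        "x \<in> grade ?A p" "y \<in> grade ?A q"
    | (jacobi) x y z p q r' where "r = x \<otimes>\<^bsub>?A\<^esub> (y \<otimes>\<^bsub>?A\<^esub> z)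
         \<ominus>\<^bsub>?A\<^esub> ((x \<otimes>\<^bsub>?A\<^esub> y) \<otimes>\<^bsub>?A\<^esub> z \<oplus>\<^bsub>?A\<^esub> super_sign p q \<odot>\<^bsub>?A\<^esub> (y \<otimes>\<^bsub>?A\<^esub> (x \<otimes>\<^bsub>?A\<^esub> z)))"
        "x \<in> grade ?A p" "y \<in> grade ?A q" "z \<in> grade ?A r'"
      unfolding lie_relators_def by blast
    then show "r \<in> ?I"
    proof cases
      case skew
      have m: "x \<otimes>\<^bsub>?A\<^esub> y \<in> grade ?A (p + q)" "y \<otimes>\<^bsub>?A\<^esub> x \<in> grade ?A (p + q)"
        using A.grade_mult[OF skew(2,3)] A.grade_mult[OF skew(3,2)] by (simp_all add: add.commute)
      have "?e r = 0"
        using skew m supercomm_skew[of p q "?e x" "?e y"]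
        by (simp add: assoc_eval_add assoc_eval_smult assoc_eval_mult[OF skew(2,3)] assoc_eval_mult[OF skew(3,2)])
      moreover have "r \<in> grade ?A (p + q)"
        unfolding skew(1) by (intro A.gradeD(4,5) m)
      ultimately show ?thesis
        using mem J'(1) by simp
    next
      case jacobi
      note g = jacobi(2-4)
      have yz: "y \<otimes>\<^bsub>?A\<^esub> z \<in> grade ?A (q + r')" and xy: "x \<otimes>\<^bsub>?A\<^esub> y \<in> grade ?A (p + q)"
        and xz: "x \<otimes>\<^bsub>?A\<^esub> z \<in> grade ?A (p + r')"
        using g by (auto intro: A.grade_mult)
      have m: "x \<otimes>\<^bsub>?A\<^esub> (y \<otimes>\<^bsub>?A\<^esub> z) \<in> grade ?A (p + q + r')" "(x \<otimes>\<^bsub>?A\<^esub> y) \<otimes>\<^bsub>?A\<^esub> z \<in> grade ?A (p + q + r')"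
        "y \<otimes>\<^bsub>?A\<^esub> (x \<otimes>\<^bsub>?A\<^esub> z) \<in> grade ?A (p + q + r')"
        using A.grade_mult[OF g(1) yz] A.grade_mult[OF xy g(3)] A.grade_mult[OF g(2) xz]
        by (simp_all add: add_ac)
      let ?r = "(x \<otimes>\<^bsub>?A\<^esub> y) \<otimes>\<^bsub>?A\<^esub> z \<oplus>\<^bsub>?A\<^esub> super_sign p q \<odot>\<^bsub>?A\<^esub> (y \<otimes>\<^bsub>?A\<^esub> (x \<otimes>\<^bsub>?A\<^esub> z))"
      have rg: "?r \<in> grade ?A (p + q + r')"
        by (intro A.gradeD(4,5) m)
      have r_eq: "r = x \<otimes>\<^bsub>?A\<^esub> (y \<otimes>\<^bsub>?A\<^esub> z) \<oplus>\<^bsub>?A\<^esub> (- 1) \<odot>\<^bsub>?A\<^esub> ?r"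
        unfolding jacobi(1) a_minus_def using rg by (subst A.a_inv_eq) (rule A.grade_in, simp_all)
      have er: "?e ?r = supercomm (p + q) r' (supercomm p q (?e x) (?e y)) (?e z) +
          scl (super_sign p q) (supercomm q (p + r') (?e y) (supercomm p r' (?e x) (?e z)))"
        using m by (simp add: assoc_eval_add assoc_eval_smult assoc_eval_mult[OF xy g(3)]
            assoc_eval_mult[OF g(2) xz] assoc_eval_mult[OF g(1,2)] assoc_eval_mult[OF g(1,3)])
      have "?e r = ?e (x \<otimes>\<^bsub>?A\<^esub> (y \<otimes>\<^bsub>?A\<^esub> z)) - ?e ?r"
        unfolding r_eq using m(1) rg by (subst assoc_eval_add) (simp_all add: assoc_eval_smult)
      also have "\<dots> = 0"
        using supercomm_jacobi[of p q r' "?e x" "?e y" "?e z"]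
        unfolding er by (simp add: assoc_eval_mult[OF g(1) yz] assoc_eval_mult[OF g(2,3)])
      finally have "?e r = 0" .
      moreover have "r \<in> grade ?A (p + q + r')"
        unfolding r_eq by (intro A.gradeD(4,5) m rg)
      ultimately show ?thesis
        using mem J'(1) by simp
    qed
  qed
  then show thesis
    using that I mem by blast
qed

section \<open>Representations modulo a two-sided ideal\<close>

text \<open>The relation \<open>H p\<close> is the graph of the even or odd part of a linear map to the associative
  algebra modulo \<open>J\<close> that turns brackets into supercommutators.\<close>

locale super_rep = superalgebra L
  for L :: "('k::field, 'a) superalgebra" (structure) +
  fixes J :: "('w::monoid_add \<Rightarrow>\<^sub>0 'k) set" and H :: "bit \<Rightarrow> 'a \<Rightarrow> ('w \<Rightarrow>\<^sub>0 'k) \<Rightarrow> bool"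
  assumes J: "two_sided_ideal J"
    and H_grade: "H p x a \<Longrightarrow> x \<in> grade L p"
    and H_zero: "H p \<zero> 0"
    and H_add: "H p x a \<Longrightarrow> H p y b \<Longrightarrow> H p (x \<oplus> y) (a + b)"
    and H_smult: "H p x a \<Longrightarrow> H p (c \<odot> x) (scl c a)"
    and H_mult: "H p x a \<Longrightarrow> H q y b \<Longrightarrow> H (p + q) (x \<otimes> y) (supercomm p q a b)"
    and H_zeroD: "H p \<zero> a \<Longrightarrow> a \<in> J"
begin

lemma H_diff:
  assumes "H p x a" "H p y b"
  shows "H p (x \<ominus> y) (a - b)"
  using H_add[OF assms(1) H_smult[OF assms(2), of "- 1"]] H_grade[OF assms(2)]
  by (simp add: a_minus_def a_inv_eq)

lemma H_unique: "H p x a \<Longrightarrow> H p x b \<Longrightarrow> a - b \<in> J"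
  using H_diff[of p x a x b] H_zeroD[of p "a - b"] H_grade[of p x a] by (simp add: a_minus_def M.r_neg)

text \<open>The relation is compatible with brackets and linear operations, so values on the
  generators propagate to monomials and then to their combinations.\<close>

lemma H_eval:
  fixes f :: "'x monomial \<Rightarrow> 'k"
  assumes e: "e \<in> superalgebra_hom (free_nonassoc G d) L"
    and gen: "\<And>g. g \<in> G \<Longrightarrow> H (d g) (e (unit_fun (Gen g))) (h g)"
    and f: "f \<in> grade (free_nonassoc G d) p"
  shows "H p (e f) (assoc_eval d h f)"
proof -
  let ?A = "free_nonassoc G d :: ('k, _) superalgebra"
  interpret hom: superalgebra_homomorphism ?A L e
    by (intro superalgebra_homomorphism.intro superalgebra_homomorphism_axioms.intro
        superalgebra_free_nonassoc superalgebra_axioms e)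
  let ?U = "{f \<in> grade ?A p. H p (e f) (assoc_eval d h f)}"
  have mon: "H (parity d m) (e (unit_fun m)) (assoc_monomial d h m)" if "set_monomial m \<subseteq> G" for m
    using that
  proof (induction m)
    case (Gen g)
    then show ?case
      using gen by simp
  next
    case (Prod s t)
    have "e (unit_fun (Prod s t)) = e (unit_fun s \<otimes>\<^bsub>?A\<^esub> unit_fun t)"
      by (simp add: free_nonassoc_simps nonassoc_mult_unit_fun)
    also have "\<dots> = e (unit_fun s) \<otimes> e (unit_fun t)"
      using Prod.prems by (intro hom.homD(4) unit_fun_in_carrier) auto
    finally show ?case
      using H_mult[OF Prod.IH] Prod.prems by simp
  qed
  have "subspace_of ?U ?A"
  proof (rule hom.L.subspaceI)
    show "x \<oplus>\<^bsub>?A\<^esub> y \<in> ?U" if "x \<in> ?U" "y \<in> ?U" for x y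
      using that hom.L.gradeD(4)[of x p y] hom.L.grade_in[of x p] hom.L.grade_in[of y p] H_add[of p "e x" _ "e y"] by (simp add: assoc_eval_add)
    show "c \<odot>\<^bsub>?A\<^esub> x \<in> ?U" if "x \<in> ?U" for c x
      using that hom.L.gradeD(5)[of x p c] hom.L.grade_in[of x p] H_smult[of p "e x" _ c] by (simp add: assoc_eval_smult)
  qed (use hom.L.gradeD(3) H_zero in \<open>auto simp: assoc_eval_zero\<close>)
  then have "f \<in> ?U"
  proof (rule free_nonassoc_grade_span[OF _ f])
    fix m assume m: "set_monomial m \<subseteq> G" "parity d m = p"
    then show "unit_fun m \<in> ?U"
      using mon[OF m(1)] unit_fun_in_grade[OF m(1), of d] by (simp add: assoc_eval_unit_fun)
  qed
  then show ?thesis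
    by simp
qed

end

definition subst_hom :: "('x \<Rightarrow> 'w::monoid_add \<Rightarrow>\<^sub>0 'k::field) \<Rightarrow> ('x list \<Rightarrow>\<^sub>0 'k) \<Rightarrow> 'w \<Rightarrow>\<^sub>0 'k"
  where "subst_hom h = lext (\<lambda>w. prod_list (map h w))"

lemma subst_hom_mult: "subst_hom h (a * b) = subst_hom h a * subst_hom h b"
proof (induction a rule: poly_mapping_induct_single)
  case (single w c)
  show ?case
    by (induction b rule: poly_mapping_induct_single)
      (simp_all add: subst_hom_def lext_add lext_single mult_single algebra_simps plus_list_def scl_simps)
qed (simp_all add: subst_hom_def lext_add algebra_simps)

lemma subst_hom_assoc_monomial:
  "subst_hom h (assoc_monomial d (\<lambda>g. word [g]) m) = assoc_monomial d h m"
  by (induction m)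
    (simp_all add: supercomm_def subst_hom_mult[symmetric] subst_hom_def lext_single lext_diff lext_scl,
     simp add: subst_hom_mult flip: subst_hom_def)

text \<open>Evaluation at \<open>h\<close> factors through the free associative algebra on the
  generators, so freeness of the elements \<open>h g\<close> can be tested there.\<close>

lemma subst_hom_assoc_eval: "subst_hom h (assoc_eval d (\<lambda>g. word [g]) f) = assoc_eval d h f"
proof -
  have "subst_hom h (lext (assoc_monomial d (\<lambda>g. word [g])) a) = lext (assoc_monomial d h) a" for a
    using subst_hom_assoc_monomial[of h d]
    by (intro lext_eqI) (simp_all add: subst_hom_def lext_add lext_scl lext_single)
  then show ?thesis
    by (simp add: assoc_eval_def)
qed

section \<open>A diamond lemma for quadratic-linear relations\<close>

lemma lext_cong: "(\<And>i. i \<in> keys a \<Longrightarrow> \<phi> i = \<psi> i) \<Longrightarrow> lext \<phi> a = lext \<psi> a"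
  unfolding lext_def by (rule sum.cong) auto

lemma lext_eq_zero: "(\<And>i. i \<in> keys a \<Longrightarrow> \<phi> i = 0) \<Longrightarrow> lext \<phi> a = 0"
  unfolding lext_def by (rule sum.neutral) auto

lemma keys_lext: "w \<in> keys (lext \<phi> a) \<Longrightarrow> \<exists>i\<in>keys a. w \<in> keys (\<phi> i)"
  by (rule ccontr) (auto simp: lext_def in_keys_iff lookup_sum)

lemma keys_word_sandwich:
  assumes "w \<in> keys (word u * a * (word v :: 'x list \<Rightarrow>\<^sub>0 'k::field))"
  shows "\<exists>w'\<in>keys a. w = u @ w' @ v"
proof -
  obtain w1 w2 where "w = w1 + w2" "w1 \<in> keys (word u * a)" "w2 \<in> keys (word v :: 'x list \<Rightarrow>\<^sub>0 'k)"
    using assms keys_mult by blast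
  moreover from this obtain u1 u2 where "w1 = u1 + u2" "u1 \<in> keys (word u :: 'x list \<Rightarrow>\<^sub>0 'k)" "u2 \<in> keys a"
    using keys_mult by blast
  ultimately show ?thesis
    by (auto simp: plus_list_def)
qed

text \<open>The right contexts may differ as long as the one after the smaller word is not longer;
  this happens when two places of a word are contracted.\<close>

lemma lenlex_append_mono:
  assumes "(a, b) \<in> lenlex r" "length s \<le> length s'"
  shows "(a @ s, b @ s') \<in> lenlex r"
proof (cases "length a < length b \<or> length s < length s'")
  case True
  then show ?thesis
    using assms lenlex_length[OF assms(1)] by (auto simp: lenlex_conv)
next
  case False
  then show ?thesis
    using assms by (intro lenlex_append1) auto
qed

lemma lenlex_shorter: "length a < length b \<Longrightarrow> (a, b) \<in> lenlex r"
  by (simp add: lenlex_conv)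

text \<open>The relations express the supercommutator of two letters by a combination of letters.
  They are imposed on pairs in \<open>D\<close> only, since in the HNN envelope \<open>t\<close> has
  no prescribed bracket with letters outside \<open>A\<close>. \<open>D_overlap\<close> and
  \<open>f_overlap\<close> ensure that all brackets met while resolving a critical pair are
  prescribed, and \<open>f_jacobi\<close> makes the two results agree. The primes 2 and 3 are
  excluded because of the words \<open>x x\<close> and \<open>x x x\<close> in an odd
  letter.\<close>

locale quadratic_linear =
  fixes r :: "('x \<times> 'x) set" and par :: "'x \<Rightarrow> bit" and D :: "'x \<Rightarrow> 'x \<Rightarrow> bool"
    and f :: "'x \<Rightarrow> 'x \<Rightarrow> 'x list \<Rightarrow>\<^sub>0 'k::field"
  assumes two: "(2::'k) \<noteq> 0" and three: "(3::'k) \<noteq> 0"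
    and wf_r: "wf r" and trans_r: "trans r" and total_r: "total r"
    and D_sym: "D x y \<Longrightarrow> D y x"
    and f_length: "D x y \<Longrightarrow> w \<in> keys (f x y) \<Longrightarrow> length w = 1"
    and f_skew: "D x y \<Longrightarrow> f x y = - scl (super_sign (par x) (par y)) (f y x)"
    and D_overlap: "D x y \<Longrightarrow> D y z \<Longrightarrow> (y, x) \<in> r\<^sup>= \<Longrightarrow> (z, y) \<in> r\<^sup>= \<Longrightarrow> D x z"
    and f_overlap: "D x y \<Longrightarrow> D y z \<Longrightarrow> D x z \<Longrightarrow> w \<in> keys (f y z) \<Longrightarrow>
        \<exists>l. w = [l] \<and> D x l \<and> par l = par y + par z"
    and f_jacobi: "D x y \<Longrightarrow> D y z \<Longrightarrow> D x z \<Longrightarrow>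
        lext (\<lambda>w. f x (hd w)) (f y z) =
          scl (super_sign (par x) (par y)) (lext (\<lambda>w. f y (hd w)) (f x z))
          - scl (super_sign (par x + par y) (par z)) (lext (\<lambda>w. f z (hd w)) (f x y))"
begin

abbreviation e where "e x y \<equiv> (super_sign (par x) (par y) :: 'k)"

definition inversion :: "'x \<Rightarrow> 'x \<Rightarrow> bool"
  where "inversion x y \<longleftrightarrow> D x y \<and> ((y, x) \<in> r \<or> x = y \<and> par x = 1)"

definition redexes :: "'x list \<Rightarrow> ('x list \<times> 'x \<times> 'x \<times> 'x list) set"
  where "redexes w = {(u, x, y, v). w = u @ [x, y] @ v \<and> inversion x y}"

text \<open>For an odd letter the relation reads \<open>2 x x = f x x\<close>, whence the factor
  \<open>1 / 2\<close>. For distinct letters it is a swap plus shorter words.\<close>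

definition contractum :: "'x \<Rightarrow> 'x \<Rightarrow> 'x list \<Rightarrow>\<^sub>0 'k"
  where "contractum x y = (if x = y then scl (1 / 2) (f x y) else scl (e x y) (word [y, x]) + f x y)"

definition relator :: "'x \<Rightarrow> 'x \<Rightarrow> 'x list \<Rightarrow>\<^sub>0 'k"
  where "relator x y = word [x, y] - scl (e x y) (word [y, x]) - f x y"

definition contract :: "('x list \<Rightarrow> 'x list \<Rightarrow>\<^sub>0 'k) \<Rightarrow> 'x list \<times> 'x \<times> 'x \<times> 'x list \<Rightarrow> 'x list \<Rightarrow>\<^sub>0 'k"
  where "contract F t = (case t of (u, x, y, v) \<Rightarrow> lext F (word u * contractum x y * word v))"

text \<open>Well-founded recursion along one reduction path, with the redex chosen arbitrarily. That
  every other redex leads to the same value is the content of \<open>confluent\<close>.\<close>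

definition nf :: "'x list \<Rightarrow> 'x list \<Rightarrow>\<^sub>0 'k"
  where "nf = wfrec (lenlex r) (\<lambda>F w. if redexes w = {} then word w else contract F (SOME t. t \<in> redexes w))"

abbreviation NF :: "('x list \<Rightarrow>\<^sub>0 'k) \<Rightarrow> 'x list \<Rightarrow>\<^sub>0 'k"
  where "NF \<equiv> lext nf"

lemma irrefl_r: "(x, x) \<notin> r"
  using wf_r by auto

lemma irrefl: "irrefl r"
  using irrefl_r by (auto simp: irrefl_def)

lemma lenlex_prefix: "(a, b) \<in> lenlex r \<Longrightarrow> (u @ a, u @ b) \<in> lenlex r"
  using irrefl by (simp add: lenlex_append2)

lemma lenlex_context: "(a, b) \<in> lenlex r \<Longrightarrow> length s \<le> length s' \<Longrightarrow> (u @ a @ s, u @ b @ s') \<in> lenlex r"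
  by (intro lenlex_prefix lenlex_append_mono)

lemma lenlex_swap: "(y, x) \<in> r \<Longrightarrow> ([y, x], [x, y]) \<in> lenlex r"
  by (simp add: Cons_lenlex_iff)

lemma contractum_lower:
  assumes "inversion x y" "w \<in> keys (contractum x y)"
  shows "(w, [x, y]) \<in> lenlex r"
proof -
  have D: "D x y"
    using assms by (simp add: inversion_def)
  have "w \<in> keys (f x y) \<or> (w = [y, x] \<and> x \<noteq> y)"
    using assms(2) keys_add[of "scl (e x y) (word [y, x])" "f x y"] keys_scl[of "1 / 2" "f x y"]
    by (auto simp: contractum_def simp del: scl_single split: if_splits dest!: subsetD[OF keys_scl])
  then show ?thesis
    using f_length[OF D] assms(1) by (auto simp: inversion_def lenlex_swap intro: lenlex_shorter)
qed

lemma nf_unfold: "nf w = (if redexes w = {} then word w else contract nf (SOME t. t \<in> redexes w))"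
proof -
  let ?F = "\<lambda>F w. if redexes w = {} then word w else contract F (SOME t. t \<in> redexes w)"
  have "nf w = ?F (cut nf (lenlex r) w) w"
    unfolding nf_def by (rule wfrec) (rule wf_lenlex[OF wf_r])
  moreover have "contract (cut nf (lenlex r) w) t = contract nf t" if "t \<in> redexes w" for t
  proof -
    obtain u x y v where t: "t = (u, x, y, v)" "w = u @ [x, y] @ v" "inversion x y"
      using \<open>t \<in> redexes w\<close> by (auto simp: redexes_def)
    \<comment> \<open>All words produced by a contraction are smaller, so cutting the recursive
      function off below \<open>w\<close> changes nothing.\<close>
    have "cut nf (lenlex r) w i = nf i" if i: "i \<in> keys (word u * contractum x y * word v)" for i
    proof -
      obtain w' where "w' \<in> keys (contractum x y)" "i = u @ w' @ v"
        using keys_word_sandwich[OF i] by blast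
      then have "(i, w) \<in> lenlex r"
        unfolding t(2) using contractum_lower[OF t(3)] by (auto intro!: lenlex_context simp del: append_Cons)
      then show ?thesis
        by (simp add: cut_apply)
    qed
    then show ?thesis
      unfolding contract_def t(1) prod.case by (rule lext_cong)
  qed
  moreover have "(SOME t. t \<in> redexes w) \<in> redexes w" if "redexes w \<noteq> {}"
    using that some_in_eq by blast
  ultimately show ?thesis
    by (cases "redexes w = {}") simp_all
qed

lemma nf_normal: "redexes w = {} \<Longrightarrow> nf w = word w"
  by (simp add: nf_unfold[of w])

lemma nf_contract_ex: "redexes w \<noteq> {} \<Longrightarrow> \<exists>t\<in>redexes w. nf w = contract nf t"
  using nf_unfold[of w] some_in_eq[of "redexes w"] by auto

lemma keys_nf: "w' \<in> keys (nf w) \<Longrightarrow> w' = w \<or> (w', w) \<in> lenlex r"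
proof (induction w arbitrary: w' rule: wf_induct_rule[OF wf_lenlex[OF wf_r]])
  case (1 w)
  show ?case
  proof (cases "redexes w = {}")
    case True
    then show ?thesis
      using 1(2) by (simp add: nf_normal)
  next
    case False
    then obtain u x y v where t: "nf w = contract nf (u, x, y, v)" "w = u @ [x, y] @ v" "inversion x y"
      using nf_contract_ex[OF False] by (auto simp: redexes_def)
    then obtain i where i: "i \<in> keys (word u * contractum x y * word v)" "w' \<in> keys (nf i)"
      using 1(2) keys_lext by (fastforce simp: contract_def)
    obtain w'' where "w'' \<in> keys (contractum x y)" "i = u @ w'' @ v"
      using keys_word_sandwich[OF i(1)] by blast
    then have "(i, w) \<in> lenlex r"
      unfolding t(2) using contractum_lower[OF t(3)] by (auto intro!: lenlex_context simp del: append_Cons)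
    then show ?thesis
      using 1(1)[OF _ i(2)] lenlex_trans[OF _ _ trans_r] by blast
  qed
qed

lemma NF_word: "NF (word w) = nf w"
  by (simp add: lext_single)

lemma word_minus_contractum:
  assumes "inversion x y"
  shows "\<exists>c. word [x, y] - contractum x y = scl c (relator x y)"
proof (cases "x = y")
  case True
  then have "par x = 1"
    using assms irrefl_r by (auto simp: inversion_def)
  then have "relator x y = scl 2 (word [x, y]) - f x y"
    using True by (simp add: relator_def super_sign_def flip: single_diff)
  then have "word [x, y] - contractum x y = scl (1 / 2) (relator x y)"
    using True two by (simp add: contractum_def pm.scale_right_diff_distrib)
  then show ?thesis
    by blast
next
  case False
  then have "word [x, y] - contractum x y = scl 1 (relator x y)"
    by (simp add: contractum_def relator_def)
  then show ?thesis
    by blast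
qed

lemma f_square_even: "D x x \<Longrightarrow> par x = 0 \<Longrightarrow> f x x = 0"
proof -
  assume "D x x" "par x = 0"
  then have "scl 2 (f x x) = 0"
    using f_skew[of x x] pm.scale_left_distrib[of 1 1 "f x x"] by (simp add: super_sign_def eq_neg_iff_add_eq_0)
  then show ?thesis
    using two by simp
qed

text \<open>The values on smaller words may be computed by contracting any redex; this is the induction
  hypothesis of the proof of confluence.\<close>

definition confluent_at :: "'x list \<Rightarrow> bool"
  where "confluent_at w \<longleftrightarrow> (\<forall>t\<in>redexes w. nf w = contract nf t)"

text \<open>The bracket with the letter \<open>x\<close>, extended linearly to combinations of
  letters; these are words of length one, which \<open>hd\<close> unpacks.\<close>

definition act :: "'x \<Rightarrow> ('x list \<Rightarrow>\<^sub>0 'k) \<Rightarrow> 'x list \<Rightarrow>\<^sub>0 'k"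
  where "act x a = lext (\<lambda>w. f x (hd w)) a"

text \<open>For distinct letters exactly one order of the pair is an inversion, and by confluence
  the normal form may be computed by contracting it; this gives the relation up to sign. An odd
  square gives half of it, and for an even square the relator is zero by
  \<open>f_square_even\<close>.\<close>

lemma NF_relator:
  assumes D: "D x y" and "confluent_at (u @ [x, y] @ v)" "confluent_at (u @ [y, x] @ v)"
  shows "NF (word u * relator x y * word v) = 0"
proof -
  let ?s = "\<lambda>a. word u * a * word v"
  have rel: "NF (?s (relator x y)) = nf (u @ [x, y] @ v) - scl (e x y) (nf (u @ [y, x] @ v)) - NF (?s (f x y))"
    by (simp add: relator_def algebra_simps scl_simps word_mult lext_diff lext_scl lext_add NF_word
        del: scl_single)
  have con: "nf (u @ [a, b] @ v) = NF (?s (contractum a b))" if "inversion a b" "confluent_at (u @ [a, b] @ v)" for a b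
    using that by (force simp: confluent_at_def redexes_def contract_def)
  have swap: "NF (?s (contractum a b)) = scl (e a b) (nf (u @ [b, a] @ v)) + NF (?s (f a b))" if "a \<noteq> b" for a b
    using that by (simp add: contractum_def algebra_simps scl_simps word_mult lext_diff lext_scl lext_add NF_word
        del: scl_single)
  have "x = y \<or> (y, x) \<in> r \<or> (x, y) \<in> r" "par x = 0 \<or> par x = 1"
    using total_r by (auto simp: total_on_def)
  then consider "x = y" "par x = 1" | "x = y" "par x = 0" | "(y, x) \<in> r" "x \<noteq> y" | "(x, y) \<in> r" "x \<noteq> y"
    using irrefl_r by metis
  then show ?thesis
  proof cases
    case 1
    then have "nf (u @ [x, x] @ v) = scl (1 / 2) (NF (?s (f x x)))"
      using con[of x x] assms by (simp add: inversion_def contractum_def scl_simps lext_scl)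
    then have "scl 2 (nf (u @ [x, x] @ v)) = NF (?s (f x x))"
      using two by simp
    moreover have "scl 2 (nf (u @ [x, x] @ v)) = nf (u @ [x, x] @ v) + nf (u @ [x, x] @ v)"
      using pm.scale_left_distrib[of 1 1 "nf (u @ [x, x] @ v)"] by simp
    ultimately show ?thesis
      using rel 1 by (simp add: super_sign_def)
  next
    case 2
    then show ?thesis
      using rel f_square_even[of x] D by (simp add: super_sign_def)
  next
    case 3
    then show ?thesis
      using rel con[of x y] swap[of x y] assms by (simp add: inversion_def)
  next
    case 4
    have "nf (u @ [y, x] @ v) = scl (e y x) (nf (u @ [x, y] @ v)) + NF (?s (f y x))"
      using 4 con[of y x] swap[of y x] assms D_sym[OF D] by (simp add: inversion_def)
    moreover have "NF (?s (f x y)) = - scl (e x y) (NF (?s (f y x)))"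
      by (simp add: f_skew[OF D] scl_simps lext_scl lext_uminus)
    moreover have "e x y * e y x = 1" "e x y = e y x"
      by (simp_all add: super_sign_def)
    ultimately show ?thesis
      using rel by (simp add: scl_simps)
  qed
qed

text \<open>The relation of \<open>x\<close> with a combination of letters of a common parity, by
  linearity from \<open>NF_relator\<close>. It is applied to the values of \<open>f\<close> arising
  in an overlap.\<close>

lemma NF_act:
  assumes a: "\<And>w. w \<in> keys a \<Longrightarrow> \<exists>l. w = [l] \<and> D x l \<and> par l = p"
    and c: "\<And>l. confluent_at (u @ [x, l] @ v) \<and> confluent_at (u @ [l, x] @ v)"
  shows "NF (word u * (word [x] * a - scl (super_sign (par x) p) (a * word [x]) - act x a) * word v) = 0"
proof -
  define \<Phi> where "\<Phi> a = NF (word u * (word [x] * a - scl (super_sign (par x) p) (a * word [x]) - act x a) * word v)" for a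
  have "\<Phi> a = lext (\<lambda>w. \<Phi> (word w)) a"
    by (rule lext_eqI)
      (simp_all add: \<Phi>_def act_def algebra_simps scl_simps lext_add lext_diff lext_scl pm.scale_left_commute)
  also have "\<dots> = 0"
  proof (rule lext_eq_zero)
    fix w assume "w \<in> keys a"
    then obtain l where l: "w = [l]" "D x l" "par l = p"
      using a by blast
    then have "\<Phi> (word w) = NF (word u * relator x l * word v)"
      by (simp add: \<Phi>_def relator_def act_def lext_single word_mult)
    then show "\<Phi> (word w) = 0"
      using NF_relator[OF l(2)] c by simp
  qed
  finally show ?thesis
    by (simp add: \<Phi>_def)
qed

lemma word_Cons: "word (x # v) = word [x] * (word v :: 'x list \<Rightarrow>\<^sub>0 'k)"
  and word_snoc: "word (u @ [x]) = word u * (word [x] :: 'x list \<Rightarrow>\<^sub>0 'k)"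
  by (simp_all add: word_mult)

lemma inversionD: "inversion x y \<Longrightarrow> D x y" "inversion x y \<Longrightarrow> (y, x) \<in> r\<^sup>="
  by (auto simp: inversion_def)

text \<open>The critical pair \<open>x y z\<close>. Both reductions are continued until their
  difference is a combination of relators in smaller contexts and of brackets of a letter with a
  value of \<open>f\<close>. The former vanish under \<open>NF\<close> by induction, and the latter
  cancel by the Jacobi identity.\<close>

lemma overlap_confluent:
  assumes xy: "inversion x y" and yz: "inversion y z"
    and low: "\<And>w'. (w', u @ [x, y, z] @ v) \<in> lenlex r \<Longrightarrow> confluent_at w'"
  shows "contract nf (u, x, y, z # v) = contract nf (u @ [x], y, z, v)"
proof -
  define \<Phi> where "\<Phi> a = NF (word u * a * word v)" for a
  have \<Phi>_simps: "\<Phi> (a + b) = \<Phi> a + \<Phi> b" "\<Phi> (a - b) = \<Phi> a - \<Phi> b" "\<Phi> (scl c a) = scl c (\<Phi> a)" for a b c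
    by (simp_all add: \<Phi>_def algebra_simps lext_add lext_diff scl_simps lext_scl)
  note D = inversionD(1)[OF xy] inversionD(1)[OF yz]
  have Dxz: "D x z"
    by (rule D_overlap[OF D inversionD(2)[OF xy] inversionD(2)[OF yz]])
  have low3: "confluent_at (u @ s @ v)" if "(s, [x, y, z]) \<in> lenlex r" for s
    using that by (intro low lenlex_context) simp_all
  have low2: "confluent_at (u @ [a, b] @ v)" for a b
    by (intro low3 lenlex_shorter) simp
  have rel_right: "\<Phi> (relator a b * word [c]) = 0"
    if "D a b" "([a, b, c], [x, y, z]) \<in> lenlex r" "([b, a, c], [x, y, z]) \<in> lenlex r" for a b c
    using NF_relator[OF that(1), of u "c # v"] low3[OF that(2)] low3[OF that(3)]
    by (simp add: \<Phi>_def word_Cons[of c v] mult.assoc)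
  have rel_left: "\<Phi> (word [c] * relator a b) = 0"
    if "D a b" "([c, a, b], [x, y, z]) \<in> lenlex r" "([c, b, a], [x, y, z]) \<in> lenlex r" for a b c
    using NF_relator[OF that(1), of "u @ [c]" v] low3[OF that(2)] low3[OF that(3)]
    by (simp add: \<Phi>_def word_snoc mult.assoc)
  let ?e1 = "e x y" and ?e2 = "e x z" and ?e3 = "e y z"
  let ?R = "\<lambda>x p a. word [x] * a - scl (super_sign (par x) p) (a * word [x]) - act x a"
  have R: "\<Phi> (?R x (par y + par z) (f y z)) = 0" "\<Phi> (?R y (par x + par z) (f x z)) = 0"
    "\<Phi> (?R z (par x + par y) (f x y)) = 0"
    unfolding \<Phi>_def using low2 f_overlap[OF D Dxz] f_overlap[OF D_sym[OF D(1)] Dxz D(2)]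
      f_overlap[OF D_sym[OF Dxz] D(1) D_sym[OF D(2)]]
    by (auto intro!: NF_act)
  \<comment> \<open>\<open>?b1\<close> and \<open>?b2'\<close> are reduced in two steps,
    \<open>?b2\<close> and \<open>?b1'\<close> in one. If \<open>x = y\<close>, the word
    \<open>y x z\<close> is the overlap itself, and if \<open>y = z\<close>, so is
    \<open>x z y\<close>. Hence \<open>id1\<close>, which avoids \<open>y x z\<close>, serves the
    first coincidence and \<open>id2\<close>, which avoids \<open>x z y\<close>, the second: only
    smaller words may be used.\<close>
  let ?b1 = "scl ?e1 (scl ?e2 (word [y, z, x]) + word [y] * f x z) + f x y * word [z]"
    and ?b2 = "scl ?e3 (word [x, z, y]) + word [x] * f y z"
    and ?b1' = "scl ?e1 (word [y, x, z]) + f x y * word [z]"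
    and ?b2' = "scl ?e3 (scl ?e2 (word [z, x, y]) + f x z * word [y]) + word [x] * f y z"
  let ?common = "scl (?e1 * ?e2) (relator y z * word [x]) - scl (?e2 * ?e3) (word [z] * relator x y)
      - ?R x (par y + par z) (f y z) + scl ?e1 (?R y (par x + par z) (f x z))
      - scl (?e2 * ?e3) (?R z (par x + par y) (f x y))"
  have jac: "act x (f y z) = scl ?e1 (act y (f x z)) - scl (super_sign (par x + par y) (par z)) (act z (f x y))"
    unfolding act_def by (rule f_jacobi[OF D Dxz])
  have id1: "?b1 - ?b2 = ?common - scl ?e3 (relator x z * word [y])"
    unfolding relator_def jac
    by (cases "par x"; cases "par y"; cases "par z")
      (simp_all add: super_sign_def algebra_simps word_mult single_uminus)
  have id2: "?b1' - ?b2' = ?common + scl ?e1 (word [y] * relator x z)"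
    unfolding relator_def jac
    by (cases "par x"; cases "par y"; cases "par z")
      (simp_all add: super_sign_def algebra_simps word_mult single_uminus)
  have lin5: "\<Phi> (scl a A - scl b B - C + scl c E - scl d F) = 0"
    if "\<Phi> A = 0" "\<Phi> B = 0" "\<Phi> C = 0" "\<Phi> E = 0" "\<Phi> F = 0" for a b c d A B C E F
    using that by (simp add: \<Phi>_simps)
  note common = lin5[OF _ _ R]
  have lin_diff: "\<Phi> (A - scl c B) = 0" and lin_add: "\<Phi> (A + scl c B) = 0"
    if "\<Phi> A = 0" "\<Phi> B = 0" for A B c
    using that by (simp_all add: \<Phi>_simps)
  have con1: "contract nf (u, x, y, z # v) = \<Phi> (contractum x y * word [z])"
    by (simp add: contract_def \<Phi>_def word_Cons[of z v] mult.assoc)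
  have con2: "contract nf (u @ [x], y, z, v) = \<Phi> (word [x] * contractum y z)"
    by (simp add: contract_def \<Phi>_def word_snoc mult.assoc)
  have half: "a = b" if "a + a = b + b" for a b :: "'x list \<Rightarrow>\<^sub>0 'k"
  proof -
    have "scl 2 a = scl 2 b"
      using that pm.scale_left_distrib[of 1 1 a] pm.scale_left_distrib[of 1 1 b] by simp
    then show ?thesis
      using two by simp
  qed
  have double_eq: "a = a'" if "b = b'" "b' = a'" "b = q - b'" "a + a = q" for a a' b b' q :: "'x list \<Rightarrow>\<^sub>0 'k"
    by (rule half) (use that in \<open>simp add: eq_diff_eq diff_eq_eq\<close>)
  have double: "\<Phi> (c * scl (1 / 2) a * d) + \<Phi> (c * scl (1 / 2) a * d) = \<Phi> (c * a * d)" for a c d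
  proof -
    have "scl (1 / 2) q + scl (1 / 2) q = q" for q :: "'x list \<Rightarrow>\<^sub>0 'k"
      using two by (simp flip: pm.scale_left_distrib)
    then show ?thesis
      by (simp add: scl_simps \<Phi>_simps)
  qed
  consider "x = y" "y = z" "par x = 1" | "(z, y) \<in> r" "x = y" "par x = 1" | "(z, y) \<in> r" "(y, x) \<in> r"
    | "y = z" "(y, x) \<in> r" "par y = 1"
    using xy yz by (auto simp: inversion_def)
  then show ?thesis
  proof cases
    case 1
    \<comment> \<open>For three equal odd letters the Jacobi identity says
      \<open>3 [x,[x,x]] = 0\<close>; this is where characteristic 3 must be excluded.\<close>
    have "scl 3 (act x (f x x)) = 0"
      using jac 1 pm.scale_left_distrib[of 1 2 "act x (f x x)"] pm.scale_left_distrib[of 1 1 "act x (f x x)"]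
      by (simp add: super_sign_def eq_neg_iff_add_eq_0 algebra_simps)
    then have "act x (f x x) = 0"
      using three by simp
    then have "\<Phi> (word [x] * f x x) = \<Phi> (f x x * word [x])"
      using R(1) 1 by (simp add: super_sign_def \<Phi>_simps)
    moreover have "\<Phi> (contractum x y * word [z]) = scl (1 / 2) (\<Phi> (f x x * word [x]))"
      "\<Phi> (word [x] * contractum y z) = scl (1 / 2) (\<Phi> (word [x] * f x x))"
      using 1 by (simp_all add: contractum_def scl_simps \<Phi>_simps)
    ultimately show ?thesis
      unfolding con1 con2 by simp
  next
    case 2
    have zx: "(z, x) \<in> r" "y \<noteq> z"
      using 2 irrefl_r by auto
    have "\<Phi> (relator y z * word [x]) = 0" "\<Phi> (relator x z * word [y]) = 0" "\<Phi> (word [z] * relator x y) = 0"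
      using 2 zx D Dxz by (auto intro!: rel_right rel_left simp: Cons_lenlex_iff)
    then have "\<Phi> (?b1 - ?b2) = 0"
      unfolding id1 by (intro lin_diff common)
    then have "\<Phi> ?b1 = \<Phi> ?b2"
      by (simp only: \<Phi>_simps(2) right_minus_eq)
    moreover have "\<Phi> ?b2 = \<Phi> (word [x] * contractum y z)"
      by (rule arg_cong[of _ _ \<Phi>])
        (use zx in \<open>simp add: contractum_def algebra_simps scl_simps mult_single plus_list_def\<close>)
    \<comment> \<open>Contracting an odd square yields half of \<open>f x y\<close>, while the
      swapped form carries the sign -1. So the sum of the two agreeing values is the value of
      \<open>f x y * word [z]\<close>, and division by 2 in \<open>double_eq\<close> compares it
      with the contraction.\<close>
    moreover have "?b1 = f x y * word [z] - ?b2"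
      using 2 by (simp add: super_sign_def algebra_simps single_uminus)
    then have "\<Phi> ?b1 = \<Phi> (f x y * word [z]) - \<Phi> ?b2"
      by (simp only: \<Phi>_simps(2))
    moreover have "\<Phi> (contractum x y * word [z]) + \<Phi> (contractum x y * word [z]) = \<Phi> (f x y * word [z])"
      using 2 double[of 1 "f x y" "word [z]"] by (simp add: contractum_def)
    ultimately show ?thesis
      unfolding con1 con2 by (rule double_eq)
  next
    case 3
    have zx: "(z, x) \<in> r" "y \<noteq> z" "x \<noteq> y"
      using 3 irrefl_r trans_r by (auto dest: transD)
    have "\<Phi> (relator y z * word [x]) = 0" "\<Phi> (relator x z * word [y]) = 0" "\<Phi> (word [z] * relator x y) = 0"
      "\<Phi> (word [y] * relator x z) = 0"
      using 3 zx D Dxz by (auto intro!: rel_right rel_left simp: Cons_lenlex_iff)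
    then have "\<Phi> (?b1 - ?b2) = 0" and yxz: "\<Phi> (word [y] * relator x z) = 0"
      unfolding id1 by (blast intro: lin_diff common)+
    then have "\<Phi> ?b1 = \<Phi> ?b2"
      by (simp only: \<Phi>_simps(2) right_minus_eq)
    have "\<Phi> ?b2 = \<Phi> (word [x] * contractum y z)"
      by (rule arg_cong[of _ _ \<Phi>])
        (use zx in \<open>simp add: contractum_def algebra_simps scl_simps mult_single plus_list_def\<close>)
    have "contractum x y * word [z] = ?b1 + scl ?e1 (word [y] * relator x z)"
      using zx by (simp add: contractum_def relator_def algebra_simps scl_simps mult_single plus_list_def)
    then have "\<Phi> (contractum x y * word [z]) = \<Phi> ?b1 + scl ?e1 (\<Phi> (word [y] * relator x z))"
      by (simp only: \<Phi>_simps(1)[of ?b1] \<Phi>_simps(3)[of ?e1 "word [y] * relator x z"])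
    also have "\<dots> = \<Phi> ?b1"
      unfolding yxz by simp
    also have "\<dots> = \<Phi> (word [x] * contractum y z)"
      by (rule trans) fact+
    finally show ?thesis
      unfolding con1 con2 .
  next
    case 4
    have zx: "(z, x) \<in> r" "x \<noteq> y"
      using 4 irrefl_r by auto
    have "\<Phi> (relator y z * word [x]) = 0" "\<Phi> (word [y] * relator x z) = 0" "\<Phi> (word [z] * relator x y) = 0"
      using 4 zx D Dxz by (auto intro!: rel_right rel_left simp: Cons_lenlex_iff)
    then have "\<Phi> (?b1' - ?b2') = 0"
      unfolding id2 by (intro lin_add common)
    then have "\<Phi> ?b1' = \<Phi> ?b2'"
      by (simp only: \<Phi>_simps(2) right_minus_eq)
    then have "\<Phi> ?b2' = \<Phi> ?b1'"
      by (rule sym)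
    moreover have "\<Phi> ?b1' = \<Phi> (contractum x y * word [z])"
      by (rule arg_cong[of _ _ \<Phi>])
        (use zx in \<open>simp add: contractum_def algebra_simps scl_simps mult_single plus_list_def\<close>)
    moreover have "?b2' = word [x] * f y z - ?b1'"
      using 4 by (simp add: super_sign_def algebra_simps single_uminus)
    then have "\<Phi> ?b2' = \<Phi> (word [x] * f y z) - \<Phi> ?b1'"
      by (simp only: \<Phi>_simps(2))
    moreover have "\<Phi> (word [x] * contractum y z) + \<Phi> (word [x] * contractum y z) = \<Phi> (word [x] * f y z)"
      using 4 double[of "word [x]" "f y z" 1] by (simp add: contractum_def)
    ultimately have "\<Phi> (word [x] * contractum y z) = \<Phi> (contractum x y * word [z])"
      by (rule double_eq)
    then show ?thesis
      unfolding con1 con2 by (rule sym)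
  qed
qed

text \<open>Both sides equal the result of contracting both redexes. Each comparison is a relator
  next to a word that has already become smaller, so it vanishes by induction.\<close>

lemma disjoint_confluent:
  assumes xy: "inversion x y" and xy': "inversion x' y'"
    and low: "\<And>w'. (w', u @ [x, y] @ m @ [x', y'] @ v) \<in> lenlex r \<Longrightarrow> confluent_at w'"
  shows "contract nf (u, x, y, m @ [x', y'] @ v) = contract nf (u @ [x, y] @ m, x', y', v)"
proof -
  let ?w = "u @ [x, y] @ m @ [x', y'] @ v"
  have "contract nf (u, x, y, m @ [x', y'] @ v) =
      NF (word u * contractum x y * word m * contractum x' y' * word v)"
  proof -
    obtain c where c: "word [x', y'] - contractum x' y' = scl c (relator x' y')"
      using word_minus_contractum[OF xy'] by blast
    define \<Phi> where "\<Phi> a = NF (word u * a * word m * relator x' y' * word v)" for a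
    have "\<Phi> (contractum x y) = lext (\<lambda>w. \<Phi> (word w)) (contractum x y)"
      by (rule lext_eqI) (simp_all add: \<Phi>_def algebra_simps scl_simps lext_add lext_scl)
    also have "\<dots> = 0"
    proof (rule lext_eq_zero)
      fix w assume "w \<in> keys (contractum x y)"
      then have w: "(w, [x, y]) \<in> lenlex r"
        by (rule contractum_lower[OF xy])
      have con: "confluent_at ((u @ w @ m) @ s @ v)" if "length s = 2" for s
        using that lenlex_context[OF w, of "m @ s @ v" "m @ [x', y'] @ v" u] by (intro low) simp
      have "NF (word (u @ w @ m) * relator x' y' * word v) = 0"
        by (rule NF_relator[OF inversionD(1)[OF xy'] con con]) simp_all
      then show "\<Phi> (word w) = 0"
        by (simp add: \<Phi>_def word_mult)
    qed
    finally have "NF (word u * contractum x y * word m * (word [x', y'] - contractum x' y') * word v) = 0"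
      unfolding c \<Phi>_def by (simp add: scl_simps lext_scl)
    then show ?thesis
      by (simp add: contract_def algebra_simps lext_diff word_mult[of m "x' # y' # v", symmetric]
          word_mult[of "[x', y']" v, simplified, symmetric])
  qed
  also have "\<dots> = contract nf (u @ [x, y] @ m, x', y', v)"
  proof -
    obtain c where c: "word [x, y] - contractum x y = scl c (relator x y)"
      using word_minus_contractum[OF xy] by blast
    define \<Phi> where "\<Phi> a = NF (word u * relator x y * word m * a * word v)" for a
    have "\<Phi> (contractum x' y') = lext (\<lambda>w. \<Phi> (word w)) (contractum x' y')"
      by (rule lext_eqI) (simp_all add: \<Phi>_def algebra_simps scl_simps lext_add lext_scl)
    also have "\<dots> = 0"
    proof (rule lext_eq_zero)
      fix w assume "w \<in> keys (contractum x' y')"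
      then have w: "(w, [x', y']) \<in> lenlex r"
        by (rule contractum_lower[OF xy'])
      have "confluent_at (u @ [x, y] @ (m @ w @ v))"
        using lenlex_context[OF w, of v v "u @ [x, y] @ m"] by (intro low) simp
      moreover have "confluent_at (u @ [y, x] @ (m @ w @ v))"
      proof (cases "x = y")
        case True
        then show ?thesis
          using calculation by simp
      next
        case False
        then have "([y, x], [x, y]) \<in> lenlex r"
          using xy by (auto simp: inversion_def intro: lenlex_swap)
        moreover have "length (m @ w @ v) \<le> length (m @ [x', y'] @ v)"
          using lenlex_length[OF w] by simp
        ultimately show ?thesis
          by (intro low lenlex_context)
      qed
      ultimately have "NF (word u * relator x y * word (m @ w @ v)) = 0"
        by (intro NF_relator inversionD(1)[OF xy])
      then show "\<Phi> (word w) = 0"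
        by (simp add: \<Phi>_def word_mult mult.assoc)
    qed
    finally have "NF (word u * (word [x, y] - contractum x y) * word m * contractum x' y' * word v) = 0"
      unfolding c \<Phi>_def by (simp add: scl_simps lext_scl)
    then have "NF (word u * word [x, y] * word m * contractum x' y' * word v)
        = NF (word u * contractum x y * word m * contractum x' y' * word v)"
      by (simp add: algebra_simps lext_diff)
    then show ?thesis
      by (simp add: contract_def word_mult)
  qed
  finally show ?thesis .
qed

text \<open>Two redexes, ordered by position, coincide, overlap in one letter or are disjoint. The
  last two cases are the critical pairs settled above, by induction on the word.\<close>

theorem confluent: "confluent_at w"
proof (induction w rule: wf_induct_rule[OF wf_lenlex[OF wf_r]])
  case (1 w)
  have le: "contract nf (u, x, y, v) = contract nf (u', x', y', v')"
    if t: "(u, x, y, v) \<in> redexes w" "(u', x', y', v') \<in> redexes w" "length u \<le> length u'" for u x y v u' x' y' v'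
  proof -
    have w: "w = u @ [x, y] @ v" "w = u' @ [x', y'] @ v'" and inv: "inversion x y" "inversion x' y'"
      using t by (auto simp: redexes_def)
    have "u = take (length u) u'"
      using w t(3) by (metis append_eq_append_conv_if)
    then obtain s where s: "u' = u @ s"
      by (metis append_take_drop_id)
    then have eq: "[x, y] @ v = s @ [x', y'] @ v'"
      using w by simp
    show ?thesis
    proof (cases s)
      case Nil
      then show ?thesis
        using eq s by simp
    next
      case (Cons a s1)
      then have a: "a = x" "y # v = s1 @ [x', y'] @ v'"
        using eq by auto
      show ?thesis
      proof (cases s1)
        case Nil
        then have "x' = y" "v = y' # v'" "u' = u @ [x]"
          using a s Cons by auto
        then show ?thesis
          using overlap_confluent[of x y y' u v'] inv 1 w by simp
      next
        case (Cons b m)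
        then have "v = m @ [x', y'] @ v'" "u' = u @ [x, y] @ m"
          using a s \<open>s = a # s1\<close> by auto
        then show ?thesis
          using disjoint_confluent[of x y x' y' u m v'] inv 1 w by simp
      qed
    qed
  qed
  have all: "contract nf t = contract nf t'" if "t \<in> redexes w" "t' \<in> redexes w" for t t'
  proof -
    obtain u x y v u' x' y' v' where "t = (u, x, y, v)" "t' = (u', x', y', v')"
      by (metis prod_cases4)
    then show ?thesis
      using that le[of u x y v u' x' y' v'] le[of u' x' y' v' u x y v]
      by (cases "length u \<le> length u'") auto
  qed
  show ?case
    unfolding confluent_at_def
  proof
    fix t assume t: "t \<in> redexes w"
    then obtain t' where "t' \<in> redexes w" "nf w = contract nf t'"
      using nf_contract_ex[of w] by blast
    then show "nf w = contract nf t"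
      using all[OF t] by simp
  qed
qed

text \<open>The largest two-sided ideal inside the kernel of \<open>NF\<close>. In this form being
  an ideal is immediate, confluence puts all relators into it, and a nonzero \<open>NF\<close> still
  certifies that an element lies outside.\<close>

definition J :: "('x list \<Rightarrow>\<^sub>0 'k) set"
  where "J = {a. \<forall>u v. NF (u * a * v) = 0}"

lemma J_ideal: "two_sided_ideal J"
  unfolding two_sided_ideal_def
proof (intro conjI ballI allI)
  show "u * a \<in> J" "a * u \<in> J" if a: "a \<in> J" for a u
  proof -
    have "NF (v * (u * a) * v') = 0" for v v'
      using a by (simp add: J_def flip: mult.assoc)
    then show "u * a \<in> J"
      by (simp add: J_def)
    have "NF (v * (a * u) * v') = 0" for v v'
      using a by (simp add: J_def mult.assoc)
    then show "a * u \<in> J"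
      by (simp add: J_def)
  qed
qed (auto simp: J_def lext_add algebra_simps)

lemma NF_J: "a \<in> J \<Longrightarrow> NF a = 0"
proof -
  assume "a \<in> J"
  then have "NF (1 * a * 1) = 0"
    by (simp only: J_def mem_Collect_eq)
  then show ?thesis
    by simp
qed

lemma relator_in_J:
  assumes "D x y"
  shows "relator x y \<in> J"
proof -
  have "NF (a * relator x y * b) = 0" for a b
  proof (induction a rule: poly_mapping_induct_single)
    case (single u c)
    show ?case
    proof (induction b rule: poly_mapping_induct_single)
      case (single v c')
      have "single u c = scl c (word u :: 'x list \<Rightarrow>\<^sub>0 'k)" "single v c' = scl c' (word v :: 'x list \<Rightarrow>\<^sub>0 'k)"
        by simp_all
      then show ?case
        using NF_relator[OF assms confluent confluent, of u v] by (simp only: scl_simps lext_scl) simp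
    qed (simp_all add: distrib_left lext_add)
  qed (simp_all add: distrib_right lext_add)
  then show ?thesis
    by (simp add: J_def)
qed

end

section \<open>The universal envelope of an HNN extension\<close>

lemma lext_lext: "lext \<psi> (lext \<phi> a) = lext (\<lambda>i. lext \<psi> (\<phi> i)) a"
  by (rule lext_eqI) (simp_all add: lext_single lext_add lext_scl)

lemma lext_single_id: "lext (\<lambda>i. single i 1) a = a"
  by (rule lext_eqI[symmetric]) simp_all

text \<open>The letters of the envelope are a basis of \<open>B\<close> adapted to \<open>A\<close> and the letter \<^term>\<open>None\<close>,
  which stands for \<open>t\<close>. Only the relations \<open>[t, a]\<close> with \<open>a\<close> in \<open>A\<close> are imposed on \<^term>\<open>None\<close>.\<close>

locale hnn_basis = lie_superalgebra L
  for L :: "('k::field, 'a) superalgebra" (structure) +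
  fixes p :: bit and t :: 'a and A B :: "'a set" and \<B> :: "bit \<Rightarrow> 'a set"
    and \<kappa> :: "bit \<Rightarrow> 'a \<Rightarrow> 'a \<Rightarrow>\<^sub>0 'k" and r :: "('a option \<times> 'a option) set"
  assumes two: "(2::'k) \<noteq> 0" and three: "(3::'k) \<noteq> 0"
    and t: "t \<in> grade L p" and A: "subsuperalgebra A L" and B: "subsuperalgebra B L" and AB: "A \<subseteq> B"
    and tA: "a \<in> A \<Longrightarrow> t \<otimes> a \<in> B"
    and basis_subset: "\<B> q \<subseteq> B \<inter> grade L q"
    and basis_B: "subspace_of U L \<Longrightarrow> \<B> q \<subseteq> U \<Longrightarrow> B \<inter> grade L q \<subseteq> U"
    and basis_A: "subspace_of U L \<Longrightarrow> \<B> q \<inter> A \<subseteq> U \<Longrightarrow> A \<inter> grade L q \<subseteq> U"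
    and \<kappa>_add: "x \<in> B \<inter> grade L q \<Longrightarrow> y \<in> B \<inter> grade L q \<Longrightarrow> \<kappa> q (x \<oplus> y) = \<kappa> q x + \<kappa> q y"
    and \<kappa>_smult: "x \<in> B \<inter> grade L q \<Longrightarrow> \<kappa> q (c \<odot> x) = scl c (\<kappa> q x)"
    and \<kappa>_basis: "x \<in> \<B> q \<Longrightarrow> \<kappa> q x = single x 1"
    and \<kappa>_inj: "x \<in> B \<inter> grade L q \<Longrightarrow> \<kappa> q x = 0 \<Longrightarrow> x = \<zero>"
    and wf_r: "wf r" and trans_r: "trans r" and total_r: "total r"
    and r_None: "(None, l) \<notin> r" and r_A: "(l, Some a) \<in> r \<Longrightarrow> a \<in> A \<Longrightarrow> l \<in> Some ` A"
begin

definition val :: "'a option \<Rightarrow> 'a"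
  where "val l = (case l of None \<Rightarrow> t | Some x \<Rightarrow> x)"

text \<open>Letters that are not basis elements receive the default parity 0; \<open>D\<close>
  relates only basis letters and \<open>None\<close>.\<close>

definition par :: "'a option \<Rightarrow> bit"
  where "par l = (case l of None \<Rightarrow> p | Some x \<Rightarrow> if x \<in> \<B> 1 then 1 else 0)"

definition D :: "'a option \<Rightarrow> 'a option \<Rightarrow> bool"
  where "D l m \<longleftrightarrow> (\<exists>x\<in>\<B> 0 \<union> \<B> 1. \<exists>y\<in>\<B> 0 \<union> \<B> 1. l = Some x \<and> m = Some y)
    \<or> (\<exists>x\<in>(\<B> 0 \<union> \<B> 1) \<inter> A. l = None \<and> m = Some x \<or> l = Some x \<and> m = None)"

definition emb :: "bit \<Rightarrow> 'a \<Rightarrow> 'a option list \<Rightarrow>\<^sub>0 'k"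
  where "emb q z = lext (\<lambda>x. word [Some x]) (\<kappa> q z)"

definition f :: "'a option \<Rightarrow> 'a option \<Rightarrow> 'a option list \<Rightarrow>\<^sub>0 'k"
  where "f l m = emb (par l + par m) (val l \<otimes> val m)"

abbreviation Bq where "Bq q \<equiv> B \<inter> grade L q"

lemmas B_sub = subsuperalgebraD(1)[OF B] and A_sub = subsuperalgebraD(1)[OF A]

lemma Bq_sub: "subspace_of (Bq q) L" and Aq_sub: "subspace_of (A \<inter> grade L q) L"
  using B_sub A_sub grade_subspace[of q] by (auto simp: subspace_iff)

lemmas BqD = subspaceD[OF Bq_sub] and AqD = subspaceD[OF Aq_sub]

lemma basis_disjoint: "x \<in> \<B> q \<Longrightarrow> x \<in> \<B> q' \<Longrightarrow> q = q'"
proof (rule ccontr)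
  assume x: "x \<in> \<B> q" "x \<in> \<B> q'" "q \<noteq> q'"
  then have "x = \<zero>"
    using grade_disjoint[of x q q'] basis_subset by blast
  then have "\<kappa> q x = scl 0 (\<kappa> q x)"
    using \<kappa>_smult[of x q 0] basis_subset[of q] x(1) by (metis smult_zero subsetD)
  then have "keys (single x (1::'k)) = {}"
    using \<kappa>_basis[OF x(1)] by simp
  then show False
    by simp
qed

lemma par_Some: "x \<in> \<B> q \<Longrightarrow> par (Some x) = q"
  using basis_disjoint[of x q 1] by (cases q) (auto simp: par_def)

lemma par_None: "par None = p"
  by (simp add: par_def)

lemma emb_add: "x \<in> Bq q \<Longrightarrow> y \<in> Bq q \<Longrightarrow> emb q (x \<oplus> y) = emb q x + emb q y"
  by (simp add: emb_def \<kappa>_add lext_add)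

lemma emb_smult: "x \<in> Bq q \<Longrightarrow> emb q (c \<odot> x) = scl c (emb q x)"
  by (simp add: emb_def \<kappa>_smult lext_scl)

lemma emb_zero: "emb q \<zero> = 0"
  using emb_smult[of \<zero> q 0] BqD(3) by simp

lemma emb_basis: "x \<in> \<B> q \<Longrightarrow> emb q x = word [Some x]"
  by (simp add: emb_def \<kappa>_basis lext_single)

lemma emb_inj: "x \<in> Bq q \<Longrightarrow> emb q x = 0 \<Longrightarrow> x = \<zero>"
proof (rule \<kappa>_inj)
  assume "emb q x = 0"
  then have "lext (\<lambda>w. single (the (hd w)) 1) (emb q x) = (0 :: 'a \<Rightarrow>\<^sub>0 'k)"
    by simp
  then show "\<kappa> q x = 0"
    by (simp add: emb_def lext_lext lext_single lext_single_id)
qed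

lemma basis_induct [consumes 1, case_names basis zero add smult]:
  assumes "x \<in> Bq q" "\<And>x. x \<in> \<B> q \<Longrightarrow> P x" "P \<zero>"
    "\<And>x y. x \<in> Bq q \<Longrightarrow> y \<in> Bq q \<Longrightarrow> P x \<Longrightarrow> P y \<Longrightarrow> P (x \<oplus> y)"
    "\<And>c x. x \<in> Bq q \<Longrightarrow> P x \<Longrightarrow> P (c \<odot> x)"
  shows "P x"
proof -
  have "subspace_of {x \<in> Bq q. P x} L"
  proof (rule subspaceI)
    show "x \<oplus> y \<in> {x \<in> Bq q. P x}" if "x \<in> {x \<in> Bq q. P x}" "y \<in> {x \<in> Bq q. P x}" for x y
      using that BqD(4)[of x q y] assms(4)[of x y] by simp
    show "c \<odot> x \<in> {x \<in> Bq q. P x}" if "x \<in> {x \<in> Bq q. P x}" for c x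
      using that BqD(5)[of x q c] assms(5)[of x c] by simp
    show "\<zero> \<in> {x \<in> Bq q. P x}"
      using BqD(3)[of q] assms(3) by simp
  qed auto
  moreover have "\<B> q \<subseteq> {x \<in> Bq q. P x}"
    using basis_subset assms(2) by blast
  ultimately show ?thesis
    using basis_B assms(1) by blast
qed

lemma basis_A_induct [consumes 1, case_names basis zero add smult]:
  assumes "x \<in> A \<inter> grade L q" "\<And>x. x \<in> \<B> q \<Longrightarrow> x \<in> A \<Longrightarrow> P x" "P \<zero>"
    "\<And>x y. x \<in> A \<inter> grade L q \<Longrightarrow> y \<in> A \<inter> grade L q \<Longrightarrow> P x \<Longrightarrow> P y \<Longrightarrow> P (x \<oplus> y)"
    "\<And>c x. x \<in> A \<inter> grade L q \<Longrightarrow> P x \<Longrightarrow> P (c \<odot> x)"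
  shows "P x"
proof -
  have "subspace_of {x \<in> A \<inter> grade L q. P x} L"
  proof (rule subspaceI)
    show "x \<oplus> y \<in> {x \<in> A \<inter> grade L q. P x}" if "x \<in> {x \<in> A \<inter> grade L q. P x}" "y \<in> {x \<in> A \<inter> grade L q. P x}" for x y
      using that AqD(4)[of x q y] assms(4)[of x y] by simp
    show "c \<odot> x \<in> {x \<in> A \<inter> grade L q. P x}" if "x \<in> {x \<in> A \<inter> grade L q. P x}" for c x
      using that AqD(5)[of x q c] assms(5)[of x c] by simp
    show "\<zero> \<in> {x \<in> A \<inter> grade L q. P x}"
      using AqD(3)[of q] assms(3) by simp
  qed auto
  moreover have "\<B> q \<inter> A \<subseteq> {x \<in> A \<inter> grade L q. P x}"
    using basis_subset assms(2) by blast
  ultimately show ?thesis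
    using basis_A assms(1) by blast
qed

lemma keys_\<kappa>: "x \<in> Bq q \<Longrightarrow> keys (\<kappa> q x) \<subseteq> \<B> q"
proof (induction rule: basis_induct)
  case zero
  then show ?case
    using \<kappa>_smult[of \<zero> q 0] BqD(3) by simp
next
  case (add x y)
  then show ?case
    using keys_add[of "\<kappa> q x" "\<kappa> q y"] by (auto simp: \<kappa>_add)
next
  case (smult c x)
  then show ?case
    using keys_scl[of c "\<kappa> q x"] by (auto simp: \<kappa>_smult)
qed (simp add: \<kappa>_basis)

lemma keys_\<kappa>_A: "x \<in> A \<inter> grade L q \<Longrightarrow> keys (\<kappa> q x) \<subseteq> \<B> q \<inter> A"
proof (induction rule: basis_A_induct)
  case zero
  then show ?case
    using \<kappa>_smult[of \<zero> q 0] BqD(3) by simp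
next
  case (add x y)
  then have "\<kappa> q (x \<oplus> y) = \<kappa> q x + \<kappa> q y"
    using AB by (intro \<kappa>_add) auto
  then show ?case
    using keys_add[of "\<kappa> q x" "\<kappa> q y"] add by auto
next
  case (smult c x)
  then have "\<kappa> q (c \<odot> x) = scl c (\<kappa> q x)"
    using AB by (intro \<kappa>_smult) auto
  then show ?case
    using keys_scl[of c "\<kappa> q x"] smult by auto
qed (simp add: \<kappa>_basis)

lemma keys_emb: "x \<in> Bq q \<Longrightarrow> w \<in> keys (emb q x) \<Longrightarrow> \<exists>y\<in>\<B> q. w = [Some y]"
  unfolding emb_def using keys_\<kappa> by (fastforce dest!: keys_lext)

lemma keys_emb_A: "x \<in> A \<inter> grade L q \<Longrightarrow> w \<in> keys (emb q x) \<Longrightarrow> \<exists>y\<in>\<B> q \<inter> A. w = [Some y]"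
  unfolding emb_def using keys_\<kappa>_A by (fastforce dest!: keys_lext)

lemma D_sym: "D l m \<Longrightarrow> D m l"
  by (auto simp: D_def)

lemma D_cases:
  assumes "D l m"
  obtains x y q q' where "l = Some x" "m = Some y" "x \<in> \<B> q" "y \<in> \<B> q'"
  | x q where "l = None" "m = Some x" "x \<in> \<B> q" "x \<in> A"
  | x q where "l = Some x" "m = None" "x \<in> \<B> q" "x \<in> A"
  using assms unfolding D_def by blast

lemma DI: "x \<in> \<B> q \<Longrightarrow> y \<in> \<B> q' \<Longrightarrow> D (Some x) (Some y)"
  "x \<in> \<B> q \<Longrightarrow> x \<in> A \<Longrightarrow> D None (Some x)" "x \<in> \<B> q \<Longrightarrow> x \<in> A \<Longrightarrow> D (Some x) None"
  by (cases q; cases q'; auto simp: D_def) (cases q; auto simp: D_def)+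

lemma val_grade: "D l m \<Longrightarrow> val l \<in> grade L (par l)"
  using basis_subset t by (elim D_cases) (auto simp: val_def par_Some par_None)

lemma skew: 
  assumes "x \<in> grade L q" "y \<in> grade L q'"
  shows "x \<otimes> y = (- super_sign q q') \<odot> (y \<otimes> x)"
  using super_skew[OF assms] assms by (simp add: minus_smult)

lemma mult_t_A: "a \<in> A \<Longrightarrow> a \<in> grade L q \<Longrightarrow> a \<otimes> t \<in> B"
  using skew[of a q t p] t tA[of a] subspaceD(5)[OF B_sub] by simp

lemma D_mult:
  assumes "D l m"
  shows "val l \<otimes> val m \<in> Bq (par l + par m)"
proof -
  have "val l \<otimes> val m \<in> grade L (par l + par m)"
    using assms D_sym val_grade by (intro grade_mult) blast+
  moreover have "val l \<otimes> val m \<in> B"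
    using assms
  proof (cases rule: D_cases)
    case (1 x y q q')
    then show ?thesis
      using basis_subset[of q] basis_subset[of q'] subsuperalgebraD(2)[OF B, of x y] by (auto simp: val_def)
  next
    case (2 x q)
    then show ?thesis
      using tA by (simp add: val_def)
  next
    case (3 x q)
    then show ?thesis
      using mult_t_A[of x q] basis_subset[of q] by (auto simp: val_def)
  qed
  ultimately show ?thesis
    by simp
qed

lemma D_mult_A:
  assumes "D None l" "D None m" "D l m"
  shows "val l \<otimes> val m \<in> A \<inter> grade L (par l + par m)"
proof -
  obtain x y where "l = Some x" "m = Some y" "x \<in> A" "y \<in> A"
    using assms by (auto elim!: D_cases)
  then show ?thesis
    using D_mult[OF assms(3)] subsuperalgebraD(2)[OF A, of x y] by (auto simp: val_def)
qed

lemma f_basis: "x \<in> \<B> q \<Longrightarrow> f l (Some x) = emb (par l + q) (val l \<otimes> x)"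
  by (simp add: f_def par_Some val_def)

lemma act_emb_B:
  assumes l: "l = Some y" "y \<in> \<B> q'" and z: "z \<in> Bq q"
  shows "lext (\<lambda>w. f l (hd w)) (emb q z) = emb (par l + q) (val l \<otimes> z)"
proof -
  have y: "y \<in> Bq q'" "val l = y" "par l = q'"
    using l basis_subset[of q'] by (auto simp: val_def par_Some)
  have m: "y \<otimes> x \<in> Bq (q' + q)" if "x \<in> Bq q" for x
    using that y subsuperalgebraD(2)[OF B, of y x] grade_mult[of y q' x q] by auto
  show ?thesis
    using z unfolding y(2,3)
  proof (induction rule: basis_induct)
    case (basis x)
    then show ?case
      using y by (simp add: emb_basis lext_single f_basis)
  next
    case zero
    have "y \<in> carrier L"
      using y by auto
    then show ?case
      by (simp add: emb_zero)
  next
    case (add x x')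
    then have "y \<otimes> (x \<oplus> x') = y \<otimes> x \<oplus> y \<otimes> x'"
      using y by (intro mult_add) auto
    then show ?case
      using add m by (simp only: emb_add lext_add)
  next
    case (smult c x)
    then have "y \<otimes> (c \<odot> x) = c \<odot> (y \<otimes> x)"
      using y by (intro mult_smult) auto
    then show ?case
      using smult m by (simp only: emb_smult lext_scl)
  qed
qed

lemma act_emb_None:
  assumes z: "z \<in> A \<inter> grade L q"
  shows "lext (\<lambda>w. f None (hd w)) (emb q z) = emb (p + q) (t \<otimes> z)"
proof -
  have m: "t \<otimes> x \<in> Bq (p + q)" if "x \<in> A \<inter> grade L q" for x
    using that tA[of x] grade_mult[OF t, of x q] by auto
  have AB': "x \<in> Bq q" if "x \<in> A \<inter> grade L q" for x
    using that AB by auto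
  show ?thesis
    using z
  proof (induction rule: basis_A_induct)
    case (basis x)
    then show ?case
      by (simp add: emb_basis lext_single f_basis par_None) (simp add: val_def)
  next
    case zero
    then show ?case
      using t by (simp add: emb_zero)
  next
    case (add x x')
    then have "t \<otimes> (x \<oplus> x') = t \<otimes> x \<oplus> t \<otimes> x'"
      using t by (intro mult_add) auto
    then show ?case
      using add m AB' by (simp only: emb_add lext_add)
  next
    case (smult c x)
    then have "t \<otimes> (c \<odot> x) = c \<odot> (t \<otimes> x)"
      using t by (intro mult_smult) auto
    then show ?case
      using smult m AB' by (simp only: emb_smult lext_scl)
  qed
qed

text \<open>Double brackets computed with letters agree with those of \<open>L\<close> and stay in
  \<open>B\<close>. For \<open>l = None\<close> this works because the letters related to
  \<open>None\<close> lie in the subalgebra \<open>A\<close>, so their bracket is again in the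
  domain of the derivation.\<close>

lemma act_emb:
  assumes "D l m" "D l n" "D m n"
  shows "lext (\<lambda>w. f l (hd w)) (f m n) = emb (par l + (par m + par n)) (val l \<otimes> (val m \<otimes> val n))"
    "val l \<otimes> (val m \<otimes> val n) \<in> Bq (par l + (par m + par n))"
proof -
  have mn: "val m \<otimes> val n \<in> Bq (par m + par n)"
    using assms by (intro D_mult)
  have *: "lext (\<lambda>w. f l (hd w)) (f m n) = emb (par l + (par m + par n)) (val l \<otimes> (val m \<otimes> val n))
      \<and> val l \<otimes> (val m \<otimes> val n) \<in> B"
  proof (cases l)
    case None
    then have "val m \<otimes> val n \<in> A \<inter> grade L (par m + par n)"
      using assms D_mult_A by blast
    then show ?thesis
      using None act_emb_None tA by (simp add: f_def par_None val_def)
  next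
    case (Some y)
    then obtain q where q: "y \<in> \<B> q"
      using assms(1) by (auto elim: D_cases)
    then have "y \<in> B"
      using basis_subset by blast
    then show ?thesis
      using Some act_emb_B[OF Some q mn] mn subsuperalgebraD(2)[OF B, of y] by (simp add: f_def val_def)
  qed
  then show "lext (\<lambda>w. f l (hd w)) (f m n) = emb (par l + (par m + par n)) (val l \<otimes> (val m \<otimes> val n))"
    by blast
  show "val l \<otimes> (val m \<otimes> val n) \<in> Bq (par l + (par m + par n))"
    using * grade_mult[OF val_grade[OF assms(1)], of "val m \<otimes> val n" "par m + par n"] mn by blast
qed

text \<open>The hypotheses of the diamond lemma are, through the coordinate map \<open>emb\<close>,
  the sign and Jacobi laws of \<open>L\<close> together with the position of \<open>A\<close> in the
  order of letters.\<close>

sublocale quadratic_linear r par D f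
proof
  fix l m n w
  show "D l m \<Longrightarrow> D m l"
    by (rule D_sym)
  show "length w = 1" if "D l m" "w \<in> keys (f l m)"
    using keys_emb[OF D_mult[OF that(1)], of w] that(2) by (auto simp: f_def)
  show "f l m = - scl (super_sign (par l) (par m)) (f m l)" if "D l m"
  proof -
    have "val l \<otimes> val m = (- super_sign (par l) (par m)) \<odot> (val m \<otimes> val l)"
      using that D_sym val_grade by (intro skew) blast+
    then have "f l m = emb (par m + par l) ((- super_sign (par l) (par m)) \<odot> (val m \<otimes> val l))"
      by (simp add: f_def add.commute)
    also have "\<dots> = scl (- super_sign (par l) (par m)) (f m l)"
      unfolding f_def by (rule emb_smult[OF D_mult[OF D_sym[OF that]]])
    finally show ?thesis
      by simp
  qed
  \<comment> \<open>If \<open>None\<close> comes first, the next letter is in \<open>A\<close>; a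
    letter not above it is again in \<open>A\<close>, as \<open>A\<close> is an initial segment.
    \<open>None\<close> cannot come later, being maximal.\<close>
  show "D l n" if h: "D l m" "D m n" "(m, l) \<in> r\<^sup>=" "(n, m) \<in> r\<^sup>="
    using h(1)
  proof (cases rule: D_cases)
    case (1 x y q q')
    then obtain z q'' where "n = Some z" "z \<in> \<B> q''"
      using h(2,4) r_None by (auto elim!: D_cases)
    then show ?thesis
      using 1 DI(1) by blast
  next
    case (2 x q)
    then obtain z q'' where z: "n = Some z" "z \<in> \<B> q''"
      using h(2,4) r_None by (auto elim!: D_cases)
    then have "z \<in> A"
      using h(4) 2 r_A[of n x] by auto
    then show ?thesis
      using 2 z DI(2) by blast
  next
    case (3 x q)
    then show ?thesis
      using h(3) r_None by auto
  qed
  show "\<exists>l'. w = [l'] \<and> D l l' \<and> par l' = par m + par n"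
    if D: "D l m" "D m n" "D l n" and w: "w \<in> keys (f m n)"
  proof (cases l)
    case None
    then have "val m \<otimes> val n \<in> A \<inter> grade L (par m + par n)"
      using D D_mult_A by blast
    then obtain y where "y \<in> \<B> (par m + par n)" "y \<in> A" "w = [Some y]"
      using keys_emb_A w unfolding f_def by blast
    then show ?thesis
      using None DI(2) par_Some by blast
  next
    case (Some x)
    then obtain q where "x \<in> \<B> q"
      using D(1) by (auto elim: D_cases)
    moreover obtain y where "y \<in> \<B> (par m + par n)" "w = [Some y]"
      using keys_emb[OF D_mult[OF D(2)]] w unfolding f_def by blast
    ultimately show ?thesis
      using Some DI(1) par_Some by blast
  qed
  show "lext (\<lambda>w. f l (hd w)) (f m n) =
      scl (super_sign (par l) (par m)) (lext (\<lambda>w. f m (hd w)) (f l n))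
      - scl (super_sign (par l + par m) (par n)) (lext (\<lambda>w. f n (hd w)) (f l m))"
    if D: "D l m" "D m n" "D l n"
  proof -
    let ?x = "val l" and ?y = "val m" and ?z = "val n"
    note g = val_grade[OF D(1)] val_grade[OF D(2)] val_grade[OF D_sym[OF D(2)]]
    note D' = D_sym[OF D(1)] D_sym[OF D(2)] D_sym[OF D(3)]
    have par: "par m + (par l + par n) = par l + (par m + par n)" "par n + (par l + par m) = par l + (par m + par n)"
      by (simp_all add: add_ac)
    have B: "?x \<otimes> (?y \<otimes> ?z) \<in> Bq (par l + (par m + par n))" "?y \<otimes> (?x \<otimes> ?z) \<in> Bq (par l + (par m + par n))"
      "?z \<otimes> (?x \<otimes> ?y) \<in> Bq (par l + (par m + par n))"
      using act_emb(2)[OF D(1,3,2)] act_emb(2)[OF D'(1) D(2,3)] act_emb(2)[OF D'(3) D'(2) D(1)] unfolding par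
      by blast+
    have "(?x \<otimes> ?y) \<otimes> ?z = (- super_sign (par l + par m) (par n)) \<odot> (?z \<otimes> (?x \<otimes> ?y))"
      by (rule skew[OF grade_mult[OF g(1,2)] g(3)])
    then have "?x \<otimes> (?y \<otimes> ?z) = (- super_sign (par l + par m) (par n)) \<odot> (?z \<otimes> (?x \<otimes> ?y)) \<oplus>
        super_sign (par l) (par m) \<odot> (?y \<otimes> (?x \<otimes> ?z))"
      using super_jacobi[OF g] by simp
    then have "emb (par l + (par m + par n)) (?x \<otimes> (?y \<otimes> ?z)) =
      scl (- super_sign (par l + par m) (par n)) (emb (par l + (par m + par n)) (?z \<otimes> (?x \<otimes> ?y))) +
      scl (super_sign (par l) (par m)) (emb (par l + (par m + par n)) (?y \<otimes> (?x \<otimes> ?z)))"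
      using emb_add[OF BqD(5)[OF B(3)] BqD(5)[OF B(2)]] emb_smult[OF B(3)] emb_smult[OF B(2)] by simp
    then show ?thesis
      unfolding act_emb(1)[OF D(1,3,2)] act_emb(1)[OF D'(1) D(2,3)] act_emb(1)[OF D'(3) D'(2) D(1)] par
      by simp
  qed
qed (rule two three wf_r trans_r total_r)+

lemma supercomm_emb_None:
  assumes z: "z \<in> A \<inter> grade L q"
  shows "supercomm p q (word [None]) (emb q z) - emb (p + q) (t \<otimes> z) \<in> J"
proof -
  have m: "t \<otimes> x \<in> Bq (p + q)" if "x \<in> A \<inter> grade L q" for x
    using that tA[of x] grade_mult[OF t, of x q] by auto
  have AB': "x \<in> Bq q" if "x \<in> A \<inter> grade L q" for x
    using that AB by auto
  note J = two_sided_idealD[OF J_ideal] two_sided_ideal_scl[OF J_ideal]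
  show ?thesis
    using z
  proof (induction rule: basis_A_induct)
    case (basis x)
    have "relator None (Some x) = supercomm p q (word [None]) (emb q x) - emb (p + q) (t \<otimes> x)"
      using basis by (simp add: relator_def supercomm_def emb_basis word_mult par_None par_Some f_basis)
        (simp add: val_def)
    then show ?case
      using relator_in_J[OF DI(2)[OF basis]] by simp
  next
    case zero
    then show ?case
      using t J(1) by (simp add: emb_zero)
  next
    case (add x x')
    then have "t \<otimes> (x \<oplus> x') = t \<otimes> x \<oplus> t \<otimes> x'"
      using t by (intro mult_add) auto
    then have "supercomm p q (word [None]) (emb q (x \<oplus> x')) - emb (p + q) (t \<otimes> (x \<oplus> x')) =
      (supercomm p q (word [None]) (emb q x) - emb (p + q) (t \<otimes> x)) +
      (supercomm p q (word [None]) (emb q x') - emb (p + q) (t \<otimes> x'))"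
      using add m AB' by (simp add: emb_add supercomm_add_right)
    then show ?case
      using J(2) add by simp
  next
    case (smult c x)
    then have "t \<otimes> (c \<odot> x) = c \<odot> (t \<otimes> x)"
      using t by (intro mult_smult) auto
    then have "supercomm p q (word [None]) (emb q (c \<odot> x)) - emb (p + q) (t \<otimes> (c \<odot> x)) =
      scl c (supercomm p q (word [None]) (emb q x) - emb (p + q) (t \<otimes> x))"
      using smult m AB' by (simp add: emb_smult supercomm_scl_right pm.scale_right_diff_distrib)
    then show ?case
      using J(7) smult by simp
  qed
qed

lemma supercomm_emb:
  assumes z: "z \<in> Bq q" and z': "z' \<in> Bq q'"
  shows "supercomm q q' (emb q z) (emb q' z') - emb (q + q') (z \<otimes> z') \<in> J"
proof -
  note J = two_sided_idealD[OF J_ideal] two_sided_ideal_scl[OF J_ideal]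
  have m: "x \<otimes> y \<in> Bq (q + q')" if "x \<in> Bq q" "y \<in> Bq q'" for x y
    using that subsuperalgebraD(2)[OF B, of x y] grade_mult[of x q y q'] by auto
  have "supercomm q q' (emb q x) (emb q' z') - emb (q + q') (x \<otimes> z') \<in> J" if x: "x \<in> \<B> q" for x
    using z'
  proof (induction rule: basis_induct)
    case (basis y)
    have "relator (Some x) (Some y) = supercomm q q' (emb q x) (emb q' y) - emb (q + q') (x \<otimes> y)"
      using basis x by (simp add: relator_def supercomm_def emb_basis word_mult par_Some f_basis)
        (simp add: val_def)
    then show ?case
      using relator_in_J[OF DI(1)[OF x basis]] by simp
  next
    case zero
    have "x \<in> carrier L"
      using x basis_subset[of q] by auto
    then show ?case
      using J(1) by (simp add: emb_zero)
  next
    case (add y y')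
    have xB: "x \<in> Bq q"
      using x basis_subset by blast
    then have "x \<otimes> (y \<oplus> y') = x \<otimes> y \<oplus> x \<otimes> y'"
      using add by (intro mult_add) auto
    then have "supercomm q q' (emb q x) (emb q' (y \<oplus> y')) - emb (q + q') (x \<otimes> (y \<oplus> y')) =
      (supercomm q q' (emb q x) (emb q' y) - emb (q + q') (x \<otimes> y)) +
      (supercomm q q' (emb q x) (emb q' y') - emb (q + q') (x \<otimes> y'))"
      using add m[OF xB] by (simp add: emb_add supercomm_add_right)
    then show ?case
      using J(2) add by simp
  next
    case (smult c y)
    have xB: "x \<in> Bq q"
      using x basis_subset by blast
    then have "x \<otimes> (c \<odot> y) = c \<odot> (x \<otimes> y)"
      using smult by (intro mult_smult) auto
    then have "supercomm q q' (emb q x) (emb q' (c \<odot> y)) - emb (q + q') (x \<otimes> (c \<odot> y)) =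
      scl c (supercomm q q' (emb q x) (emb q' y) - emb (q + q') (x \<otimes> y))"
      using smult m[OF xB] by (simp add: emb_smult supercomm_scl_right pm.scale_right_diff_distrib)
    then show ?case
      using J(7) smult by simp
  qed
  note basis_case = this
  show ?thesis
    using z
  proof (induction rule: basis_induct)
    case (basis y)
    then show ?case
      by (rule basis_case)
  next
    case zero
    have "z' \<in> carrier L"
      using z' by auto
    then show ?case
      using J(1) by (simp add: emb_zero)
  next
    case (add y y')
    then have "(y \<oplus> y') \<otimes> z' = y \<otimes> z' \<oplus> y' \<otimes> z'"
      using z' by (intro add_mult) auto
    then have "supercomm q q' (emb q (y \<oplus> y')) (emb q' z') - emb (q + q') ((y \<oplus> y') \<otimes> z') =
      (supercomm q q' (emb q y) (emb q' z') - emb (q + q') (y \<otimes> z')) +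
      (supercomm q q' (emb q y') (emb q' z') - emb (q + q') (y' \<otimes> z'))"
      using add m[OF _ z'] by (simp add: emb_add supercomm_add_left)
    then show ?case
      using J(2) add by simp
  next
    case (smult c y)
    then have "(c \<odot> y) \<otimes> z' = c \<odot> (y \<otimes> z')"
      using z' by (intro smult_mult) auto
    then have "supercomm q q' (emb q (c \<odot> y)) (emb q' z') - emb (q + q') ((c \<odot> y) \<otimes> z') =
      scl c (supercomm q q' (emb q y) (emb q' z') - emb (q + q') (y \<otimes> z'))"
      using smult m[OF _ z'] by (simp add: emb_smult supercomm_scl_left pm.scale_right_diff_distrib)
    then show ?case
      using J(7) smult by simp
  qed
qed

lemma redexes_letter: "redexes [l] = {}"
  by (auto simp: redexes_def)

text \<open>Single letters are normal words, so \<open>NF\<close> fixes the coordinate vector of an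
  element of \<open>B\<close>. Hence \<open>B\<close> embeds in the envelope.\<close>

lemma emb_J:
  assumes "x \<in> Bq q" "emb q x \<in> J"
  shows "x = \<zero>"
proof -
  have "NF (emb q x) = lext (\<lambda>i. single i 1) (emb q x)"
    by (intro lext_cong nf_normal) (use keys_emb[OF assms(1)] redexes_letter in blast)
  then have "emb q x = 0"
    using NF_J[OF assms(2)] by (simp add: lext_single_id)
  then show ?thesis
    using emb_inj assms(1) by blast
qed

lemma super_rep_B: "super_rep L J (\<lambda>q x a. x \<in> Bq q \<and> a - emb q x \<in> J)"
proof
  note J = two_sided_idealD[OF J_ideal] two_sided_ideal_scl[OF J_ideal]
  show "two_sided_ideal J"
    by (rule J_ideal)
  fix q q' x y a b
  show "\<zero> \<in> Bq q \<and> 0 - emb q \<zero> \<in> J"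
    using J(1) BqD(3)[of q] by (simp add: emb_zero)
  show "x \<in> grade L q" if "x \<in> Bq q \<and> a - emb q x \<in> J"
    using that by simp
  show "x \<oplus> y \<in> Bq q \<and> a + b - emb q (x \<oplus> y) \<in> J"
    if "x \<in> Bq q \<and> a - emb q x \<in> J" "y \<in> Bq q \<and> b - emb q y \<in> J"
  proof -
    have "a + b - emb q (x \<oplus> y) = (a - emb q x) + (b - emb q y)"
      using that by (simp add: emb_add)
    also have "\<dots> \<in> J"
      using that by (intro J(2)) simp_all
    finally show ?thesis
      using that BqD(4)[of x q y] by simp
  qed
  show "c \<odot> x \<in> Bq q \<and> scl c a - emb q (c \<odot> x) \<in> J" if "x \<in> Bq q \<and> a - emb q x \<in> J" for c
  proof -
    have "scl c a - emb q (c \<odot> x) = scl c (a - emb q x)"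
      using that by (simp add: emb_smult pm.scale_right_diff_distrib)
    then show ?thesis
      using that J(7) BqD(5)[of x q c] by simp
  qed
  show "x \<otimes> y \<in> Bq (q + q') \<and> supercomm q q' a b - emb (q + q') (x \<otimes> y) \<in> J"
    if xy: "x \<in> Bq q \<and> a - emb q x \<in> J" "y \<in> Bq q' \<and> b - emb q' y \<in> J"
  proof -
    have "supercomm q q' a b - emb (q + q') (x \<otimes> y) = supercomm q q' (a - emb q x) b +
      (supercomm q q' (emb q x) (b - emb q' y) + (supercomm q q' (emb q x) (emb q' y) - emb (q + q') (x \<otimes> y)))"
      by (simp add: supercomm_diff_left supercomm_diff_right)
    also have "\<dots> \<in> J"
      using xy by (intro J(2) two_sided_ideal_supercomm[OF J_ideal] supercomm_emb) auto
    finally show ?thesis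
      using xy subsuperalgebraD(2)[OF B, of x y] grade_mult[of x q y q'] by simp
  qed
  show "a \<in> J" if "\<zero> \<in> Bq q \<and> a - emb q \<zero> \<in> J"
    using that by (simp add: emb_zero)
qed

end

lemma well_order_refining_rank:
  fixes rank :: "'b \<Rightarrow> nat"
  obtains r :: "('b \<times> 'b) set" where "wf r" "trans r" "total r"
    "\<And>l m. (l, m) \<in> r \<Longrightarrow> rank l \<le> rank m" "\<And>l. (l, l) \<notin> r"
proof -
  have "\<exists>w :: ('b \<times> 'b) set. Well_order w \<and> Field w = UNIV"
    by (rule well_ordering)
  then obtain w :: "('b \<times> 'b) set" where w: "well_order_on UNIV w"
    by auto
  define r0 where "r0 = w - Id"
  have "wf r0"
    using w by (simp add: r0_def well_order_on_def)
  moreover have "trans r0"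
    unfolding r0_def using w
    by (intro trans_diff_Id) (simp_all add: well_order_on_def linear_order_on_def partial_order_on_def preorder_on_def)
  moreover have "total r0"
    using w by (auto simp: r0_def well_order_on_def linear_order_on_def total_on_def)
  ultimately have r0: "wf r0" "trans r0" "total r0"
    by blast+
  define r where "r = inv_image (less_than <*lex*> r0) (\<lambda>l. (rank l, l))"
  have mem: "(l, m) \<in> r \<longleftrightarrow> rank l < rank m \<or> rank l = rank m \<and> (l, m) \<in> r0" for l m
    by (simp add: r_def)
  show thesis
  proof (rule that[of r])
    show "wf r"
      unfolding r_def using r0(1) by (intro wf_inv_image wf_lex_prod wf_less_than)
    show "trans r"
    proof (rule transI)
      fix x y z assume "(x, y) \<in> r" "(y, z) \<in> r"
      then show "(x, z) \<in> r"
        using transD[OF r0(2), of x y z] by (auto simp: mem)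
    qed
    show "total r"
      using r0(3) by (auto simp: total_on_def mem)
  qed (auto simp: mem r0_def)
qed

text \<open>Adapted bases are chosen separately in each parity. The set \<open>E\<close> allows one
  homogeneous element outside \<open>A\<close> to be prescribed as a basis letter; it will be the
  element \<open>b\<close> of the free generators.\<close>

lemma hnn_basis_exists:
  fixes L :: "('k::field, 'a) superalgebra" (structure)
  assumes L: "lie_superalgebra L" and char: "(2::'k) \<noteq> 0" "(3::'k) \<noteq> 0"
    and t: "t \<in> grade L p" and A: "subsuperalgebra A L" and B: "subsuperalgebra B L" and AB: "A \<subseteq> B"
    and tA: "\<And>a. a \<in> A \<Longrightarrow> t \<otimes> a \<in> B"
    and E: "E = {} \<or> (\<exists>b. E = {b})" "E \<subseteq> B - A" "E \<subseteq> homogeneous L"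
  obtains \<B> \<kappa> r where "hnn_basis L p t A B \<B> \<kappa> r" "E \<subseteq> \<B> 0 \<union> \<B> 1"
proof -
  interpret lie_superalgebra L
    by (rule L)
  have "\<exists>S \<iota>. S \<subseteq> B \<inter> grade L q \<and> E \<inter> grade L q \<subseteq> S \<and>
    (\<forall>U. subspace_of U L \<longrightarrow> S \<subseteq> U \<longrightarrow> B \<inter> grade L q \<subseteq> U) \<and>
    (\<forall>U. subspace_of U L \<longrightarrow> S \<inter> A \<subseteq> U \<longrightarrow> A \<inter> grade L q \<subseteq> U) \<and>
    (\<forall>x y. x \<in> B \<inter> grade L q \<longrightarrow> y \<in> B \<inter> grade L q \<longrightarrow> \<iota> (x \<oplus> y) = \<iota> x + \<iota> y) \<and>
    (\<forall>c x. x \<in> B \<inter> grade L q \<longrightarrow> \<iota> (c \<odot> x) = scl c (\<iota> x)) \<and>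
    (\<forall>x. x \<in> S \<longrightarrow> \<iota> x = single x 1) \<and>
    (\<forall>x. x \<in> B \<inter> grade L q \<longrightarrow> \<iota> x = 0 \<longrightarrow> x = \<zero>)" (is "\<exists>S \<iota>. ?P q S \<iota>") for q
  proof -
    have sub: "subspace_of (A \<inter> grade L q) L" "subspace_of (B \<inter> grade L q) L"
      using subsuperalgebraD(1)[OF A] subsuperalgebraD(1)[OF B] grade_subspace[of q]
      by (auto simp: subspace_iff)
    have Eq: "E \<inter> grade L q = {} \<or> (\<exists>b. E \<inter> grade L q = {b})" "E \<inter> grade L q \<subseteq> B \<inter> grade L q - A \<inter> grade L q"
      using E by auto
    have ABq: "A \<inter> grade L q \<subseteq> B \<inter> grade L q"
      using AB by auto
    show ?thesis
    proof (rule adapted_basis[OF sub ABq Eq], goal_cases)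
      case S: (1 S \<iota>)
      have eq: "S \<inter> (A \<inter> grade L q) = S \<inter> A"
        using S(1) by auto
      have "?P q S \<iota>"
      proof (intro conjI allI impI)
        show "A \<inter> grade L q \<subseteq> U" if "subspace_of U L" "S \<inter> A \<subseteq> U" for U
          using S(4)[OF that(1)] that(2) unfolding eq by blast
      qed (fact S(1-3) S(5-8) | erule S(3,5-8); assumption)+
      then show ?case
        by (intro exI)
    qed
  qed
  note ex = this
  have "\<forall>q. \<exists>s. ?P q (fst s) (snd s)"
  proof
    fix q
    obtain S \<iota> where S: "?P q S \<iota>"
      using ex[of q] by (elim exE)
    have "?P q (fst (S, \<iota>)) (snd (S, \<iota>))"
      unfolding fst_conv snd_conv by (rule S)
    then show "\<exists>s. ?P q (fst s) (snd s)"
      by (rule exI[where x = "(S, \<iota>)"])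
  qed
  from choice[OF this] obtain s where s: "\<forall>q. ?P q (fst (s q)) (snd (s q))"
    by (elim exE)
  define \<B> where "\<B> q = fst (s q)" for q
  define \<kappa> where "\<kappa> q = snd (s q)" for q
  have P: "?P q (\<B> q) (\<kappa> q)" for q
    unfolding \<B>_def \<kappa>_def by (rule spec[OF s])
  note P1 = P[THEN conjunct1] and Qa = P[THEN conjunct2]
  note P2 = Qa[THEN conjunct1] and Qb = Qa[THEN conjunct2]
  note P3 = Qb[THEN conjunct1, rule_format] and Qc = Qb[THEN conjunct2]
  note P4 = Qc[THEN conjunct1, rule_format] and Qd = Qc[THEN conjunct2]
  note P5 = Qd[THEN conjunct1, rule_format] and Qe = Qd[THEN conjunct2]
  note P6 = Qe[THEN conjunct1, rule_format] and Qf = Qe[THEN conjunct2]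
  note P7 = Qf[THEN conjunct1, rule_format] and P8 = Qf[THEN conjunct2, rule_format]
  \<comment> \<open>Letters of \<open>A\<close> at the bottom, \<open>None\<close> on top: this is
    what makes the relations closed under overlaps.\<close>
  define rank where "rank l = (case l of None \<Rightarrow> 2 | Some x \<Rightarrow> if x \<in> A then 0 else (1::nat))" for l :: "'a option"
  obtain r :: "('a option \<times> 'a option) set" where r: "wf r" "trans r" "total r"
    "\<And>l m. (l, m) \<in> r \<Longrightarrow> rank l \<le> rank m" "\<And>l. (l, l) \<notin> r"
    using well_order_refining_rank[of rank] by blast
  have r_None: "(None, l) \<notin> r" for l
    using r(4)[of None l] r(5) by (cases l) (auto simp: rank_def split: if_splits)
  have r_A: "l \<in> Some ` A" if "(l, Some a) \<in> r" "a \<in> A" for l a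
    using r(4)[OF that(1)] that(2) by (cases l) (auto simp: rank_def split: if_splits)
  have "hnn_basis L p t A B \<B> \<kappa> r"
    by (intro hnn_basis.intro hnn_basis_axioms.intro)
      (fact lie_superalgebra_axioms char t A B AB r(1-3) r_None P1 | erule tA P3 P4 P5 P6 P7 P8 r_A; assumption)+
  moreover have "E \<subseteq> \<B> 0 \<union> \<B> 1"
    using P2[of 0] P2[of 1] E(3) unfolding homogeneous_def by blast
  ultimately show thesis
    by (rule that)
qed

section \<open>Leading words\<close>

context quadratic_linear
begin

definition lower :: "'x list \<Rightarrow> ('x list \<Rightarrow>\<^sub>0 'k) \<Rightarrow> bool"
  where "lower w a \<longleftrightarrow> (\<forall>w'\<in>keys a. (w', w) \<in> lenlex r)"

text \<open>A monic leading term in the length-lexicographic order. The other words of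
  \<open>a\<close> need not be normal, which makes leading words multiplicative before any
  reduction.\<close>

definition leads :: "('x list \<Rightarrow>\<^sub>0 'k) \<Rightarrow> 'x list \<Rightarrow> bool"
  where "leads a w \<longleftrightarrow> lower w (a - word w)"

lemma lower_add: "lower w a \<Longrightarrow> lower w b \<Longrightarrow> lower w (a + b)"
  using keys_add[of a b] by (auto simp: lower_def)

lemma lower_scl: "lower w a \<Longrightarrow> lower w (scl c a)"
  using keys_scl[of c a] by (auto simp: lower_def)

lemma lower_NF:
  assumes "lower w a"
  shows "lower w (NF a)"
  unfolding lower_def
proof
  fix w' assume "w' \<in> keys (NF a)"
  from keys_lext[OF this] obtain i where i: "i \<in> keys a" "w' \<in> keys (nf i)"
    by auto
  then have iw: "(i, w) \<in> lenlex r"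
    using assms by (simp add: lower_def)
  from keys_nf[OF i(2)] show "(w', w) \<in> lenlex r"
  proof
    assume "(w', i) \<in> lenlex r"
    from lenlex_trans[OF this iw trans_r] show ?thesis .
  qed (simp add: iw)
qed

lemma lower_lookup: "lower w a \<Longrightarrow> lookup a w = 0"
  using lenlex_irreflexive[of r w] irrefl_r by (auto simp: lower_def in_keys_iff)

lemma keys_leads: "leads a w \<Longrightarrow> w' \<in> keys a \<Longrightarrow> w' = w \<or> (w', w) \<in> lenlex r"
  using keys_add[of "a - word w" "word w"] by (auto simp: leads_def lower_def)

lemma leads_lower:
  assumes "leads a w" "(w, v) \<in> lenlex r"
  shows "lower v a"
  unfolding lower_def
proof
  fix w' assume "w' \<in> keys a"
  from keys_leads[OF assms(1) this] show "(w', v) \<in> lenlex r"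
  proof
    assume "(w', w) \<in> lenlex r"
    from lenlex_trans[OF this assms(2) trans_r] show ?thesis .
  qed (simp add: assms(2))
qed

lemma leads_word: "leads (word w) w"
  by (simp add: leads_def lower_def)

lemma lower_mult_left:
  assumes "lower u a" "\<And>w. w \<in> keys b \<Longrightarrow> length w \<le> length v"
  shows "lower (u @ v) (a * b)"
  unfolding lower_def
proof
  fix w assume "w \<in> keys (a * b)"
  then obtain x y where "w = x @ y" "x \<in> keys a" "y \<in> keys b"
    using keys_mult[of a b] by (auto simp: plus_list_def)
  then show "(w, u @ v) \<in> lenlex r"
    using assms by (auto simp: lower_def intro: lenlex_append_mono)
qed

lemma leads_mult:
  assumes "leads a u" "leads b v"
  shows "leads (a * b) (u @ v)"
proof -
  have "lower (u @ v) ((a - word u) * b)"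
    using assms(1) keys_leads[OF assms(2)] lenlex_length
    by (intro lower_mult_left) (auto simp: leads_def)
  moreover have "lower (u @ v) (word u * (b - word v))"
    unfolding lower_def
  proof
    fix w assume "w \<in> keys (word u * (b - word v))"
    then obtain y where "w = u @ y" "y \<in> keys (b - word v)"
      using keys_mult[of "word u" "b - word v"] by (auto simp: plus_list_def)
    then show "(w, u @ v) \<in> lenlex r"
      using assms(2) by (auto simp: leads_def lower_def intro: lenlex_prefix)
  qed
  moreover have "a * b - word (u @ v) = (a - word u) * b + word u * (b - word v)"
    by (simp add: algebra_simps word_mult)
  ultimately show ?thesis
    unfolding leads_def using lower_add by simp
qed

lemma leads_add_lower: "leads a w \<Longrightarrow> lower w b \<Longrightarrow> leads (a + b) w"
  using lower_add[of w "a - word w" b] by (simp add: leads_def algebra_simps)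

lemma leads_supercomm:
  assumes "leads a u" "leads b v" "(v @ u, u @ v) \<in> lenlex r"
  shows "leads (supercomm q q' a b) (u @ v)"
proof -
  have "lower (u @ v) (b * a)"
    by (rule leads_lower[OF leads_mult[OF assms(2,1)] assms(3)])
  then have "lower (u @ v) (scl (- super_sign q q') (b * a))"
    by (rule lower_scl)
  from leads_add_lower[OF leads_mult[OF assms(1,2)] this] show ?thesis
    by (simp add: supercomm_def)
qed

text \<open>Reduction only produces smaller words, so a normal leading word keeps its
  coefficient.\<close>

lemma lookup_NF_leads:
  assumes "leads a w" "redexes w = {}"
  shows "lookup (NF a) w = 1"
proof -
  have "NF a = NF (a - word w) + nf w"
    by (simp add: lext_diff NF_word)
  then show ?thesis
    using lower_lookup[OF lower_NF[of w "a - word w"]] assms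
    by (simp add: leads_def lookup_add nf_normal)
qed

lemma leads_notin_J: 
  assumes "leads a w" "redexes w = {}"
  shows "a \<notin> J"
proof
  assume "a \<in> J"
  then show False
    using lookup_NF_leads[OF assms] NF_J[of a] by simp
qed

lemma leads_prod_list:
  assumes "\<And>g. g \<in> set w \<Longrightarrow> leads (h g) (\<phi> g)"
  shows "leads (prod_list (map h w)) (concat (map \<phi> w))"
  using assms
proof (induction w)
  case Nil
  then show ?case
    using leads_word[of "[]"] by (simp add: word_Nil)
qed (auto intro: leads_mult)

lemma ex_lenlex_maximum:
  assumes "finite S" "S \<noteq> {}"
  shows "\<exists>m\<in>S. \<forall>w\<in>S. w = m \<or> (w, m) \<in> lenlex r"
  using assms
proof (induction S rule: finite_ne_induct)
  case (insert x S)
  then obtain m where m: "m \<in> S" "\<forall>w\<in>S. w = m \<or> (w, m) \<in> lenlex r"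
    by blast
  have "x = m \<or> (x, m) \<in> lenlex r \<or> (m, x) \<in> lenlex r"
    using total_lenlex[OF total_r] by (auto simp: total_on_def)
  then show ?case
  proof (elim disjE)
    assume "(m, x) \<in> lenlex r"
    then have "w = x \<or> (w, x) \<in> lenlex r" if "w \<in> insert x S" for w
      using that m(2) lenlex_trans[OF _ _ trans_r, of w m x] by auto
    then show ?thesis
      by blast
  qed (use m in auto)
qed simp

text \<open>Normal words that form a code generate a free subalgebra modulo \<open>J\<close>.\<close>

lemma subst_hom_injective:
  assumes h: "\<And>g. g \<in> G \<Longrightarrow> leads (h g) (\<phi> g)"
    and inj: "inj_on (\<lambda>w. concat (map \<phi> w)) (lists G)"
    and normal: "\<And>w. w \<in> lists G \<Longrightarrow> redexes (concat (map \<phi> w)) = {}"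
    and P: "keys P \<subseteq> lists G" "subst_hom h P \<in> J"
  shows "P = 0"
proof (rule ccontr)
  let ?\<psi> = "\<lambda>w. concat (map \<phi> w)"
  assume "P \<noteq> 0"
  then have "keys P \<noteq> {}"
    by simp
  then obtain m where "m \<in> ?\<psi> ` keys P" "\<forall>w\<in>?\<psi> ` keys P. w = m \<or> (w, m) \<in> lenlex r"
    using ex_lenlex_maximum[of "?\<psi> ` keys P"] by auto
  \<comment> \<open>\<open>w0\<close> has the largest image among the words of \<open>P\<close>.
    Injectivity of the code makes all other images strictly smaller, so no other term can cancel
    this one.\<close>
  then obtain w0 where w0: "w0 \<in> keys P" "\<And>w. w \<in> keys P \<Longrightarrow> ?\<psi> w = ?\<psi> w0 \<or> (?\<psi> w, ?\<psi> w0) \<in> lenlex r"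
    by auto
  have lead: "leads (prod_list (map h w)) (?\<psi> w)" if "w \<in> keys P" for w
    using that P(1) h by (intro leads_prod_list) auto
  have lookup: "lookup (NF (prod_list (map h w))) (?\<psi> w0) = (if w = w0 then 1 else 0)" if w: "w \<in> keys P" for w
  proof (cases "w = w0")
    case True
    then show ?thesis
      using lookup_NF_leads[OF lead[OF w]] normal P(1) w by auto
  next
    case False
    then have "?\<psi> w \<noteq> ?\<psi> w0"
      using inj_onD[OF inj, of w w0] w w0(1) P(1) by auto
    then have "(?\<psi> w, ?\<psi> w0) \<in> lenlex r"
      using w0(2)[OF w] by blast
    then have "lower (?\<psi> w0) (prod_list (map h w))"
      by (rule leads_lower[OF lead[OF w]])
    then show ?thesis
      using False lower_lookup[OF lower_NF] by simp
  qed
  have "NF (subst_hom h P) = lext (\<lambda>w. NF (prod_list (map h w))) P"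
    by (simp add: subst_hom_def lext_lext)
  then have "lookup (NF (subst_hom h P)) (?\<psi> w0) = (\<Sum>w\<in>keys P. lookup P w * lookup (NF (prod_list (map h w))) (?\<psi> w0))"
    by (simp add: lext_def lookup_sum)
  also have "\<dots> = (\<Sum>w\<in>keys P. if w = w0 then lookup P w else 0)"
    by (rule sum.cong) (simp_all add: lookup)
  also have "\<dots> = lookup P w0"
    using w0(1) by simp
  also have "\<dots> \<noteq> 0"
    using w0(1) by (simp add: in_keys_iff)
  finally show False
    using NF_J[OF P(2)] by simp
qed

lemma successively_redexes: "successively (\<lambda>x y. \<not> inversion x y) w \<Longrightarrow> redexes w = {}"
  by (auto simp: redexes_def successively_append_iff)

end

section \<open>Free Lie superalgebras embed in free associative algebras\<close>

lemma keys_mult_lists: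
  assumes "keys a \<subseteq> lists S" "keys b \<subseteq> lists S"
  shows "keys (a * b) \<subseteq> lists S"
proof
  fix w assume "w \<in> keys (a * b)"
  then obtain u v where "w = u @ v" "u \<in> keys a" "v \<in> keys b"
    using keys_mult[of a b] by (auto simp: plus_list_def)
  then show "w \<in> lists S"
    using assms by auto
qed

lemma keys_assoc_monomial:
  "keys (assoc_monomial d (\<lambda>g. word [g] :: 'x list \<Rightarrow>\<^sub>0 'k::field) m) \<subseteq> lists (set_monomial m)"
proof (induction m)
  case (Prod s t)
  let ?a = "assoc_monomial d (\<lambda>g. word [g] :: 'x list \<Rightarrow>\<^sub>0 'k) s" and ?b = "assoc_monomial d (\<lambda>g. word [g] :: 'x list \<Rightarrow>\<^sub>0 'k) t"
  let ?c = "super_sign (parity d s) (parity d t)" and ?S = "set_monomial (Prod s t)"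
  have ab: "keys ?a \<subseteq> lists ?S" "keys ?b \<subseteq> lists ?S"
    by (rule order_trans[OF Prod(1) lists_mono], simp) (rule order_trans[OF Prod(2) lists_mono], simp)
  have "keys (?a * ?b) \<subseteq> lists ?S" "keys (scl (- ?c) (?b * ?a)) \<subseteq> lists ?S"
    by (rule keys_mult_lists[OF ab]) (rule order_trans[OF keys_scl keys_mult_lists[OF ab(2,1)]])
  from order_trans[OF keys_add Un_least[OF this]] show ?case
    by (simp add: supercomm_def)
qed simp

lemma keys_assoc_eval:
  fixes f :: "'x monomial \<Rightarrow> 'k::field"
  assumes "f \<in> carrier (free_nonassoc G d)"
  shows "keys (assoc_eval d (\<lambda>g. word [g]) f) \<subseteq> lists G"
proof
  fix w assume w: "w \<in> keys (assoc_eval d (\<lambda>g. word [g]) f)"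
  from keys_lext[OF w[unfolded assoc_eval_def]] obtain m
    where m: "m \<in> keys (Abs_poly_mapping f)" "w \<in> keys (assoc_monomial d (\<lambda>g. word [g] :: 'x list \<Rightarrow>\<^sub>0 'k) m)"
    by auto
  then have "set_monomial m \<subseteq> G"
    using assms by (simp add: free_nonassoc_simps keys_Abs)
  from subsetD[OF lists_mono[OF this] subsetD[OF keys_assoc_monomial m(2)]] show "w \<in> lists G" .
qed

lemma free_relations_superideal:
  "superideal (ideal_gen (free_nonassoc G d) (lie_relators (free_nonassoc G d)))
    (free_nonassoc G d :: ('k::field, 'x monomial \<Rightarrow> 'k) superalgebra)"
proof -
  interpret superalgebra "free_nonassoc G d :: ('k, 'x monomial \<Rightarrow> 'k) superalgebra"
    by (rule superalgebra_free_nonassoc)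
  have "lie_relators (free_nonassoc G d) \<subseteq> carrier (free_nonassoc G d :: ('k, 'x monomial \<Rightarrow> 'k) superalgebra)"
    unfolding lie_relators_def by auto
  then show ?thesis
    by (rule ideal_gen)
qed

lemma lie_superalgebra_free_lie:
  "lie_superalgebra (free_lie G d :: ('k::field, ('x monomial \<Rightarrow> 'k) set) superalgebra)"
proof -
  interpret superalgebra "free_nonassoc G d :: ('k, 'x monomial \<Rightarrow> 'k) superalgebra"
    by (rule superalgebra_free_nonassoc)
  show ?thesis
    unfolding free_lie_def by (rule quotient_lie_superalgebra[OF free_relations_superideal subset_ideal_gen])
qed

text \<open>The HNN envelope with \<open>A = 0\<close>, \<open>t = 0\<close> and \<open>B\<close>
  the whole free Lie superalgebra is its universal envelope, in which it embeds by
  \<open>emb_J\<close>. An expression that vanishes in the free associative algebra also vanishes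
  after substituting the images of the generators, hence is zero in the free Lie
  superalgebra.\<close>

lemma free_lie_embedding:
  fixes f :: "'x monomial \<Rightarrow> 'k::field"
  assumes char: "(2::'k) \<noteq> 0" "(3::'k) \<noteq> 0"
    and f: "f \<in> grade (free_nonassoc G d) p" "assoc_eval d (\<lambda>g. word [g]) f = 0"
  shows "f \<in> ideal_gen (free_nonassoc G d) (lie_relators (free_nonassoc G d))"
proof -
  let ?A = "free_nonassoc G d :: ('k, 'x monomial \<Rightarrow> 'k) superalgebra"
  let ?I = "ideal_gen ?A (lie_relators ?A)" and ?F = "free_lie G d :: ('k, _) superalgebra"
  interpret A: superalgebra ?A
    by (rule superalgebra_free_nonassoc)
  interpret F: lie_superalgebra ?F
    by (rule lie_superalgebra_free_lie)
  note I = free_relations_superideal[of G d]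
  note Q = A.quotient_simps[OF I, folded free_lie_def]
  have Z: "subsuperalgebra {\<zero>\<^bsub>?F\<^esub>} ?F"
  proof (rule F.subsuperalgebraI)
    show "subspace_of {\<zero>\<^bsub>?F\<^esub>} ?F"
      by (rule F.subspaceI) auto
    show "x0 \<in> {\<zero>\<^bsub>?F\<^esub>} \<and> x1 \<in> {\<zero>\<^bsub>?F\<^esub>}"
      if "x0 \<in> grade ?F 0" "x1 \<in> grade ?F 1" "x0 \<oplus>\<^bsub>?F\<^esub> x1 \<in> {\<zero>\<^bsub>?F\<^esub>}" for x0 x1
      using F.decomp_zero[of x0 x1] that by simp
  qed simp
  obtain \<B> \<kappa> r where "hnn_basis ?F 0 \<zero>\<^bsub>?F\<^esub> {\<zero>\<^bsub>?F\<^esub>} (carrier ?F) \<B> \<kappa> r"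
    using hnn_basis_exists[OF F.lie_superalgebra_axioms char F.gradeD(3)[of 0] Z F.subsuperalgebra_carrier, of "{}"]
    by auto
  then interpret H: hnn_basis ?F 0 "\<zero>\<^bsub>?F\<^esub>" "{\<zero>\<^bsub>?F\<^esub>}" "carrier ?F" \<B> \<kappa> r .
  interpret R: super_rep ?F H.J "\<lambda>q x a. x \<in> carrier ?F \<inter> grade ?F q \<and> a - H.emb q x \<in> H.J"
    by (rule H.super_rep_B)
  let ?e = "\<lambda>x. ?I +>\<^bsub>?A\<^esub> x"
  have e: "?e \<in> superalgebra_hom ?A ?F"
    unfolding free_lie_def by (rule A.quotient_hom[OF I])
  define h where "h g = H.emb (d g) (?e (unit_fun (Gen g)))" for g
  have "?e f \<in> carrier ?F \<inter> grade ?F p \<and> assoc_eval d h f - H.emb p (?e f) \<in> H.J"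
  proof (rule R.H_eval[OF e _ f(1)])
    fix g assume g: "g \<in> G"
    have u: "unit_fun (Gen g) \<in> grade ?A (d g)"
      using unit_fun_in_grade[of "Gen g" G d] g by simp
    show "?e (unit_fun (Gen g)) \<in> carrier ?F \<inter> grade ?F (d g) \<and> h g - H.emb (d g) (?e (unit_fun (Gen g))) \<in> H.J"
      using superalgebra_homD(5)[OF e u] two_sided_idealD(1)[OF H.J_ideal] by (simp add: h_def)
  qed
  moreover have "assoc_eval d h f = 0"
    using subst_hom_assoc_eval[of h d f] f(2) by (simp add: subst_hom_def)
  ultimately have ef: "?e f \<in> carrier ?F \<inter> grade ?F p" "- H.emb p (?e f) \<in> H.J"
    by auto
  then have "H.emb p (?e f) \<in> H.J"
    using two_sided_idealD(5)[OF H.J_ideal ef(2)] by simp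
  then have "?e f = \<zero>\<^bsub>?F\<^esub>"
    using H.emb_J ef(1) by blast
  then show ?thesis
    using A.coset_eq_zero_iff[OF A.superidealD(1)[OF I], of f] f(1) A.coset_zero[OF A.superidealD(1)[OF I]]
    by (simp add: Q(3))
qed

text \<open>Elements of a Lie superalgebra whose images are free associative generators generate a free
  Lie superalgebra.\<close>

lemma (in super_rep) free_subalgebra:
  fixes G :: "'a set"
  assumes L: "lie_superalgebra L" and char: "(2::'k) \<noteq> 0" "(3::'k) \<noteq> 0"
    and gen: "\<And>g. g \<in> G \<Longrightarrow> H (d g) g (h g)"
    and free: "\<And>P. keys P \<subseteq> lists G \<Longrightarrow> subst_hom h P \<in> J \<Longrightarrow> P = 0"
  obtains S where "subsuperalgebra S L" "superalgebra_iso (restrict_to L S) (free_lie G d)" "G \<subseteq> S"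
proof -
  let ?A = "free_nonassoc G d :: ('k, 'a monomial \<Rightarrow> 'k) superalgebra" and ?e = "eval_free L (\<lambda>x. x)"
  let ?I = "ideal_gen ?A (lie_relators ?A)"
  interpret A: superalgebra ?A
    by (rule superalgebra_free_nonassoc)
  have grade: "g \<in> grade L (d g)" if "g \<in> G" for g
    using gen[OF that] by (rule H_grade)
  have e: "?e \<in> superalgebra_hom ?A L"
    using grade by (rule eval_free_hom)
  have e_gen: "?e (unit_fun (Gen g)) = g" if "g \<in> G" for g
    using grade that by (rule eval_free_gen)
  interpret hom: superalgebra_homomorphism ?A L ?e
    by (intro superalgebra_homomorphism.intro superalgebra_homomorphism_axioms.intro e
        A.superalgebra_axioms superalgebra_axioms)
  interpret L: lie_superalgebra L
    by (rule L)
  define K where "K = {x \<in> carrier ?A. ?e x = \<zero>}"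
  have K: "superideal K ?A"
    unfolding K_def by (rule hom.kernel_superideal)
  have "lie_relators ?A \<subseteq> K"
  proof
    fix r assume "r \<in> lie_relators ?A"
    then consider
      (skew) x y p q where "r = x \<otimes>\<^bsub>?A\<^esub> y \<oplus>\<^bsub>?A\<^esub> super_sign p q \<odot>\<^bsub>?A\<^esub> (y \<otimes>\<^bsub>?A\<^esub> x)"
        "x \<in> grade ?A p" "y \<in> grade ?A q"
    | (jacobi) x y z p q r' where "r = x \<otimes>\<^bsub>?A\<^esub> (y \<otimes>\<^bsub>?A\<^esub> z)
         \<ominus>\<^bsub>?A\<^esub> ((x \<otimes>\<^bsub>?A\<^esub> y) \<otimes>\<^bsub>?A\<^esub> z \<oplus>\<^bsub>?A\<^esub> super_sign p q \<odot>\<^bsub>?A\<^esub> (y \<otimes>\<^bsub>?A\<^esub> (x \<otimes>\<^bsub>?A\<^esub> z)))"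
        "x \<in> grade ?A p" "y \<in> grade ?A q" "z \<in> grade ?A r'"
      unfolding lie_relators_def by blast
    then show "r \<in> K"
    proof cases
      case skew
      then have "?e x \<otimes> ?e y = \<ominus> (super_sign p q \<odot> (?e y \<otimes> ?e x))"
        by (intro L.super_skew) simp_all
      then show ?thesis
        using skew M.l_neg[of "super_sign p q \<odot> (?e y \<otimes> ?e x)"] by (simp add: K_def)
    next
      case jacobi
      have "?e x \<otimes> (?e y \<otimes> ?e z) =
          (?e x \<otimes> ?e y) \<otimes> ?e z \<oplus> super_sign p q \<odot> (?e y \<otimes> (?e x \<otimes> ?e z))"
        by (rule L.super_jacobi[OF hom.homD(5)[OF jacobi(2)] hom.homD(5)[OF jacobi(3)] hom.homD(5)[OF jacobi(4)]])
      then have "?e (x \<otimes>\<^bsub>?A\<^esub> (y \<otimes>\<^bsub>?A\<^esub> z)) =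
          ?e ((x \<otimes>\<^bsub>?A\<^esub> y) \<otimes>\<^bsub>?A\<^esub> z \<oplus>\<^bsub>?A\<^esub> super_sign p q \<odot>\<^bsub>?A\<^esub> (y \<otimes>\<^bsub>?A\<^esub> (x \<otimes>\<^bsub>?A\<^esub> z)))"
        using jacobi by simp
      moreover have "?e r = ?e (x \<otimes>\<^bsub>?A\<^esub> (y \<otimes>\<^bsub>?A\<^esub> z)) \<ominus>
          ?e ((x \<otimes>\<^bsub>?A\<^esub> y) \<otimes>\<^bsub>?A\<^esub> z \<oplus>\<^bsub>?A\<^esub> super_sign p q \<odot>\<^bsub>?A\<^esub> (y \<otimes>\<^bsub>?A\<^esub> (x \<otimes>\<^bsub>?A\<^esub> z)))"
        unfolding jacobi(1) using jacobi by (intro hom.hom_minus) simp_all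
      moreover have "?e (x \<otimes>\<^bsub>?A\<^esub> (y \<otimes>\<^bsub>?A\<^esub> z)) \<in> carrier L"
        using jacobi by (intro hom.homD(1)) simp
      ultimately have "?e r = \<zero>"
        by (simp add: a_minus_def M.r_neg del: hom.homD)
      moreover have "r \<in> carrier ?A"
        unfolding jacobi(1) a_minus_def using jacobi by simp
      ultimately show ?thesis
        by (simp add: K_def)
    qed
  qed
  then have "?I \<subseteq> K"
    by (rule ideal_gen_least[OF K])
  moreover have "K \<subseteq> ?I"
  proof
    fix x assume x: "x \<in> K"
    then have "x \<in> carrier ?A"
      by (simp add: K_def)
    then obtain x0 x1 where xx: "x = x0 \<oplus>\<^bsub>?A\<^esub> x1" "x0 \<in> grade ?A 0" "x1 \<in> grade ?A 1"
      by (rule A.decomp)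
    then have "x0 \<in> K \<and> x1 \<in> K"
      using A.superidealD(4)[OF K] x by blast
    \<comment> \<open>A homogeneous relation between the elements of \<open>G\<close> evaluates into
      \<open>J\<close>. By freeness of the images it vanishes already in the free associative
      algebra, so it is a consequence of the Lie relators.\<close>
    moreover have "f \<in> ?I" if f: "f \<in> grade ?A p" "f \<in> K" for f p
    proof -
      have "H p (?e f) (assoc_eval d h f)"
        using gen e_gen by (intro H_eval[OF e _ f(1)]) simp
      then have "assoc_eval d h f \<in> J"
        using f(2) by (intro H_zeroD[of p]) (simp add: K_def)
      then have "assoc_eval d (\<lambda>g. word [g]) f = 0"
        using keys_assoc_eval[of f G d] f(1)
        by (intro free) (simp_all add: subst_hom_assoc_eval)
      then show ?thesis
        by (rule free_lie_embedding[OF char f(1)])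
    qed
    ultimately show "x \<in> ?I"
      unfolding xx(1) using xx A.subspaceD(4)[OF A.superidealD(1)[OF free_relations_superideal]] by blast
  qed
  ultimately have KI: "K = ?I"
    by blast
  show thesis
  proof (rule that[of "?e ` carrier ?A"])
    show "subsuperalgebra (?e ` carrier ?A) L"
      by (rule hom.image_subsuperalgebra)
    show "superalgebra_iso (restrict_to L (?e ` carrier ?A)) (free_lie G d)"
      using hom.first_isomorphism[OF K_def] unfolding KI free_lie_def .
    show "G \<subseteq> ?e ` carrier ?A"
    proof
      fix g assume "g \<in> G"
      then have "?e (unit_fun (Gen g)) = g" "unit_fun (Gen g) \<in> carrier ?A"
        using e_gen by (auto intro!: unit_fun_in_carrier)
      then show "g \<in> ?e ` carrier ?A"
        by (metis imageI)
    qed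
  qed
qed

section \<open>Free subalgebras of HNN extensions\<close>

lemma derived_series_subset:
  assumes "superalgebra L"
  shows "derived_series L (Suc n) \<subseteq> derived_series L n"
proof (induction n)
  case 0
  interpret superalgebra L
    by (rule assms)
  show ?case
    using subspace_carrier by (auto simp: linear_span_def)
next
  case (Suc n)
  then have "{x \<otimes>\<^bsub>L\<^esub> y | x y. x \<in> derived_series L (Suc n) \<and> y \<in> derived_series L (Suc n)}
      \<subseteq> {x \<otimes>\<^bsub>L\<^esub> y | x y. x \<in> derived_series L n \<and> y \<in> derived_series L n}"
    by blast
  then show ?case
    unfolding derived_series.simps(2)[of L n] derived_series.simps(2)[of L "Suc n"]
    unfolding linear_span_def by (intro Inter_anti_mono) auto
qed

lemma derived_series_mult:
  "x \<in> derived_series L n \<Longrightarrow> y \<in> derived_series L n \<Longrightarrow> x \<otimes>\<^bsub>L\<^esub> y \<in> derived_series L (Suc n)"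
  by (auto simp: linear_span_def)

context hnn_basis
begin

lemma not_inversion_None: "\<not> inversion l None"
  using r_None by (auto simp: inversion_def D_def)

lemma not_inversion_outside_A: "b \<notin> A \<Longrightarrow> \<not> inversion None (Some b)"
  by (auto simp: inversion_def D_def)

lemma Some_less_None: "(Some x, None) \<in> r"
  using total_r r_None by (auto simp: total_on_def)

abbreviation tb :: "'a \<Rightarrow> 'a option list" where "tb b \<equiv> [None, Some b]"
abbreviation ttb :: "'a \<Rightarrow> 'a option list" where "ttb b \<equiv> [None, None, Some b]"

text \<open>Every code word begins with \<open>None\<close> and nothing forms an inversion with a
  following \<open>None\<close>, so no redex arises at a junction. Inside a code word none arises
  because \<open>None\<close> and a letter outside \<open>A\<close> are not related by
  \<open>D\<close>.\<close>

lemma code_normal: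
  assumes b: "b \<notin> A" and w: "w \<in> lists {tb b, ttb b}"
  shows "redexes (concat w) = {}"
proof -
  have "successively (\<lambda>x y. \<not> inversion x y) (concat w) \<and> (concat w \<noteq> [] \<longrightarrow> hd (concat w) = None)"
    using w
  proof (induction w)
    case (Cons a w)
    then have a: "a = tb b \<or> a = ttb b"
      by blast
    then have "successively (\<lambda>x y. \<not> inversion x y) a" "last a = Some b" "a \<noteq> []" "hd a = None"
      using not_inversion_None not_inversion_outside_A[OF b] by auto
    then show ?case
      using Cons.IH not_inversion_None by (auto simp: successively_append_iff)
  qed simp
  then show ?thesis
    by (intro successively_redexes) blast
qed

lemma code_inj: "w \<in> lists {tb b, ttb b} \<Longrightarrow> w' \<in> lists {tb b, ttb b} \<Longrightarrow> concat w = concat w' \<Longrightarrow> w = w'"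
proof (induction w arbitrary: w')
  case Nil
  then show ?case
    by (cases w') auto
next
  case (Cons a w)
  then show ?case
    by (cases w') auto
qed

context
  fixes H q b
  assumes rep: "super_rep L J H" and b: "b \<in> \<B> q" "b \<notin> A"
    and Ht: "H p t (word [None])" and Hb: "H q b (word [Some b])"
begin

interpretation R: super_rep L J H
  by (rule rep)

text \<open>For odd \<open>b\<close> the word \<open>b b\<close> is a redex, whereas no product of
  \<open>tb b\<close> and \<open>ttb b\<close> contains one. Therefore the brackets with leading
  words \<open>tb b\<close> and \<open>ttb b\<close> are used in place of \<open>t\<close> and
  \<open>b\<close>.\<close>

definition u1 where "u1 = t \<otimes> b"
definition u2 where "u2 = t \<otimes> u1"
definition a1 :: "'a option list \<Rightarrow>\<^sub>0 'k" where "a1 = supercomm p q (word [None]) (word [Some b])"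
definition a2 :: "'a option list \<Rightarrow>\<^sub>0 'k" where "a2 = supercomm p (p + q) (word [None]) a1"

lemma H_u1: "H (p + q) u1 a1"
  unfolding u1_def a1_def by (rule R.H_mult[OF Ht Hb])

lemma H_u2: "H (p + (p + q)) u2 a2"
  unfolding u2_def a2_def by (rule R.H_mult[OF Ht H_u1])

lemma leads_a1: "leads a1 (tb b)"
  using leads_supercomm[OF leads_word[of "[None]"] leads_word[of "[Some b]"], of p q] Some_less_None
  by (simp add: a1_def Cons_lenlex_iff)

lemma leads_a2: "leads a2 (ttb b)"
  using leads_supercomm[OF leads_word[of "[None]"] leads_a1, of p "p + q"] Some_less_None
  by (simp add: a2_def Cons_lenlex_iff)

lemma normal1: "redexes (tb b) = {}" and normal2: "redexes (ttb b) = {}"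
  and normal21: "redexes (ttb b @ tb b) = {}"
  using code_normal[OF b(2), of "[tb b]"] code_normal[OF b(2), of "[ttb b]"]
    code_normal[OF b(2), of "[ttb b, tb b]"] by simp_all

text \<open>For even \<open>t\<close> the two images have different leading words. For odd
  \<open>t\<close> the two elements have different parities, so equality would make both zero,
  contrary to the leading word of \<open>a1\<close>.\<close>

lemma u1_u2: "u1 \<noteq> u2"
proof
  assume eq: "u1 = u2"
  show False
  proof (cases p)
    case zero
    then have "a2 - a1 \<in> J"
      using R.H_unique[of q u2 a2 a1] H_u1 H_u2 eq by simp
    moreover have "lower (ttb b) (scl (- 1) a1)"
      by (intro lower_scl leads_lower[OF leads_a1] lenlex_shorter) simp
    from leads_add_lower[OF leads_a2 this] have "leads (a2 - a1) (ttb b)"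
      by simp
    ultimately show False
      using leads_notin_J normal2 by blast
  next
    case one
    have "u1 \<in> grade L (p + q)" "u1 \<in> grade L (p + (p + q))"
      using R.H_grade[OF H_u1] R.H_grade[OF H_u2] eq by simp_all
    moreover have "p + q \<noteq> p + (p + q)"
      using one by (cases q) simp_all
    ultimately have "u1 = \<zero>"
      by (rule grade_disjoint)
    then have "a1 \<in> J"
      using H_u1 R.H_zeroD by simp
    then show False
      using leads_notin_J[OF leads_a1 normal1] by simp
  qed
qed

text \<open>The leading words form a code of normal words, so the images of \<open>u1\<close> and
  \<open>u2\<close> are free associative generators and \<open>free_subalgebra\<close> applies. The
  subalgebra is not abelian because \<open>[u2, u1]\<close> has the normal leading word
  \<open>ttb b @ tb b\<close>.\<close>

lemma contains_free:
  assumes L: "lie_superalgebra L"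
  shows "contains_nonabelian_free L"
proof -
  define G where "G = {u1, u2}"
  define d where "d x = (if x = u1 then p + q else p + (p + q))" for x
  define h where "h x = (if x = u1 then a1 else a2)" for x
  define \<phi> where "\<phi> x = (if x = u1 then tb b else ttb b)" for x
  have "P = 0" if P: "keys P \<subseteq> lists G" "subst_hom h P \<in> J" for P :: "'a list \<Rightarrow>\<^sub>0 'k"
  proof (rule subst_hom_injective[OF _ _ _ P])
    show "leads (h g) (\<phi> g)" for g
      using leads_a1 leads_a2 by (simp add: h_def \<phi>_def)
    have code: "map \<phi> w \<in> lists {tb b, ttb b}" for w
      by (induction w) (auto simp: \<phi>_def)
    show "redexes (concat (map \<phi> w)) = {}" for w
      by (rule code_normal[OF b(2) code])
    show "inj_on (\<lambda>w. concat (map \<phi> w)) (lists G)"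
    proof (rule inj_onI)
      fix w w' assume w: "w \<in> lists G" "w' \<in> lists G" "concat (map \<phi> w) = concat (map \<phi> w')"
      from code_inj[OF code code w(3)] have "map \<phi> w = map \<phi> w'" .
      moreover have "inj_on \<phi> G"
        using u1_u2 by (auto simp: inj_on_def \<phi>_def G_def)
      then have "inj_on \<phi> (set w \<union> set w')"
        by (rule inj_on_subset) (use w(1,2) in auto)
      ultimately show "w = w'"
        by (rule map_inj_on)
    qed
  qed
  moreover have "H (d g) g (h g)" if "g \<in> G" for g
    using that H_u1 H_u2 u1_u2 by (auto simp: G_def d_def h_def)
  ultimately obtain S where S: "subsuperalgebra S L" "superalgebra_iso (restrict_to L S) (free_lie G d)" "G \<subseteq> S"
    using R.free_subalgebra[OF L two three, of G d h] by metis
  have "u2 \<otimes> u1 \<noteq> \<zero>"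
  proof
    assume z: "u2 \<otimes> u1 = \<zero>"
    have "supercomm (p + (p + q)) (p + q) a2 a1 \<in> J"
      using R.H_mult[OF H_u2 H_u1] R.H_zeroD unfolding z by blast
    moreover have "leads (supercomm (p + (p + q)) (p + q) a2 a1) (ttb b @ tb b)"
      using Some_less_None by (intro leads_supercomm leads_a1 leads_a2) (simp add: Cons_lenlex_iff)
    ultimately show False
      using leads_notin_J normal21 by blast
  qed
  then have "\<not> abelian (restrict_to L S)"
    using S(3) by (auto simp: abelian_def restrict_to_def G_def)
  moreover have "\<nexists>c. G = {c}"
    using u1_u2 by (auto simp: G_def)
  ultimately show ?thesis
    unfolding contains_nonabelian_free_def using S(1,2) by blast
qed

text \<open>If \<open>x\<close> and \<open>y\<close> have leading words \<open>\<alpha>\<close> and \<open>\<beta>\<close> with \<open>\<beta> \<alpha> < \<alpha> \<beta>\<close>, then so have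
  \<open>[x, [x, y]]\<close> and \<open>[x, y]\<close>, with \<open>\<alpha> \<alpha> \<beta>\<close> and \<open>\<alpha> \<beta>\<close>.\<close>

lemma derived_series_leads:
  "\<exists>x y a c pa pc \<alpha> \<beta>. x \<in> derived_series L n \<and> y \<in> derived_series L n \<and> H pa x a \<and> H pc y c \<and>
    leads a (concat \<alpha>) \<and> leads c (concat \<beta>) \<and> \<alpha> \<in> lists {tb b, ttb b} \<and> \<beta> \<in> lists {tb b, ttb b} \<and>
    (concat \<beta> @ concat \<alpha>, concat \<alpha> @ concat \<beta>) \<in> lenlex r"
proof (induction n)
  case 0
  have "u1 \<in> carrier L" "u2 \<in> carrier L"
    using R.H_grade[OF H_u1] R.H_grade[OF H_u2] by simp_all
  then show ?case
    using H_u1 H_u2 leads_a1 leads_a2 Some_less_None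
    by (intro exI[of _ u2] exI[of _ u1] exI[of _ a2] exI[of _ a1] exI[of _ "p + (p + q)"] exI[of _ "p + q"]
        exI[of _ "[ttb b]"] exI[of _ "[tb b]"]) (simp add: Cons_lenlex_iff)
next
  case (Suc n)
  then obtain x y a c pa pc \<alpha> \<beta> where h: "x \<in> derived_series L n" "y \<in> derived_series L n" "H pa x a" "H pc y c"
    "leads a (concat \<alpha>)" "leads c (concat \<beta>)" "\<alpha> \<in> lists {tb b, ttb b}" "\<beta> \<in> lists {tb b, ttb b}"
    "(concat \<beta> @ concat \<alpha>, concat \<alpha> @ concat \<beta>) \<in> lenlex r"
    by (elim exE conjE)
  have xy: "x \<otimes> y \<in> derived_series L (Suc n)"
    by (rule derived_series_mult[OF h(1,2)])
  then have xxy: "x \<otimes> (x \<otimes> y) \<in> derived_series L (Suc n)"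
    using derived_series_subset[OF superalgebra_axioms] h(1) by (intro derived_series_mult) blast+
  have lead: "leads (supercomm pa pc a c) (concat \<alpha> @ concat \<beta>)"
    by (rule leads_supercomm[OF h(5,6,9)])
  have "((concat \<alpha> @ concat \<beta>) @ concat \<alpha>, concat \<alpha> @ (concat \<alpha> @ concat \<beta>)) \<in> lenlex r"
    using lenlex_prefix[OF h(9), of "concat \<alpha>"] by simp
  then have lead': "leads (supercomm pa (pa + pc) a (supercomm pa pc a c)) (concat \<alpha> @ (concat \<alpha> @ concat \<beta>))"
    by (rule leads_supercomm[OF h(5) lead])
  \<comment> \<open>The order condition for the new pair: after removing the common prefix \<alpha>,
    it is the old condition with \<alpha> \<beta> appended on the right.\<close>
  have "(concat (\<alpha> @ \<beta>) @ concat (\<alpha> @ \<alpha> @ \<beta>), concat (\<alpha> @ \<alpha> @ \<beta>) @ concat (\<alpha> @ \<beta>)) \<in> lenlex r"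
    using lenlex_prefix[OF lenlex_append_mono[OF h(9), of "concat \<alpha> @ concat \<beta>" "concat \<alpha> @ concat \<beta>"], of "concat \<alpha>"]
    by simp
  then show ?case
    using xy xxy R.H_mult[OF h(3,4)] R.H_mult[OF h(3) R.H_mult[OF h(3,4)]] lead lead' h(7,8)
    by (intro exI[of _ "x \<otimes> (x \<otimes> y)"] exI[of _ "x \<otimes> y"] exI[of _ "supercomm pa (pa + pc) a (supercomm pa pc a c)"]
        exI[of _ "supercomm pa pc a c"] exI[of _ "pa + (pa + pc)"] exI[of _ "pa + pc"]
        exI[of _ "\<alpha> @ \<alpha> @ \<beta>"] exI[of _ "\<alpha> @ \<beta>"]) (simp del: derived_series.simps)
qed

text \<open>The elements of \<open>derived_series_leads\<close> are nonzero, as their leading words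
  are products of code words and thus normal. This works in \<open>L\<close> itself, without
  comparing derived series of subalgebras.\<close>

lemma not_soluble: "\<not> soluble L"
proof
  assume "soluble L"
  then obtain n where n: "derived_series L n = {\<zero>}"
    unfolding soluble_def by blast
  obtain x y a c pa pc \<alpha> \<beta> where h: "x \<in> derived_series L n" "H pa x a" "leads a (concat \<alpha>)" "\<alpha> \<in> lists {tb b, ttb b}"
    using derived_series_leads[of n] by (elim exE conjE)
  then have "x = \<zero>"
    using n by simp
  then have "a \<in> J"
    using h(2) R.H_zeroD by simp
  then show False
    using leads_notin_J[OF h(3) code_normal[OF b(2) h(4)]] by simp
qed

end

end

section \<open>Partial homomorphisms\<close>

lemma bit_add_self [simp]: "(q::bit) + q = 0" "(q::bit) + (q + q') = q'"
  by (cases q; cases q'; simp)+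

context lie_superalgebra
begin

lemma skew_smult:
  assumes "x \<in> grade L q" "y \<in> grade L q'"
  shows "x \<otimes> y = (- super_sign q q') \<odot> (y \<otimes> x)"
  using super_skew[OF assms] assms by (simp add: minus_smult)

end

lemma (in superalgebra) smult_eq_zero:
  assumes "c \<odot> x = \<zero>" "c \<noteq> 0" "x \<in> carrier L"
  shows "x = \<zero>"
proof -
  have "inverse c \<odot> (c \<odot> x) = \<zero>"
    using assms(1) by simp
  then show ?thesis
    using assms(2,3) by (simp flip: mult_smult_assoc)
qed

text \<open>The sign law gives \<open>2 [t,t] = 0\<close> for even \<open>t\<close>, and the Jacobi
  identity gives \<open>3 [t,[t,t]] = 0\<close> for odd \<open>t\<close>. So \<open>t\<close> and
  \<open>[t,t]\<close> already span the subalgebra generated by \<open>t\<close>.\<close>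

lemma lie_superalgebra_square:
  fixes L :: "('k::field, 'a) superalgebra" (structure)
  assumes L: "lie_superalgebra L" and char: "(2::'k) \<noteq> 0" "(3::'k) \<noteq> 0" and t: "t \<in> grade L p"
  shows "p = 0 \<Longrightarrow> t \<otimes> t = \<zero>" "t \<otimes> (t \<otimes> t) = \<zero>" "(t \<otimes> t) \<otimes> t = \<zero>" "(t \<otimes> t) \<otimes> (t \<otimes> t) = \<zero>"
proof -
  interpret lie_superalgebra L
    by (rule L)
  have tc: "t \<in> carrier L"
    using t by simp
  have sg: "t \<otimes> t \<in> grade L 0"
    using grade_mult[OF t t] by simp
  show even: "t \<otimes> t = \<zero>" if "p = 0"
  proof (rule smult_eq_zero[of 2])
    have "t \<otimes> t = (- 1) \<odot> (t \<otimes> t)"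
      using skew_smult[OF t t] that by (simp add: super_sign_def)
    then have "(1 + 1) \<odot> (t \<otimes> t) = t \<otimes> t \<oplus> \<ominus> (t \<otimes> t)"
      using tc by (simp only: add_smult mult_in a_inv_eq one_smult)
    then show "2 \<odot> (t \<otimes> t) = \<zero>"
      using tc by (simp add: M.r_neg)
  qed (use char tc in simp_all)
  show ts: "t \<otimes> (t \<otimes> t) = \<zero>"
  proof (cases p)
    case zero
    then show ?thesis
      using even tc by simp
  next
    case one
    let ?z = "t \<otimes> (t \<otimes> t)"
    have "(t \<otimes> t) \<otimes> t = (- 1) \<odot> ?z"
      using skew_smult[OF sg t] by (simp add: super_sign_def)
    then have eq: "?z = (- 1) \<odot> ?z \<oplus> (- 1) \<odot> ?z"
      using super_jacobi[OF t t t] one by (simp add: super_sign_def)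
    have "(1 + 1 + 1) \<odot> ?z = (?z \<oplus> ?z) \<oplus> ?z"
      using tc by (simp only: add_smult mult_in one_smult)
    also have "\<dots> = (?z \<oplus> ?z) \<oplus> (\<ominus> ?z \<oplus> \<ominus> ?z)"
      using arg_cong[OF eq, of "\<lambda>u. (?z \<oplus> ?z) \<oplus> u"] tc by (simp add: a_inv_eq)
    also have "\<dots> = \<zero>"
      using tc M.r_neg[of "?z \<oplus> ?z"] by (simp add: M.minus_add)
    finally have "3 \<odot> ?z = \<zero>"
      by simp
    then show ?thesis
      by (rule smult_eq_zero) (use char tc in simp_all)
  qed
  show "(t \<otimes> t) \<otimes> t = \<zero>"
    using skew_smult[OF sg t] ts by simp
  show "(t \<otimes> t) \<otimes> (t \<otimes> t) = \<zero>"
    using super_jacobi[OF t t sg] ts tc by simp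
qed

context hnn_basis
begin

abbreviation tT :: "'a option list \<Rightarrow>\<^sub>0 'k" where "tT \<equiv> word [None]"
abbreviation sT :: "'a option list \<Rightarrow>\<^sub>0 'k" where "sT \<equiv> supercomm p p tT tT"

text \<open>The relation generated by the assignments that a homomorphism from \<open>L\<close> extending the given
  data would have to make on \<open>t\<close>, \<open>[t, t]\<close> and \<open>C\<close>.\<close>

inductive assignment :: "'a set \<Rightarrow> bit \<Rightarrow> 'a \<Rightarrow> ('a option list \<Rightarrow>\<^sub>0 'k) \<Rightarrow> bool" for C where
  gen_t: "assignment C p t tT"
| gen_tt: "assignment C 0 (t \<otimes> t) sT"
| gen_emb: "x \<in> C \<Longrightarrow> x \<in> grade L q \<Longrightarrow> assignment C q x (emb q x)"
| gen_J: "a \<in> J \<Longrightarrow> assignment C q \<zero> a"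
| gen_add: "assignment C q x a \<Longrightarrow> assignment C q y b \<Longrightarrow> assignment C q (x \<oplus> y) (a + b)"
| gen_smult: "assignment C q x a \<Longrightarrow> assignment C q (c \<odot> x) (scl c a)"

lemmas sq = lie_superalgebra_square[OF lie_superalgebra_axioms two three t]

lemma tt_grade: "t \<otimes> t \<in> grade L 0"
  using grade_mult[OF t t] by simp

lemma assignment_grade: "assignment C q x a \<Longrightarrow> x \<in> grade L q"
  by (induction rule: assignment.induct) (auto intro: t tt_grade gradeD(3-5))

lemma assignment_mono: "assignment C q x a \<Longrightarrow> C \<subseteq> C' \<Longrightarrow> assignment C' q x a"
  by (induction rule: assignment.induct) (auto intro: assignment.intros)

lemma assignment_congr:
  assumes "assignment C q x a" "a' - a \<in> J"
  shows "assignment C q x a'"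
  using assignment.gen_add[OF assms(1) assignment.gen_J[OF assms(2)]] assignment_grade[OF assms(1)] by simp

text \<open>The relation is generated linearly, so an assigned value comes from one decomposition
  into multiples of \<open>t\<close> and \<open>[t,t]\<close> and an element of \<open>C\<close>.
  That decomposition need not be unique; \<open>assignment_eq_emb\<close> removes the
  ambiguity.\<close>

lemma assignment_normal:
  assumes "assignment C q x a" and C: "subspace_of C L" "C \<subseteq> B"
  shows "\<exists>c d b. (c \<noteq> 0 \<longrightarrow> q = p) \<and> (d \<noteq> 0 \<longrightarrow> q = 0) \<and> b \<in> C \<and> b \<in> grade L q \<and>
    x = (c \<odot> t \<oplus> d \<odot> (t \<otimes> t)) \<oplus> b \<and> a - (scl c tT + scl d sT + emb q b) \<in> J"
proof -
  have tc: "t \<in> carrier L"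
    using t by simp
  note J = two_sided_idealD[OF J_ideal] two_sided_ideal_scl[OF J_ideal]
  note zC = subspaceD(3)[OF C(1)]
  show ?thesis
    using assms(1)
proof (induction rule: assignment.induct)
  case gen_t
  then show ?case
    using tc zC gradeD(3) J(1)
    by (intro exI[of _ 1] exI[of _ 0] exI[of _ \<zero>]) (simp add: emb_zero)
next
  case gen_tt
  then show ?case
    using tc zC gradeD(3) J(1)
    by (intro exI[of _ 0] exI[of _ 1] exI[of _ \<zero>]) (simp add: emb_zero)
next
  case (gen_emb x q)
  then show ?case
    using tc J(1) by (intro exI[of _ 0] exI[of _ 0] exI[of _ x]) simp
next
  case (gen_J a q)
  then show ?case
    using tc zC gradeD(3) by (intro exI[of _ 0] exI[of _ 0] exI[of _ \<zero>]) (simp add: emb_zero)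
next
  case (gen_smult q x a k)
  then obtain c d b where h: "c \<noteq> 0 \<longrightarrow> q = p" "d \<noteq> 0 \<longrightarrow> q = 0" "b \<in> C" "b \<in> grade L q"
    "x = (c \<odot> t \<oplus> d \<odot> (t \<otimes> t)) \<oplus> b" "a - (scl c tT + scl d sT + emb q b) \<in> J"
    by blast
  have "k \<odot> x = ((k * c) \<odot> t \<oplus> (k * d) \<odot> (t \<otimes> t)) \<oplus> k \<odot> b"
    using h(4,5) tc by (simp add: smult_add mult_smult_assoc)
  moreover have "scl k a - (scl (k * c) tT + scl (k * d) sT + emb q (k \<odot> b)) = scl k (a - (scl c tT + scl d sT + emb q b))"
    using h(3,4) C(2) by (simp add: emb_smult pm.scale_right_distrib pm.scale_right_diff_distrib subset_eq)
  ultimately show ?case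
    using h J(7) subspaceD(5)[OF C(1)] gradeD(5)
    by (intro exI[of _ "k * c"] exI[of _ "k * d"] exI[of _ "k \<odot> b"]) simp
next
  case (gen_add q x a y a')
  from gen_add.IH obtain c d b c' d' b' where h: "c \<noteq> 0 \<longrightarrow> q = p" "d \<noteq> 0 \<longrightarrow> q = 0" "b \<in> C" "b \<in> grade L q"
    "x = (c \<odot> t \<oplus> d \<odot> (t \<otimes> t)) \<oplus> b" "a - (scl c tT + scl d sT + emb q b) \<in> J"
    and h': "c' \<noteq> 0 \<longrightarrow> q = p" "d' \<noteq> 0 \<longrightarrow> q = 0" "b' \<in> C" "b' \<in> grade L q"
    "y = (c' \<odot> t \<oplus> d' \<odot> (t \<otimes> t)) \<oplus> b'" "a' - (scl c' tT + scl d' sT + emb q b') \<in> J"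
    by blast
  have "x \<oplus> y = ((c + c') \<odot> t \<oplus> (d + d') \<odot> (t \<otimes> t)) \<oplus> (b \<oplus> b')"
    using h(4,5) h'(4,5) tc by (simp add: add_smult M.a_ac)
  moreover have "a + a' - (scl (c + c') tT + scl (d + d') sT + emb q (b \<oplus> b')) =
      (a - (scl c tT + scl d sT + emb q b)) + (a' - (scl c' tT + scl d' sT + emb q b'))"
    using h(3,4) h'(3,4) C(2) by (simp add: emb_add pm.scale_left_distrib subset_eq single_add)
  ultimately have "x \<oplus> y = ((c + c') \<odot> t \<oplus> (d + d') \<odot> (t \<otimes> t)) \<oplus> (b \<oplus> b') \<and>
      a + a' - (scl (c + c') tT + scl (d + d') sT + emb q (b \<oplus> b')) \<in> J"
    using J(2)[OF h(6) h'(6)] by (simp only:)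
  moreover have "c + c' \<noteq> 0 \<longrightarrow> q = p" "d + d' \<noteq> 0 \<longrightarrow> q = 0"
    using h(1,2) h'(1,2) by auto
  moreover have "b \<oplus> b' \<in> C" "b \<oplus> b' \<in> grade L q"
    using subspaceD(4)[OF C(1) h(3) h'(3)] gradeD(4)[OF h(4) h'(4)] by simp_all
  ultimately show ?case
    by blast
qed
qed

lemma assignment_t_emb:
  assumes "b \<in> A" "b \<in> grade L q" "t \<otimes> b \<in> C"
  shows "assignment C (p + q) (t \<otimes> b) (supercomm p q tT (emb q b))"
  using assms grade_mult[OF t assms(2)]
  by (intro assignment_congr[OF assignment.gen_emb] supercomm_emb_None) auto

lemma assignment_swap:
  assumes "x \<in> grade L q" "y \<in> grade L q'" "assignment C (q + q') (x \<otimes> y) (supercomm q q' a b)"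
  shows "assignment C (q' + q) (y \<otimes> x) (supercomm q' q b a)"
proof -
  have "supercomm q' q b a = scl (- super_sign q' q) (supercomm q q' a b)"
    using supercomm_skew[of q' q b a] by (simp add: eq_neg_iff_add_eq_0)
  then show ?thesis
    using assignment.gen_smult[OF assms(3), of "- super_sign q' q"] skew_smult[OF assms(2,1)]
    by (simp add: add.commute)
qed

text \<open>By the Jacobi identity \<open>[[t,t],b]\<close> is \<open>1 - super_sign p p\<close>
  times \<open>[t,[t,b]]\<close>, in \<open>L\<close> and in the envelope alike. The outer bracket
  with \<open>t\<close> is governed by a relation because \<open>[t,b]\<close> is still in
  \<open>A\<close>.\<close>

lemma assignment_tt_emb:
  assumes b: "b \<in> A" "b \<in> grade L q" "t \<otimes> b \<in> A" "t \<otimes> (t \<otimes> b) \<in> C"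
  shows "assignment C (0 + q) ((t \<otimes> t) \<otimes> b) (supercomm 0 q sT (emb q b))"
proof -
  let ?z = "t \<otimes> (t \<otimes> b)" and ?Z = "supercomm p (p + q) tT (supercomm p q tT (emb q b))"
  have tb: "t \<otimes> b \<in> grade L (p + q)"
    by (rule grade_mult[OF t b(2)])
  have tc: "t \<in> carrier L" "b \<in> carrier L"
    using t b by auto
  have "?Z - supercomm p (p + q) tT (emb (p + q) (t \<otimes> b)) =
      supercomm p (p + q) tT (supercomm p q tT (emb q b) - emb (p + q) (t \<otimes> b))"
    by (simp add: supercomm_diff_right)
  also have "\<dots> \<in> J"
    using b(1,2) by (intro two_sided_ideal_supercomm[OF J_ideal] disjI2 supercomm_emb_None) auto
  finally have "assignment C (p + (p + q)) ?z ?Z"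
    by (rule assignment_congr[OF assignment_t_emb[OF b(3) tb b(4)]])
  from assignment.gen_smult[OF this, of "1 - super_sign p p"]
  have "assignment C (0 + q) ((1 - super_sign p p) \<odot> ?z) (scl (1 - super_sign p p) ?Z)"
    by simp
  moreover have "(1 - super_sign p p) \<odot> ?z = (t \<otimes> t) \<otimes> b"
  proof -
    have "?z = (t \<otimes> t) \<otimes> b \<oplus> super_sign p p \<odot> ?z"
      by (rule super_jacobi[OF t t b(2)])
    then have "?z \<oplus> (- super_sign p p) \<odot> ?z = ((t \<otimes> t) \<otimes> b \<oplus> super_sign p p \<odot> ?z) \<oplus> (- super_sign p p) \<odot> ?z"
      by simp
    also have "\<dots> = (t \<otimes> t) \<otimes> b"
      using tc by (simp add: M.a_assoc minus_smult M.r_neg)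
    finally show ?thesis
      using add_smult[of ?z 1 "- super_sign p p"] tc by simp
  qed
  moreover have "scl (1 - super_sign p p) ?Z = supercomm 0 q sT (emb q b)"
    using supercomm_jacobi[of p p q tT tT "emb q b"] by (simp add: pm.scale_left_diff_distrib diff_eq_eq)
  ultimately show ?thesis
    by simp
qed

lemma assignment_mult_right:
  assumes x: "x \<in> grade L q"
    and T: "assignment C' (q + p) (x \<otimes> t) (supercomm q p a tT)"
    and S: "assignment C' (q + 0) (x \<otimes> (t \<otimes> t)) (supercomm q 0 a sT)"
    and E: "\<And>b q'. b \<in> C \<Longrightarrow> b \<in> grade L q' \<Longrightarrow> assignment C' (q + q') (x \<otimes> b) (supercomm q q' a (emb q' b))"
  shows "assignment C q' y a' \<Longrightarrow> assignment C' (q + q') (x \<otimes> y) (supercomm q q' a a')"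
proof (induction rule: assignment.induct)
  case (gen_J a' q')
  then show ?case
    using x assignment.gen_J[OF two_sided_ideal_supercomm[OF J_ideal, of a a']] by simp
next
  case (gen_add q' y b z c)
  have "x \<otimes> (y \<oplus> z) = x \<otimes> y \<oplus> x \<otimes> z"
    using x assignment_grade[OF gen_add(1)] assignment_grade[OF gen_add(2)] by (intro mult_add) auto
  then show ?case
    using assignment.gen_add[OF gen_add.IH] by (simp add: supercomm_add_right)
next
  case (gen_smult q' y b k)
  have "x \<otimes> (k \<odot> y) = k \<odot> (x \<otimes> y)"
    using x assignment_grade[OF gen_smult(1)] by (intro mult_smult) auto
  then show ?case
    using assignment.gen_smult[OF gen_smult.IH, of k] by (simp add: supercomm_scl_right)
qed (use T S E in simp_all)

text \<open>A bracket of elements assigned over \<open>C\<close> involves \<open>C\<close>,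
  \<open>[t,C]\<close> and \<open>[t,[t,C]]\<close>, all contained in \<open>C'\<close>. Thus one
  multiplication costs at most two stages of the chain.\<close>

lemma assignment_mult:
  assumes C: "subsuperalgebra C L" "C \<subseteq> A" "C \<subseteq> C'"
    and tC: "\<And>b. b \<in> C \<Longrightarrow> t \<otimes> b \<in> A \<and> t \<otimes> b \<in> C' \<and> t \<otimes> (t \<otimes> b) \<in> C'"
    and y: "assignment C q' y a'"
  shows "assignment C q x a \<Longrightarrow> assignment C' (q + q') (x \<otimes> y) (supercomm q q' a a')"
proof (induction rule: assignment.induct)
  have zero: "assignment C' q \<zero> 0" for q
    by (rule assignment.gen_J) (rule two_sided_idealD(1)[OF J_ideal])
  \<comment> \<open>Counterparts in the associative algebra of the vanishing brackets in
    \<open>sq\<close>; they hold identically, not only modulo \<open>J\<close>.\<close>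
  have zeroT: "supercomm p 0 tT sT = 0" "supercomm 0 p sT tT = 0" "supercomm 0 0 sT sT = 0"
    by (cases p; simp add: supercomm_def super_sign_def algebra_simps)+
  have E: "assignment C' (p + q) (t \<otimes> b) (supercomm p q tT (emb q b))"
    "assignment C' (0 + q) ((t \<otimes> t) \<otimes> b) (supercomm 0 q sT (emb q b))" if "b \<in> C" "b \<in> grade L q" for b q
    using that tC C(2) by (blast intro: assignment_t_emb assignment_tt_emb)+
  {
    case gen_t
    show ?case
      by (rule assignment_mult_right[OF t _ _ _ y])
        (use assignment.gen_tt[of C'] zero sq zeroT E(1) in simp_all)
  next
    case gen_tt
    show ?case
      by (rule assignment_mult_right[OF tt_grade _ _ _ y])
        (use zero sq zeroT E(2) in simp_all)
  next
    case (gen_emb x q)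
    show ?case
    proof (rule assignment_mult_right[OF gen_emb(2) _ _ _ y])
      show "assignment C' (q + p) (x \<otimes> t) (supercomm q p (emb q x) tT)"
        by (rule assignment_swap[OF t gen_emb(2) E(1)[OF gen_emb]])
      show "assignment C' (q + 0) (x \<otimes> (t \<otimes> t)) (supercomm q 0 (emb q x) sT)"
        by (rule assignment_swap[OF tt_grade gen_emb(2) E(2)[OF gen_emb]])
      show "assignment C' (q + q') (x \<otimes> b) (supercomm q q' (emb q x) (emb q' b))"
        if b: "b \<in> C" "b \<in> grade L q'" for b q'
      proof (rule assignment_congr[OF assignment.gen_emb])
        show "x \<otimes> b \<in> C'"
          using subsuperalgebraD(2)[OF C(1) gen_emb(1) b(1)] C(3) by blast
        show "x \<otimes> b \<in> grade L (q + q')"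
          by (rule grade_mult[OF gen_emb(2) b(2)])
        show "supercomm q q' (emb q x) (emb q' b) - emb (q + q') (x \<otimes> b) \<in> J"
          using gen_emb b C(2) AB by (intro supercomm_emb) auto
      qed
    qed
  next
    case (gen_J a q)
    then show ?case
      using assignment_grade[OF y] assignment.gen_J[OF two_sided_ideal_supercomm[OF J_ideal, of a a']] by simp
  next
    case (gen_add q x b z c)
    have "(x \<oplus> z) \<otimes> y = x \<otimes> y \<oplus> z \<otimes> y"
      using assignment_grade[OF y] assignment_grade[OF gen_add(1)] assignment_grade[OF gen_add(2)] by (intro add_mult) auto
    then show ?case
      using assignment.gen_add[OF gen_add.IH] by (simp add: supercomm_add_left)
  next
    case (gen_smult q x b k)
    have "(k \<odot> x) \<otimes> y = k \<odot> (x \<otimes> y)"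
      using assignment_grade[OF y] assignment_grade[OF gen_smult(1)] by (intro smult_mult) auto
    then show ?case
      using assignment.gen_smult[OF gen_smult.IH, of k] by (simp add: supercomm_scl_left)
  }
qed

text \<open>Each product raises \<open>2 * size m\<close> by at least the two stages that
  \<open>assignment_mult\<close> consumes. The bound \<open>N\<close> keeps all intermediate
  brackets with \<open>t\<close> inside the range where relations are imposed.\<close>

lemma assignment_monomial:
  fixes C :: "nat \<Rightarrow> 'a set"
  assumes C: "\<And>n. subsuperalgebra (C n) L" "mono C" "\<And>n b. b \<in> C n \<Longrightarrow> t \<otimes> b \<in> C (Suc n)"
    and AB_eq: "A = C N" "B = C (Suc N)"
    and gen: "\<And>g. g \<in> G \<Longrightarrow> assignment (C 0) (d g) (x g) (h g)"
  shows "set_monomial m \<subseteq> G \<Longrightarrow> 2 * size m \<le> N \<Longrightarrow>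
    assignment (C (2 * size m)) (parity d m) (eval_monomial L x m) (assoc_monomial d h m)"
proof (induction m)
  case (Gen g)
  then have "assignment (C 0) (d g) (x g) (h g)"
    using gen by simp
  then have "assignment (C (2 * size (Gen g))) (d g) (x g) (h g)"
    by (rule assignment_mono) (rule monoD[OF C(2)], simp)
  then show ?case
    by simp
next
  case (Prod m1 m2)
  define k where "k = 2 * size m1 + 2 * size m2"
  have k: "k \<le> N" "Suc k \<le> N" "Suc (Suc k) = 2 * size (Prod m1 m2)"
    using Prod.prems by (auto simp: k_def)
  have mono: "C i \<subseteq> C j" if "i \<le> j" for i j
    using monoD[OF C(2) that] by simp
  have "assignment (C k) (parity d m1) (eval_monomial L x m1) (assoc_monomial d h m1)"
    by (rule assignment_mono[OF Prod.IH(1) mono]) (use Prod.prems k_def in auto)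
  moreover have "assignment (C k) (parity d m2) (eval_monomial L x m2) (assoc_monomial d h m2)"
    by (rule assignment_mono[OF Prod.IH(2) mono]) (use Prod.prems k_def in auto)
  moreover have "t \<otimes> b \<in> A \<and> t \<otimes> b \<in> C (Suc (Suc k)) \<and> t \<otimes> (t \<otimes> b) \<in> C (Suc (Suc k))" if "b \<in> C k" for b
    using C(3)[OF that] C(3)[OF C(3)[OF that]] mono[OF k(2)] mono[of "Suc k" "Suc (Suc k)"] AB_eq by auto
  moreover have "C k \<subseteq> A" "C k \<subseteq> C (Suc (Suc k))"
    using mono k AB_eq by auto
  ultimately have "assignment (C (Suc (Suc k))) (parity d m1 + parity d m2)
      (eval_monomial L x m1 \<otimes> eval_monomial L x m2)
      (supercomm (parity d m1) (parity d m2) (assoc_monomial d h m1) (assoc_monomial d h m2))"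
    by (intro assignment_mult[OF C(1)[of k]])
  then show ?case
    unfolding k(3) by simp
qed

end

text \<open>Graded subalgebras of the restricted algebra are those of \<open>L\<close> contained in
  \<open>I\<close>, so both generate the same subalgebra from \<open>S\<close>.\<close>

lemma finitely_generated_restrict:
  fixes L :: "('k::field, 'a) superalgebra" (structure)
  assumes L: "superalgebra L" and I: "subsuperalgebra I L"
    and S: "finite S" "S \<subseteq> homogeneous L" "subalgebra_gen L S = I"
  shows "finitely_generated (restrict_to L I)"
proof -
  interpret superalgebra L
    by (rule L)
  let ?R = "restrict_to L I"
  note I' = subsuperalgebraD[OF I]
  note sub = subspaceD[OF I'(1)]
  have R: "carrier ?R = I" "x \<oplus>\<^bsub>?R\<^esub> y = x \<oplus> y" "c \<odot>\<^bsub>?R\<^esub> x = c \<odot> x" "x \<otimes>\<^bsub>?R\<^esub> y = x \<otimes> y"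
    "\<zero>\<^bsub>?R\<^esub> = \<zero>" "grade ?R q = grade L q \<inter> I" "set_add ?R V W = set_add L V W" for x y c q V W
    by (simp_all add: restrict_to_def set_add_def')
  have SI: "S \<subseteq> I"
    using subset_subalgebra_gen[of S L] S(3) by simp
  have "abelian_group ?R"
  proof (rule abelian_groupI)
    fix x assume "x \<in> carrier ?R"
    then show "\<exists>y\<in>carrier ?R. y \<oplus>\<^bsub>?R\<^esub> x = \<zero>\<^bsub>?R\<^esub>"
      using sub(2,6) by (intro bexI[of _ "\<ominus> x"]) (simp_all add: R M.l_neg)
  qed (simp_all add: R sub M.a_ac)
  then interpret R: module ring_of_type_algebra ?R
    by (intro moduleI cring_from_type_algebra)
      (simp_all add: R sub smult_add add_smult mult_smult_assoc)
  have "subspace_of I ?R"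
    using R.carrier_is_submodule unfolding R(1) .
  moreover have "I = set_add L (I \<inter> grade L 0) (I \<inter> grade L 1)"
    using I unfolding subsuperalgebra_def graded_subspace_def by blast
  moreover have "I \<inter> (grade L q \<inter> I) = I \<inter> grade L q" for q
    by blast
  ultimately have "subsuperalgebra I ?R"
    using I'(2) unfolding subsuperalgebra_def graded_subspace_def R by simp
  then have "subalgebra_gen ?R S \<subseteq> I"
    using SI by (rule subalgebra_gen_least)
  moreover have "I \<subseteq> T" if T: "subsuperalgebra T ?R" "S \<subseteq> T" for T
  proof -
    have sT: "subspace_of T ?R" and gT: "T = set_add L (T \<inter> (grade L 0 \<inter> I)) (T \<inter> (grade L 1 \<inter> I))"
      and mT: "\<And>x y. x \<in> T \<Longrightarrow> y \<in> T \<Longrightarrow> x \<otimes> y \<in> T"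
      using T(1) unfolding subsuperalgebra_def graded_subspace_def R by blast+
    note sgT = submodule.axioms(1)[OF sT]
    have "T \<subseteq> I"
      using R.submoduleE(1)[OF sT] by (simp add: R)
    have "subspace_of T L"
    proof (rule subspaceI)
      show "T \<subseteq> carrier L"
        using \<open>T \<subseteq> I\<close> sub(1) by blast
      show "\<zero> \<in> T"
        using subgroup.one_closed[OF sgT] by (simp add: R)
      show "x \<oplus> y \<in> T" if "x \<in> T" "y \<in> T" for x y
        using R.submoduleE(5)[OF sT that] by (simp add: R)
      show "c \<odot> x \<in> T" if "x \<in> T" for c x
        using R.submoduleE(4)[OF sT _ that, of c] by (simp add: R)
    qed
    moreover have "T \<inter> (grade L q \<inter> I) = T \<inter> grade L q" for q
      using \<open>T \<subseteq> I\<close> by blast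
    ultimately have "subsuperalgebra T L"
      using gT mT unfolding subsuperalgebra_def graded_subspace_def by simp
    then show ?thesis
      using subalgebra_gen_least[of T L S] T(2) S(3) by simp
  qed
  then have "I \<subseteq> subalgebra_gen ?R S"
    unfolding subalgebra_gen_def by blast
  ultimately have "subalgebra_gen ?R S = carrier ?R"
    by (simp add: R)
  moreover have "S \<subseteq> homogeneous ?R"
    using S(2) SI by (auto simp: homogeneous_def R)
  ultimately show ?thesis
    unfolding finitely_generated_def using S(1) by blast
qed

section \<open>Presentations\<close>

context superalgebra_homomorphism
begin

lemma grade_lift:
  assumes x: "x \<in> carrier L" "h x \<in> grade M p"
  shows "\<exists>y \<in> grade L p. h y = h x"
proof -
  obtain x0 x1 where xx: "x = x0 \<oplus>\<^bsub>L\<^esub> x1" "x0 \<in> grade L 0" "x1 \<in> grade L 1"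
    using L.decomp x(1) by blast
  show ?thesis
  proof (cases p)
    case zero
    then have "h x0 \<oplus>\<^bsub>M\<^esub> h x1 = h x \<oplus>\<^bsub>M\<^esub> \<zero>\<^bsub>M\<^esub>"
      using xx x by simp
    then have "h x0 = h x"
      using M.decomp_unique[of "h x0" "h x1" "h x" "\<zero>\<^bsub>M\<^esub>"] xx x zero M.gradeD(3) by auto
    then show ?thesis
      using xx zero by blast
  next
    case one
    then have "h x0 \<oplus>\<^bsub>M\<^esub> h x1 = \<zero>\<^bsub>M\<^esub> \<oplus>\<^bsub>M\<^esub> h x"
      using xx x by simp
    then have "h x1 = h x"
      using M.decomp_unique[of "h x0" "h x1" "\<zero>\<^bsub>M\<^esub>" "h x"] xx x one M.gradeD(3) by auto
    then show ?thesis
      using xx one by blast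
  qed
qed

lemma inverse_hom:
  assumes bij: "bij_betw h (carrier L) (carrier M)"
  shows "inv_into (carrier L) h \<in> superalgebra_hom M L"
proof -
  let ?g = "inv_into (carrier L) h"
  have gh: "?g (h x) = x" if "x \<in> carrier L" for x
    using bij_betw_inv_into_left[OF bij that] .
  have ex: "\<exists>x \<in> carrier L. u = h x" if "u \<in> carrier M" for u
    using that bij_betw_imp_surj_on[OF bij] by blast
  show ?thesis
    unfolding superalgebra_hom_def
  proof (intro CollectI conjI ballI allI funcsetI image_subsetI)
    show "?g u \<in> carrier L" if "u \<in> carrier M" for u
      using ex[OF that] gh by auto
    fix u v assume "u \<in> carrier M" "v \<in> carrier M"
    then obtain x y where xy: "x \<in> carrier L" "y \<in> carrier L" "u = h x" "v = h y"
      using ex by blast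
    then show "?g (u \<oplus>\<^bsub>M\<^esub> v) = ?g u \<oplus>\<^bsub>L\<^esub> ?g v" "?g (u \<otimes>\<^bsub>M\<^esub> v) = ?g u \<otimes>\<^bsub>L\<^esub> ?g v"
      using gh[of "x \<oplus>\<^bsub>L\<^esub> y"] gh[of "x \<otimes>\<^bsub>L\<^esub> y"] by (simp_all add: gh)
  next
    fix c u assume "u \<in> carrier M"
    then obtain x where x: "x \<in> carrier L" "u = h x"
      using ex by blast
    then show "?g (c \<odot>\<^bsub>M\<^esub> u) = c \<odot>\<^bsub>L\<^esub> ?g u"
      using gh[of "c \<odot>\<^bsub>L\<^esub> x"] by (simp add: gh)
  next
    fix p u assume u: "u \<in> grade M p"
    then obtain x where "x \<in> carrier L" "u = h x"
      using ex[OF M.grade_in] by blast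
    then obtain y where "y \<in> grade L p" "h y = u"
      using grade_lift[of x p] u by auto
    then show "?g u \<in> grade L p"
      using gh[of y] by auto
  qed
qed

end

text \<open>The two successive quotients of a presentation are replaced by one surjection from the
  free nonassociative superalgebra, whose finitely many extra relators are lifted homogeneously. Its
  kernel is described by minimality: it lies in every graded ideal containing all the
  relators.\<close>

lemma finitely_presented_cover:
  fixes L :: "('k::field, 'a) superalgebra"
  assumes L: "superalgebra L" and fp: "finitely_presented L"
  obtains G :: "nat set" and d :: "nat \<Rightarrow> bit" and F :: "(nat monomial \<Rightarrow> 'k) set" and Q
  where "finite G" "finite F" "F \<subseteq> homogeneous (free_nonassoc G d)"
    "Q \<in> superalgebra_hom (free_nonassoc G d) L" "Q ` carrier (free_nonassoc G d) = carrier L"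
    "\<And>f. f \<in> F \<Longrightarrow> Q f = \<zero>\<^bsub>L\<^esub>"
    "\<And>K f. superideal K (free_nonassoc G d) \<Longrightarrow> lie_relators (free_nonassoc G d) \<subseteq> K \<Longrightarrow> F \<subseteq> K \<Longrightarrow>
      f \<in> carrier (free_nonassoc G d) \<Longrightarrow> Q f = \<zero>\<^bsub>L\<^esub> \<Longrightarrow> f \<in> K"
proof -
  obtain G :: "nat set" and d R where G: "finite G" and R: "finite R" "R \<subseteq> homogeneous (free_lie G d)"
    and iso: "superalgebra_iso L (quotient_superalgebra (free_lie G d) (ideal_gen (free_lie G d) R))"
    using fp unfolding finitely_presented_def by blast
  let ?A = "free_nonassoc G d :: ('k, nat monomial \<Rightarrow> 'k) superalgebra"
  let ?F = "free_lie G d :: ('k, (nat monomial \<Rightarrow> 'k) set) superalgebra"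
  let ?I1 = "ideal_gen ?A (lie_relators ?A)" and ?I2 = "ideal_gen ?F R"
  let ?M = "quotient_superalgebra ?F ?I2"
  interpret A: superalgebra ?A
    by (rule superalgebra_free_nonassoc)
  interpret L: superalgebra L
    by (rule L)
  have I1: "superideal ?I1 ?A"
    by (rule free_relations_superideal)
  interpret F: superalgebra ?F
    unfolding free_lie_def by (rule A.quotient_superalgebra[OF I1])
  have I2: "superideal ?I2 ?F"
    using R(2) by (intro F.ideal_gen) (auto simp: homogeneous_def)
  interpret M: superalgebra ?M
    by (rule F.quotient_superalgebra[OF I2])
  obtain \<phi> where \<phi>: "\<phi> \<in> superalgebra_hom L ?M" "bij_betw \<phi> (carrier L) (carrier ?M)"
    using iso unfolding superalgebra_iso_def by blast
  interpret phi: superalgebra_homomorphism L ?M \<phi>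
    by unfold_locales (rule \<phi>)
  define \<psi> where "\<psi> = inv_into (carrier L) \<phi>"
  have \<psi>: "\<psi> \<in> superalgebra_hom ?M L"
    unfolding \<psi>_def by (rule phi.inverse_hom[OF \<phi>(2)])
  interpret psi: superalgebra_homomorphism ?M L \<psi>
    by unfold_locales (rule \<psi>)
  have \<phi>\<psi>: "\<phi> (\<psi> u) = u" if "u \<in> carrier ?M" for u
    unfolding \<psi>_def by (rule bij_betw_inv_into_right[OF \<phi>(2) that])
  have \<psi>\<phi>: "\<psi> (\<phi> x) = x" if "x \<in> carrier L" for x
    unfolding \<psi>_def by (rule bij_betw_inv_into_left[OF \<phi>(2) that])
  let ?\<pi>1 = "\<lambda>f. ?I1 +>\<^bsub>?A\<^esub> f" and ?\<pi>2 = "\<lambda>u. ?I2 +>\<^bsub>?F\<^esub> u"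
  have \<pi>1: "?\<pi>1 \<in> superalgebra_hom ?A ?F"
    unfolding free_lie_def by (rule A.quotient_hom[OF I1])
  have onto1: "?\<pi>1 ` carrier ?A = carrier ?F"
    unfolding free_lie_def by (simp add: A.quotient_simps(1)[OF I1])
  interpret pi1: superalgebra_homomorphism ?A ?F ?\<pi>1
    by unfold_locales (rule \<pi>1)
  have \<pi>2: "?\<pi>2 \<in> superalgebra_hom ?F ?M"
    by (rule F.quotient_hom[OF I2])
  have onto2: "?\<pi>2 ` carrier ?F = carrier ?M"
    by (simp add: F.quotient_simps(1)[OF I2])
  interpret pi2: superalgebra_homomorphism ?F ?M ?\<pi>2
    by unfold_locales (rule \<pi>2)
  define Q where "Q f = \<psi> (?\<pi>2 (?\<pi>1 f))" for f
  have Q: "Q \<in> superalgebra_hom ?A L"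
    unfolding Q_def by (rule superalgebra_hom_comp[OF superalgebra_hom_comp[OF \<pi>1 \<pi>2] \<psi>])
  have onto: "Q ` carrier ?A = carrier L"
  proof -
    have "Q ` carrier ?A = \<psi> ` ?\<pi>2 ` ?\<pi>1 ` carrier ?A"
      by (simp add: Q_def image_image)
    also have "\<dots> = \<psi> ` carrier ?M"
      by (simp only: onto1 onto2)
    also have "\<dots> = carrier L"
      unfolding \<psi>_def by (rule bij_betw_imp_surj_on[OF bij_betw_inv_into[OF \<phi>(2)]])
    finally show ?thesis .
  qed
  have zero_M: "\<zero>\<^bsub>?M\<^esub> = ?I2"
    by (simp add: quotient_superalgebra_def)
  have Q_zero: "Q f = \<zero>\<^bsub>L\<^esub> \<longleftrightarrow> ?\<pi>1 f \<in> ?I2" if "f \<in> carrier ?A" for f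
  proof -
    have f1: "?\<pi>1 f \<in> carrier ?F"
      using that by (rule pi1.homD(1))
    have "Q f = \<zero>\<^bsub>L\<^esub> \<longleftrightarrow> ?\<pi>2 (?\<pi>1 f) = ?I2"
      using \<phi>\<psi>[OF pi2.homD(1)[OF f1]] phi.hom_zero psi.hom_zero unfolding Q_def zero_M by metis
    then show ?thesis
      using F.coset_eq_zero_iff[OF F.superidealD(1)[OF I2] f1] by simp
  qed
  have "\<exists>f \<in> homogeneous ?A. ?\<pi>1 f = u" if u: "u \<in> R" for u
  proof -
    obtain p where "u \<in> grade ?F p"
      using R(2) u unfolding homogeneous_def by blast
    then obtain f where "f \<in> grade ?A p" "u = ?\<pi>1 f"
      unfolding free_lie_def by (rule A.quotient_gradeE[OF I1])
    then show ?thesis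
      unfolding homogeneous_def by (cases p) auto
  qed
  then obtain pre where pre: "\<And>u. u \<in> R \<Longrightarrow> pre u \<in> homogeneous ?A \<and> ?\<pi>1 (pre u) = u"
    by metis
  have hom_carrier: "f \<in> carrier ?A" if "f \<in> homogeneous ?A" for f
    using that unfolding homogeneous_def by auto
  show thesis
  proof (rule that[of G "pre ` R" d Q])
    show "Q f = \<zero>\<^bsub>L\<^esub>" if f: "f \<in> pre ` R" for f
    proof -
      obtain u where u: "u \<in> R" "f = pre u"
        using f by blast
      then show ?thesis
        using Q_zero[of f] pre[OF u(1)] hom_carrier subset_ideal_gen[of R ?F] by auto
    qed
  next
    fix K f
    assume K: "superideal K ?A" "lie_relators ?A \<subseteq> K" "pre ` R \<subseteq> K" and f: "f \<in> carrier ?A" "Q f = \<zero>\<^bsub>L\<^esub>"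
    \<comment> \<open>The image of \<open>K\<close> in the free Lie superalgebra is an ideal
      containing \<open>R\<close>, hence contains \<open>?I2\<close>. So \<open>f\<close> agrees
      with an element of \<open>K\<close> up to the Lie relators, which lie in \<open>K\<close> as
      well.\<close>
    have "superideal (?\<pi>1 ` K) ?F"
      by (rule pi1.image_superideal[OF K(1) onto1])
    moreover have "R \<subseteq> ?\<pi>1 ` K"
    proof
      fix u assume "u \<in> R"
      then show "u \<in> ?\<pi>1 ` K"
        using pre[of u] K(3) by (intro rev_image_eqI[of "pre u"]) auto
    qed
    ultimately have "?I2 \<subseteq> ?\<pi>1 ` K"
      by (rule ideal_gen_least)
    then have "?\<pi>1 f \<in> ?\<pi>1 ` K"
      using f Q_zero by blast
    then obtain k where k: "k \<in> K" "?\<pi>1 f = ?\<pi>1 k"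
      by blast
    have kc: "k \<in> carrier ?A"
      using k A.subspaceD(2)[OF A.superidealD(1)[OF K(1)]] by blast
    have "f \<ominus>\<^bsub>?A\<^esub> k \<in> ?I1"
      using A.coset_eq_iff[OF A.superidealD(1)[OF I1] f(1) kc] k(2) by simp
    then have "f \<ominus>\<^bsub>?A\<^esub> k \<in> K"
      using ideal_gen_least[OF K(1,2)] by blast
    then have "(f \<ominus>\<^bsub>?A\<^esub> k) \<oplus>\<^bsub>?A\<^esub> k \<in> K"
      using k(1) by (rule A.subspaceD(4)[OF A.superidealD(1)[OF K(1)]])
    then show "f \<in> K"
      using f(1) kc by (simp add: a_minus_def A.M.a_assoc A.M.l_neg)
  qed (use G R pre Q onto in auto)
qed

text \<open>Spanning holds since iterated brackets of \<open>t\<close> beyond \<open>[t,t]\<close>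
  vanish. Independence is tested in the free associative algebra on one letter, where an odd
  generator has the square \<open>[t,t] = 2 t t\<close>, nonzero in characteristic other than
  2.\<close>

lemma free_on_one_generator_quotient:
  fixes L :: "('k::field, 'a) superalgebra" (structure)
  assumes L: "lie_superalgebra L" and char: "(2::'k) \<noteq> 0" "(3::'k) \<noteq> 0"
    and I: "superideal I L" and free: "free_on_one_generator (quotient_superalgebra L I)"
  obtains p t where "t \<in> grade L p"
    "\<And>x q. x \<in> grade L q \<Longrightarrow> \<exists>c d. (c \<noteq> 0 \<longrightarrow> q = p) \<and> (d \<noteq> 0 \<longrightarrow> q = 0) \<and> x \<ominus> (c \<odot> t \<oplus> d \<odot> (t \<otimes> t)) \<in> I"
    "\<And>c d. c \<odot> t \<oplus> d \<odot> (t \<otimes> t) \<in> I \<Longrightarrow> c = 0 \<and> (p = 1 \<longrightarrow> d = 0)"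
proof -
  interpret lie_superalgebra L
    by (rule L)
  let ?Q = "quotient_superalgebra L I"
  note Q = quotient_simps[OF I]
  obtain p where iso: "superalgebra_iso ?Q (free_lie {()} (\<lambda>_. p))"
    using free unfolding free_on_one_generator_def by blast
  let ?A = "free_nonassoc {()} (\<lambda>_. p) :: ('k, unit monomial \<Rightarrow> 'k) superalgebra"
  let ?F = "free_lie {()} (\<lambda>_. p) :: ('k, (unit monomial \<Rightarrow> 'k) set) superalgebra"
  let ?I1 = "ideal_gen ?A (lie_relators ?A)"
  interpret A: superalgebra ?A
    by (rule superalgebra_free_nonassoc)
  have I1: "superideal ?I1 ?A"
    by (rule free_relations_superideal)
  interpret F: superalgebra ?F
    unfolding free_lie_def by (rule A.quotient_superalgebra[OF I1])
  interpret Q: superalgebra ?Q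
    by (rule quotient_superalgebra[OF I])
  obtain \<phi> where \<phi>: "\<phi> \<in> superalgebra_hom ?Q ?F" "bij_betw \<phi> (carrier ?Q) (carrier ?F)"
    using iso unfolding superalgebra_iso_def by blast
  interpret phi: superalgebra_homomorphism ?Q ?F \<phi>
    by unfold_locales (rule \<phi>)
  define \<psi> where "\<psi> = inv_into (carrier ?Q) \<phi>"
  have \<psi>: "\<psi> \<in> superalgebra_hom ?F ?Q"
    unfolding \<psi>_def by (rule phi.inverse_hom[OF \<phi>(2)])
  have \<phi>\<psi>: "\<phi> (\<psi> u) = u" if "u \<in> carrier ?F" for u
    unfolding \<psi>_def by (rule bij_betw_inv_into_right[OF \<phi>(2) that])
  have \<psi>\<phi>: "\<psi> (\<phi> x) = x" if "x \<in> carrier ?Q" for x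
    unfolding \<psi>_def by (rule bij_betw_inv_into_left[OF \<phi>(2) that])
  let ?\<pi> = "\<lambda>f. ?I1 +>\<^bsub>?A\<^esub> f"
  have \<pi>: "?\<pi> \<in> superalgebra_hom ?A ?F"
    unfolding free_lie_def by (rule A.quotient_hom[OF I1])
  define e where "e f = \<psi> (?\<pi> f)" for f
  have e: "e \<in> superalgebra_hom ?A ?Q"
    unfolding e_def by (rule superalgebra_hom_comp[OF \<pi> \<psi>])
  interpret e: superalgebra_homomorphism ?A ?Q e
    by unfold_locales (rule e)
  let ?g = "unit_fun (Gen ()) :: unit monomial \<Rightarrow> 'k" and ?gg = "unit_fun (Prod (Gen ()) (Gen ())) :: unit monomial \<Rightarrow> 'k"
  have gr: "?g \<in> grade ?A p" "?gg \<in> grade ?A 0"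
    using unit_fun_in_grade[of "Gen ()" "{()}" "\<lambda>_. p"] unit_fun_in_grade[of "Prod (Gen ()) (Gen ())" "{()}" "\<lambda>_. p"]
    by simp_all
  obtain t where t: "t \<in> grade L p" "e ?g = I +> t"
    using quotient_gradeE[OF I e.homD(5)[OF gr(1)]] by blast
  note sq = lie_superalgebra_square[OF L char t(1)]
  have tc: "t \<in> carrier L" "t \<otimes> t \<in> carrier L"
    using t by simp_all
  have egg: "e ?gg = I +> (t \<otimes> t)"
  proof -
    have "e ?gg = e (?g \<otimes>\<^bsub>?A\<^esub> ?g)"
      by (simp add: free_nonassoc_simps nonassoc_mult_unit_fun)
    then show ?thesis
      using gr(1) t tc by (simp add: Q)
  qed
  \<comment> \<open>Up to cosets, every monomial in the generator is \<open>t\<close>,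
    \<open>[t,t]\<close> or zero, by the vanishing brackets in \<open>sq\<close>.\<close>
  have mon: "\<exists>y. e (unit_fun m) = I +> y \<and> (y = t \<and> parity (\<lambda>_. p) m = p \<or> y = t \<otimes> t \<and> parity (\<lambda>_. p) m = 0 \<or> y = \<zero>)"
    (is "\<exists>y. _ \<and> ?P m y") for m :: "unit monomial"
  proof (induction m)
    case (Gen u)
    then show ?case
      using t by (intro exI[of _ t]) simp
  next
    case (Prod m m')
    obtain y y' where y: "e (unit_fun m) = I +> y" "?P m y" "e (unit_fun m') = I +> y'" "?P m' y'"
      using Prod.IH by blast
    have yc: "y \<in> carrier L" "y' \<in> carrier L"
      using y(2,4) tc by auto
    have um: "unit_fun m \<in> carrier ?A" "unit_fun m' \<in> carrier ?A"
      by (rule unit_fun_in_carrier, auto)+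
    have "e (unit_fun (Prod m m')) = e (unit_fun m \<otimes>\<^bsub>?A\<^esub> unit_fun m')"
      by (simp add: free_nonassoc_simps nonassoc_mult_unit_fun)
    also have "\<dots> = I +> (y \<otimes> y')"
      using um yc y(1,3) by (simp add: Q)
    finally have "e (unit_fun (Prod m m')) = I +> (y \<otimes> y')" .
    moreover have "?P (Prod m m') (y \<otimes> y')"
      using y(2,4) sq(2-4) tc by auto
    ultimately show ?case
      by blast
  qed
  let ?lin = "\<lambda>c d. c \<odot> t \<oplus> d \<odot> (t \<otimes> t)"
  have span: "\<exists>c d. (c \<noteq> 0 \<longrightarrow> q = p) \<and> (d \<noteq> 0 \<longrightarrow> q = 0) \<and> e f = I +> ?lin c d" if f: "f \<in> grade ?A q" for f q
  proof -
    let ?U = "{f \<in> grade ?A q. \<exists>c d. (c \<noteq> 0 \<longrightarrow> q = p) \<and> (d \<noteq> 0 \<longrightarrow> q = 0) \<and> e f = I +> ?lin c d}"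
    have "subspace_of ?U ?A"
    proof (rule A.subspaceI)
      have "?lin 0 0 = \<zero>"
        using tc by simp
      then have "e \<zero>\<^bsub>?A\<^esub> = I +> ?lin 0 0"
        by (simp add: Q(3))
      then show "\<zero>\<^bsub>?A\<^esub> \<in> ?U"
        using A.gradeD(3)[of q] by blast
    next
      fix f f' assume ff: "f \<in> ?U" "f' \<in> ?U"
      then obtain c d c' d' where h: "c \<noteq> 0 \<longrightarrow> q = p" "d \<noteq> 0 \<longrightarrow> q = 0" "e f = I +> ?lin c d"
        "c' \<noteq> 0 \<longrightarrow> q = p" "d' \<noteq> 0 \<longrightarrow> q = 0" "e f' = I +> ?lin c' d'"
        by blast
      have "?lin (c + c') (d + d') = ?lin c d \<oplus> ?lin c' d'"
        using tc by (simp add: add_smult M.a_ac)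
      then have "e (f \<oplus>\<^bsub>?A\<^esub> f') = I +> ?lin (c + c') (d + d')"
        using ff h tc A.grade_in[of f q] A.grade_in[of f' q] by (simp add: Q)
      moreover have "c + c' \<noteq> 0 \<longrightarrow> q = p" "d + d' \<noteq> 0 \<longrightarrow> q = 0"
        using h by auto
      moreover have "f \<oplus>\<^bsub>?A\<^esub> f' \<in> grade ?A q"
        using ff A.gradeD(4)[of f q f'] by blast
      ultimately show "f \<oplus>\<^bsub>?A\<^esub> f' \<in> ?U"
        by blast
    next
      fix k f assume ff: "f \<in> ?U"
      then obtain c d where h: "c \<noteq> 0 \<longrightarrow> q = p" "d \<noteq> 0 \<longrightarrow> q = 0" "e f = I +> ?lin c d"
        by blast
      have "?lin (k * c) (k * d) = k \<odot> ?lin c d"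
        using tc by (simp add: smult_add mult_smult_assoc)
      then have "e (k \<odot>\<^bsub>?A\<^esub> f) = I +> ?lin (k * c) (k * d)"
        using ff h tc A.grade_in[of f q] by (simp add: Q)
      moreover have "k * c \<noteq> 0 \<longrightarrow> q = p" "k * d \<noteq> 0 \<longrightarrow> q = 0"
        using h by auto
      moreover have "k \<odot>\<^bsub>?A\<^esub> f \<in> grade ?A q"
        using ff A.gradeD(5)[of f q k] by blast
      ultimately show "k \<odot>\<^bsub>?A\<^esub> f \<in> ?U"
        by blast
    qed (use A.grade_in in blast)
    then have "f \<in> ?U"
    proof (rule free_nonassoc_grade_span[OF _ f])
      fix m :: "unit monomial" assume m: "set_monomial m \<subseteq> {()}" "parity (\<lambda>_. p) m = q"
      obtain y where y: "e (unit_fun m) = I +> y" "?P m y"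
        using mon by blast
      have "t = ?lin 1 0" "t \<otimes> t = ?lin 0 1" "\<zero> = ?lin 0 0"
        using tc by simp_all
      then have "\<exists>c d. (c \<noteq> 0 \<longrightarrow> q = p) \<and> (d \<noteq> 0 \<longrightarrow> q = 0) \<and> y = ?lin c d"
        using y(2) m(2) by (metis zero_neq_one)
      then show "unit_fun m \<in> ?U"
        using y(1) unit_fun_in_grade[OF m(1), of "\<lambda>_. p"] m(2) by auto
    qed
    then show ?thesis
      by blast
  qed
  show thesis
  proof (rule that[OF t(1)])
    fix x q assume x: "x \<in> grade L q"
    have xQ: "I +> x \<in> grade ?Q q"
      using x by (auto simp: Q(2))
    then have "\<phi> (I +> x) \<in> grade ?F q"
      by (rule phi.homD(5))
    then obtain f where f: "f \<in> grade ?A q" "\<phi> (I +> x) = ?\<pi> f"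
      unfolding free_lie_def by (rule A.quotient_gradeE[OF I1])
    then have "e f = I +> x"
      unfolding e_def using \<psi>\<phi>[OF Q.grade_in[OF xQ]] by simp
    then obtain c d where "c \<noteq> 0 \<longrightarrow> q = p" "d \<noteq> 0 \<longrightarrow> q = 0" "I +> x = I +> ?lin c d"
      using span[OF f(1)] by auto
    then show "\<exists>c d. (c \<noteq> 0 \<longrightarrow> q = p) \<and> (d \<noteq> 0 \<longrightarrow> q = 0) \<and> x \<ominus> ?lin c d \<in> I"
      using coset_eq_iff[OF superidealD(1)[OF I], of x] x tc by fastforce
  next
    fix c d assume "?lin c d \<in> I"
    then have "I +> ?lin c d = I"
      using coset_eq_zero_iff[OF superidealD(1)[OF I], of "?lin c d"] tc by simp
    then have eq: "I +> ?lin c d = \<zero>\<^bsub>?Q\<^esub>"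
      by (simp add: quotient_superalgebra_def)
    let ?f = "c \<odot>\<^bsub>?A\<^esub> ?g" and ?f' = "d \<odot>\<^bsub>?A\<^esub> ?gg"
    have fg: "?f \<in> grade ?A p" "?f' \<in> grade ?A 0"
      using gr by (auto intro: A.gradeD(5))
    have fc: "?f \<in> carrier ?A" "?f' \<in> carrier ?A" "?g \<in> carrier ?A" "?gg \<in> carrier ?A"
      using gr fg A.grade_in by blast+
    have "e (?f \<oplus>\<^bsub>?A\<^esub> ?f') = \<zero>\<^bsub>?Q\<^esub>"
      using fc t egg tc eq[symmetric] by (simp add: Q)
    then have "?\<pi> (?f \<oplus>\<^bsub>?A\<^esub> ?f') = \<zero>\<^bsub>?F\<^esub>"
      using \<phi>\<psi>[OF superalgebra_homD(1)[OF \<pi>, of "?f \<oplus>\<^bsub>?A\<^esub> ?f'"]] fc phi.hom_zero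
      unfolding e_def by simp
    then have "?\<pi> (?f \<oplus>\<^bsub>?A\<^esub> ?f') = ?I1"
      by (simp add: free_lie_def quotient_superalgebra_def)
    then have in_I1: "?f \<oplus>\<^bsub>?A\<^esub> ?f' \<in> ?I1"
      using A.coset_eq_zero_iff[OF A.superidealD(1)[OF I1], of "?f \<oplus>\<^bsub>?A\<^esub> ?f'"] fc by simp
    \<comment> \<open>The generator is sent to the single letter of a one-letter alphabet; relations
      of the free Lie superalgebra go to zero under this evaluation.\<close>
    let ?h = "\<lambda>_::unit. word [()] :: unit list \<Rightarrow>\<^sub>0 'k"
    obtain K where K: "superideal K ?A" "lie_relators ?A \<subseteq> K"
      "\<And>f q. f \<in> grade ?A q \<Longrightarrow> f \<in> K \<longleftrightarrow> assoc_eval (\<lambda>_. p) ?h f \<in> {0}"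
      by (rule assoc_kernel_superideal[OF two_sided_ideal_zero, of "{()}" "\<lambda>_. p" ?h]) blast
    have in_K: "?f \<oplus>\<^bsub>?A\<^esub> ?f' \<in> K"
      using ideal_gen_least[OF K(1,2)] in_I1 by blast
    have ev: "assoc_eval (\<lambda>_. p) ?h ?f = single [()] c"
      "assoc_eval (\<lambda>_. p) ?h ?f' = scl d (supercomm p p (word [()]) (word [()]))"
      using fc by (simp_all add: assoc_eval_smult assoc_eval_unit_fun)
    show "c = 0 \<and> (p = 1 \<longrightarrow> d = 0)"
    proof (cases p)
      case zero
      then have "?f \<oplus>\<^bsub>?A\<^esub> ?f' \<in> grade ?A 0"
        using A.gradeD(4)[OF _ fg(2), of ?f] fg(1) by simp
      then have "assoc_eval (\<lambda>_. p) ?h (?f \<oplus>\<^bsub>?A\<^esub> ?f') = 0"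
        using K(3) in_K by blast
      then have "single [()] c + scl d (supercomm p p (word [()]) (word [()])) = 0"
        using fc by (simp add: assoc_eval_add ev)
      then have "single [()] c = (0 :: unit list \<Rightarrow>\<^sub>0 'k)"
        using zero by (simp add: supercomm_def super_sign_def)
      then have "c = 0"
        by (metis lookup_single_eq lookup_zero)
      then show ?thesis
        using zero by simp
    next
      case one
      \<comment> \<open>The generator is odd here, so the summands are exchanged to bring the even
        component to the front before splitting.\<close>
      have "?f' \<oplus>\<^bsub>?A\<^esub> ?f \<in> K"
        using in_K A.M.a_comm[OF fc(1,2)] by simp
      then have "?f' \<in> K \<and> ?f \<in> K"
        using A.superidealD(4)[OF K(1) fg(2), of ?f] fg(1) one by simp
      then have "assoc_eval (\<lambda>_. p) ?h ?f = 0" "assoc_eval (\<lambda>_. p) ?h ?f' = 0"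
        using K(3)[OF fg(1)] K(3)[OF fg(2)] by blast+
      then have z: "single [()] c = (0 :: unit list \<Rightarrow>\<^sub>0 'k)"
        "scl d (supercomm p p (word [()]) (word [()])) = (0 :: unit list \<Rightarrow>\<^sub>0 'k)"
        unfolding ev .
      have "supercomm p p (word [()]) (word [()]) = (single [(), ()] 2 :: unit list \<Rightarrow>\<^sub>0 'k)"
        using one by (simp add: supercomm_def super_sign_def word_mult flip: single_diff)
      then have "single [(), ()] (d * 2) = (0 :: unit list \<Rightarrow>\<^sub>0 'k)"
        using z(2) by simp
      then have "d * 2 = 0"
        by (metis lookup_single_eq lookup_zero)
      moreover have "c = 0"
        using z(1) by (metis lookup_single_eq lookup_zero)
      ultimately show ?thesis
        using char(1) by simp
    qed
  qed
qed

section \<open>The chain of subalgebras generated by iterated brackets\<close>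

text \<open>Bracketing with \<open>t\<close> is a superderivation, so by the Jacobi identity the
  elements it sends into \<open>C'\<close> are closed under the product, and it suffices to look at
  the generators.\<close>

lemma (in lie_superalgebra) subalgebra_gen_bracket:
  assumes t: "t \<in> grade L p" and S: "S \<subseteq> carrier L" and C': "subsuperalgebra C' L" "subalgebra_gen L S \<subseteq> C'"
    and tS: "\<And>s. s \<in> S \<Longrightarrow> t \<otimes> s \<in> C'" and x: "x \<in> subalgebra_gen L S"
  shows "t \<otimes> x \<in> C'"
proof -
  let ?C = "subalgebra_gen L S"
  have C: "subsuperalgebra ?C L"
    by (rule subalgebra_gen[OF S])
  note sC = subsuperalgebraD[OF C] and sC' = subsuperalgebraD[OF C'(1)]
  note uC = subspaceD[OF sC(1)] and uC' = subspaceD[OF sC'(1)]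
  have tc: "t \<in> carrier L"
    using t by simp
  let ?T = "{x \<in> ?C. t \<otimes> x \<in> C'}"
  have graded: "x0 \<in> ?T \<and> x1 \<in> ?T" if x: "x0 \<in> grade L 0" "x1 \<in> grade L 1" "x0 \<oplus> x1 \<in> ?T" for x0 x1
  proof -
    have "x0 \<in> ?C \<and> x1 \<in> ?C"
      using sC(3)[OF x(1,2)] x(3) by simp
    moreover have tx: "t \<otimes> x0 \<in> grade L (p + 0)" "t \<otimes> x1 \<in> grade L (p + 1)" "t \<otimes> x0 \<oplus> t \<otimes> x1 \<in> C'"
      using grade_mult[OF t x(1)] grade_mult[OF t x(2)] x tc by (simp_all add: mult_add)
    \<comment> \<open>An odd \<open>t\<close> exchanges the parities of the two components, hence
      the case distinction.\<close>
    moreover have "t \<otimes> x0 \<in> C' \<and> t \<otimes> x1 \<in> C'"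
    proof (cases p)
      case zero
      then show ?thesis
        using sC'(3)[of "t \<otimes> x0" "t \<otimes> x1"] tx by simp
    next
      case one
      then show ?thesis
        using sC'(3)[of "t \<otimes> x1" "t \<otimes> x0"] tx x(1,2) tc by (simp add: M.a_comm)
    qed
    ultimately show ?thesis
      by simp
  qed
  have sub: "subspace_of ?T L"
  proof (rule subspaceI)
    show "\<zero> \<in> ?T"
      using uC(3) uC'(3) tc by simp
    show "x \<oplus> y \<in> ?T" if "x \<in> ?T" "y \<in> ?T" for x y
      using that uC(2)[of x] uC(2)[of y] uC(4)[of x y] uC'(4)[of "t \<otimes> x" "t \<otimes> y"] tc by (simp add: mult_add)
    show "c \<odot> x \<in> ?T" if "x \<in> ?T" for c x
      using that uC(2)[of x] uC(5)[of x c] uC'(5)[of "t \<otimes> x" c] tc by (simp add: mult_smult)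
  qed (use uC(1) in blast)
  note uT = subspaceD[OF sub]
  have hmult: "x \<otimes> y \<in> ?T" if x: "x \<in> ?T" "x \<in> grade L q" and y: "y \<in> ?T" "y \<in> grade L q'" for x y q q'
  proof -
    have "x \<in> C'" "y \<in> C'"
      using x y C'(2) by auto
    then have "(t \<otimes> x) \<otimes> y \<in> C'" "x \<otimes> (t \<otimes> y) \<in> C'"
      using sC'(2)[of "t \<otimes> x" y] sC'(2)[of x "t \<otimes> y"] x y by simp_all
    then have "t \<otimes> (x \<otimes> y) \<in> C'"
      unfolding super_jacobi[OF t x(2) y(2)] by (intro uC'(4,5))
    then show ?thesis
      using sC(2)[of x y] x y by simp
  qed
  have "subsuperalgebra ?T L"
  proof (rule subsuperalgebraI[OF sub graded])
    fix x y assume x: "x \<in> ?T" and y: "y \<in> ?T"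
    obtain x0 x1 where xx: "x = x0 \<oplus> x1" "x0 \<in> grade L 0" "x1 \<in> grade L 1"
      by (rule decomp[OF uT(2)[OF x]])
    obtain y0 y1 where yy: "y = y0 \<oplus> y1" "y0 \<in> grade L 0" "y1 \<in> grade L 1"
      by (rule decomp[OF uT(2)[OF y]])
    have xT: "x0 \<in> ?T" "x1 \<in> ?T" and yT: "y0 \<in> ?T" "y1 \<in> ?T"
      using graded[OF xx(2,3)] graded[OF yy(2,3)] x y unfolding xx(1) yy(1) by blast+
    have "x \<otimes> y = (x0 \<otimes> y0 \<oplus> x0 \<otimes> y1) \<oplus> (x1 \<otimes> y0 \<oplus> x1 \<otimes> y1)"
      using xx yy by (simp add: add_mult mult_add M.a_ac)
    then show "x \<otimes> y \<in> ?T"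
      using hmult[OF xT(1) xx(2) yT(1) yy(2)] hmult[OF xT(1) xx(2) yT(2) yy(3)]
        hmult[OF xT(2) xx(3) yT(1) yy(2)] hmult[OF xT(2) xx(3) yT(2) yy(3)] uT(4) by simp
  qed
  then have "?C \<subseteq> ?T"
    using tS subset_subalgebra_gen[of S L] by (intro subalgebra_gen_least) auto
  then show ?thesis
    using x by blast
qed

context hnn_basis
begin

text \<open>As long as the monomials are small relative to \<open>N\<close>, evaluating in
  \<open>L\<close> and in the envelope gives an assigned pair.\<close>

lemma assignment_eval:
  fixes C :: "nat \<Rightarrow> 'a set" and v :: "'x monomial \<Rightarrow> 'k"
  assumes Q: "Q \<in> superalgebra_hom (free_nonassoc G d) L"
    and C: "\<And>n. subsuperalgebra (C n) L" "mono C" "\<And>n b. b \<in> C n \<Longrightarrow> t \<otimes> b \<in> C (Suc n)"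
    and AB_eq: "A = C N" "B = C (Suc N)"
    and gen: "\<And>g. g \<in> G \<Longrightarrow> assignment (C 0) (d g) (Q (unit_fun (Gen g))) (h g)"
    and v: "v \<in> grade (free_nonassoc G d) q" "\<And>m. v m \<noteq> 0 \<Longrightarrow> 2 * size m \<le> N"
  shows "assignment B q (Q v) (assoc_eval d h v)"
proof -
  let ?A = "free_nonassoc G d :: ('k, 'x monomial \<Rightarrow> 'k) superalgebra"
  interpret Q: superalgebra_homomorphism ?A L Q
    by (intro superalgebra_homomorphism.intro superalgebra_homomorphism_axioms.intro
        superalgebra_free_nonassoc superalgebra_axioms Q)
  let ?U = "{v \<in> grade ?A q. assignment B q (Q v) (assoc_eval d h v)}"
  have Q_mon: "Q (unit_fun m) = eval_monomial L (\<lambda>g. Q (unit_fun (Gen g))) m" if "set_monomial m \<subseteq> G" for m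
    using that
  proof (induction m)
    case (Prod m m')
    have "Q (unit_fun (Prod m m')) = Q (unit_fun m \<otimes>\<^bsub>?A\<^esub> unit_fun m')"
      by (simp add: free_nonassoc_simps nonassoc_mult_unit_fun)
    also have "\<dots> = Q (unit_fun m) \<otimes> Q (unit_fun m')"
      using Prod.prems by (intro Q.homD(4) unit_fun_in_carrier) auto
    finally show ?case
      using Prod by simp
  qed simp
  have zero: "assignment B q \<zero> 0"
    by (intro assignment.gen_J two_sided_idealD(1)[OF J_ideal])
  have "subspace_of ?U ?A"
  proof (rule Q.L.subspaceI)
    show "x \<oplus>\<^bsub>?A\<^esub> y \<in> ?U" if "x \<in> ?U" "y \<in> ?U" for x y
      using that Q.L.gradeD(4)[of x q y] Q.L.grade_in[of x q] Q.L.grade_in[of y q]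
        assignment.gen_add[of B q "Q x" _ "Q y"] by (simp add: assoc_eval_add)
    show "c \<odot>\<^bsub>?A\<^esub> x \<in> ?U" if "x \<in> ?U" for c x
      using that Q.L.gradeD(5)[of x q c] Q.L.grade_in[of x q] assignment.gen_smult[of B q "Q x" _ c]
      by (simp add: assoc_eval_smult)
  qed (use Q.L.gradeD(3) zero in \<open>auto simp: assoc_eval_zero\<close>)
  then have "v \<in> ?U"
  proof (rule free_nonassoc_span)
    show "finite {m. v m \<noteq> 0}"
      using v(1) by (simp add: free_nonassoc_simps)
    fix m assume m: "v m \<noteq> 0"
    then have mG: "set_monomial m \<subseteq> G" "parity d m = q"
      using v(1) by (simp_all add: free_nonassoc_simps)
    have "assignment (C (2 * size m)) q (Q (unit_fun m)) (assoc_eval d h (unit_fun m))"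
      unfolding Q_mon[OF mG(1)] assoc_eval_unit_fun mG(2)[symmetric]
      by (rule assignment_monomial[OF C AB_eq _ mG(1) v(2)[OF m]]) (simp_all add: gen)
    moreover have "C (2 * size m) \<subseteq> B"
      using monoD[OF C(2) v(2)[OF m]] AB AB_eq(1) by blast
    ultimately have "assignment B q (Q (unit_fun m)) (assoc_eval d h (unit_fun m))"
      by (rule assignment_mono)
    then show "unit_fun m \<in> ?U"
      using unit_fun_in_grade[OF mG(1), of d] mG(2) by simp
  qed
  then show ?thesis
    by simp
qed

lemma assignment_lin:
  assumes "c \<noteq> 0 \<longrightarrow> q = p" "d \<noteq> 0 \<longrightarrow> q = 0"
  shows "assignment C q (c \<odot> t \<oplus> d \<odot> (t \<otimes> t)) (scl c tT + scl d sT)"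
proof (intro assignment.gen_add)
  have z: "assignment C q \<zero> 0"
    by (intro assignment.gen_J two_sided_idealD(1)[OF J_ideal])
  have tc: "t \<in> carrier L"
    using t by simp
  show "assignment C q (c \<odot> t) (scl c tT)"
    using assms(1) z tc assignment.gen_smult[OF assignment.gen_t, of C c] by (cases "c = 0") simp_all
  show "assignment C q (d \<odot> (t \<otimes> t)) (scl d sT)"
    using assms(2) z tc assignment.gen_smult[OF assignment.gen_tt, of C d] by (cases "d = 0") auto
qed

lemma lin_zero:
  assumes "c = 0 \<and> (p = 1 \<longrightarrow> d = 0)"
  shows "c \<odot> t \<oplus> d \<odot> (t \<otimes> t) = \<zero>" "scl c tT + scl d sT = 0"
proof -
  have tc: "t \<in> carrier L"
    using t by simp
  show "c \<odot> t \<oplus> d \<odot> (t \<otimes> t) = \<zero>"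
    using assms tc sq(1) by (cases p) simp_all
  show "scl c tT + scl d sT = 0"
    using assms by (cases p) (simp_all add: supercomm_def super_sign_def)
qed

text \<open>Independence of \<open>t\<close> and \<open>[t,t]\<close> modulo \<open>V\<close> forces
  their multiples in the decomposition to vanish, on both sides at once. Applied with
  \<open>V = I\<close>, it makes the values of elements of \<open>I\<close> unambiguous modulo
  \<open>J\<close>.\<close>

lemma assignment_eq_emb:
  assumes "assignment B q x a" and indep: "\<And>c d. c \<odot> t \<oplus> d \<odot> (t \<otimes> t) \<in> V \<Longrightarrow> c = 0 \<and> (p = 1 \<longrightarrow> d = 0)"
    and V: "subspace_of V L" "B \<subseteq> V" "x \<in> V"
  shows "x \<in> B \<and> a - emb q x \<in> J"
proof -
  obtain c d b where h: "b \<in> B" "x = (c \<odot> t \<oplus> d \<odot> (t \<otimes> t)) \<oplus> b" "a - (scl c tT + scl d sT + emb q b) \<in> J"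
    using assignment_normal[OF assms(1) subsuperalgebraD(1)[OF B] order.refl] by blast
  have bc: "b \<in> carrier L"
    using subspaceD(2)[OF subsuperalgebraD(1)[OF B] h(1)] .
  have tc: "t \<in> carrier L"
    using t by simp
  have "x \<ominus> b \<in> V"
    using subspaceD(7)[OF V(1,3)] h(1) V(2) by blast
  moreover have "x \<ominus> b = c \<odot> t \<oplus> d \<odot> (t \<otimes> t)"
    using h(2) bc tc by (simp add: a_minus_def M.a_assoc M.r_neg)
  ultimately have "c \<odot> t \<oplus> d \<odot> (t \<otimes> t) \<in> V"
    by simp
  note z = lin_zero[OF indep[OF this]]
  have "x = b"
    using h(2) bc z(1) by simp
  then show ?thesis
    using h(1,3) z(2) by simp
qed

end

text \<open>The graph of the map induced on \<open>L\<close> by evaluation of the free superalgebra.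
  It is well defined modulo \<open>J\<close> because kernel elements evaluate into
  \<open>J\<close>.\<close>

lemma super_rep_presentation:
  fixes L :: "('k::field, 'a) superalgebra" (structure) and J :: "('w::monoid_add \<Rightarrow>\<^sub>0 'k) set"
  assumes L: "superalgebra L" and J: "two_sided_ideal J" and Q: "Q \<in> superalgebra_hom (free_nonassoc G d) L"
    and ker: "\<And>f p. f \<in> grade (free_nonassoc G d) p \<Longrightarrow> Q f = \<zero> \<Longrightarrow> assoc_eval d h f \<in> J"
  shows "super_rep L J (\<lambda>p x a. \<exists>f \<in> grade (free_nonassoc G d) p. Q f = x \<and> a - assoc_eval d h f \<in> J)"
proof -
  let ?A = "free_nonassoc G d" and ?e = "assoc_eval d h"
  interpret Q: superalgebra_homomorphism ?A L Q
    by (intro superalgebra_homomorphism.intro superalgebra_homomorphism_axioms.intro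
        superalgebra_free_nonassoc L Q)
  note J' = two_sided_idealD[OF J] two_sided_ideal_scl[OF J]
  show ?thesis
  proof (intro super_rep.intro super_rep_axioms.intro)
    show "superalgebra L"
      by (rule L)
    show "two_sided_ideal J"
      by (rule J)
    show "x \<in> grade L p" if "\<exists>f \<in> grade ?A p. Q f = x \<and> a - ?e f \<in> J" for p x a
      using that Q.homD(5) by blast
    show "\<exists>f \<in> grade ?A p. Q f = \<zero> \<and> 0 - ?e f \<in> J" for p
      using Q.L.gradeD(3)[of p] J'(1) by (intro bexI[of _ "\<zero>\<^bsub>?A\<^esub>"]) (simp_all add: assoc_eval_zero)
    show "a \<in> J" if Ha: "\<exists>f \<in> grade ?A p. Q f = \<zero> \<and> a - ?e f \<in> J" for p a
    proof -
      obtain f where f: "f \<in> grade ?A p" "Q f = \<zero>" "a - ?e f \<in> J"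
        using Ha by blast
      then show ?thesis
        using J'(2)[OF f(3) ker[OF f(1,2)]] by simp
    qed
    show "\<exists>f \<in> grade ?A p. Q f = c \<odot> x \<and> scl c a - ?e f \<in> J"
      if Ha: "\<exists>f \<in> grade ?A p. Q f = x \<and> a - ?e f \<in> J" for p x a c
    proof -
      obtain f where f: "f \<in> grade ?A p" "Q f = x" "a - ?e f \<in> J"
        using Ha by blast
      then have "scl c a - ?e (c \<odot>\<^bsub>?A\<^esub> f) = scl c (a - ?e f)"
        using Q.L.grade_in[OF f(1)] by (simp add: assoc_eval_smult pm.scale_right_diff_distrib)
      then show ?thesis
        using f J'(7)[OF f(3), of c] Q.L.gradeD(5)[OF f(1), of c] by (intro bexI[of _ "c \<odot>\<^bsub>?A\<^esub> f"]) simp_all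
    qed
    fix p x a q y b
    assume "\<exists>f \<in> grade ?A p. Q f = x \<and> a - ?e f \<in> J"
    then obtain f where f: "f \<in> grade ?A p" "Q f = x" "a - ?e f \<in> J"
      by blast
    show "\<exists>f \<in> grade ?A p. Q f = x \<oplus> y \<and> a + b - ?e f \<in> J"
      if Hb: "\<exists>f \<in> grade ?A p. Q f = y \<and> b - ?e f \<in> J"
    proof -
      obtain g where g: "g \<in> grade ?A p" "Q g = y" "b - ?e g \<in> J"
        using Hb by blast
      have "a + b - ?e (f \<oplus>\<^bsub>?A\<^esub> g) = (a - ?e f) + (b - ?e g)"
        using Q.L.grade_in[OF f(1)] Q.L.grade_in[OF g(1)] by (simp add: assoc_eval_add)
      then have "a + b - ?e (f \<oplus>\<^bsub>?A\<^esub> g) \<in> J"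
        using J'(2)[OF f(3) g(3)] by (simp only:)
      then show ?thesis
        using f g Q.L.gradeD(4)[OF f(1) g(1)] by (intro bexI[of _ "f \<oplus>\<^bsub>?A\<^esub> g"]) simp_all
    qed
    show "\<exists>f \<in> grade ?A (p + q). Q f = x \<otimes> y \<and> supercomm p q a b - ?e f \<in> J"
      if Hb: "\<exists>f \<in> grade ?A q. Q f = y \<and> b - ?e f \<in> J"
    proof -
      obtain g where g: "g \<in> grade ?A q" "Q g = y" "b - ?e g \<in> J"
        using Hb by blast
      have "supercomm p q a b - ?e (f \<otimes>\<^bsub>?A\<^esub> g) = supercomm p q (a - ?e f) b + supercomm p q (?e f) (b - ?e g)"
        by (simp add: assoc_eval_mult[OF f(1) g(1)] supercomm_diff_left supercomm_diff_right)
      also have "\<dots> \<in> J"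
        using f(3) g(3) by (intro J'(2) two_sided_ideal_supercomm[OF J]) auto
      finally show ?thesis
        using f g Q.L.grade_mult[OF f(1) g(1)] by (intro bexI[of _ "f \<otimes>\<^bsub>?A\<^esub> g"]) simp_all
    qed
  qed
qed

text \<open>The chain \<open>C\<close> of subalgebras generated by iterated brackets with
  \<open>t\<close> either becomes stationary, and then fills \<open>I\<close>, or yields an HNN
  envelope with a letter outside \<open>A\<close>.\<close>

lemma finitely_generated_or_contains_free:
  fixes L :: "('k::field, 'a) superalgebra" (structure)
  assumes L: "lie_superalgebra L" and char: "(2::'k) \<noteq> 0" "(3::'k) \<noteq> 0"
    and fp: "finitely_presented L" and I: "superideal I L"
    and free: "free_on_one_generator (quotient_superalgebra L I)"
  shows "finitely_generated (restrict_to L I) \<or> contains_nonabelian_free L \<and> \<not> soluble L"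
proof -
  interpret lie_superalgebra L
    by (rule L)
  obtain p t where t: "t \<in> grade L p"
    and span: "\<And>x q. x \<in> grade L q \<Longrightarrow>
      \<exists>c d. (c \<noteq> 0 \<longrightarrow> q = p) \<and> (d \<noteq> 0 \<longrightarrow> q = 0) \<and> x \<ominus> (c \<odot> t \<oplus> d \<odot> (t \<otimes> t)) \<in> I"
    and indep: "\<And>c d. c \<odot> t \<oplus> d \<odot> (t \<otimes> t) \<in> I \<Longrightarrow> c = 0 \<and> (p = 1 \<longrightarrow> d = 0)"
    by (rule free_on_one_generator_quotient[OF L char I free]) (rule that, assumption+)
  have tc: "t \<in> carrier L"
    using t by simp
  note sI = superidealD[OF I]
  note uI = subspaceD[OF sI(1)]
  obtain G :: "nat set" and par F Q where G: "finite G" and F: "finite F" "F \<subseteq> homogeneous (free_nonassoc G par)"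
    and Q: "Q \<in> superalgebra_hom (free_nonassoc G par) L" "Q ` carrier (free_nonassoc G par) = carrier L"
    and QF: "\<And>f. f \<in> F \<Longrightarrow> Q f = \<zero>"
    and kerQ: "\<And>K f. superideal K (free_nonassoc G par) \<Longrightarrow> lie_relators (free_nonassoc G par) \<subseteq> K \<Longrightarrow> F \<subseteq> K \<Longrightarrow>
      f \<in> carrier (free_nonassoc G par) \<Longrightarrow> Q f = \<zero> \<Longrightarrow> f \<in> K"
    by (rule finitely_presented_cover[OF superalgebra_axioms fp]) (rule that, assumption+)
  let ?A = "free_nonassoc G par :: ('k, nat monomial \<Rightarrow> 'k) superalgebra"
  interpret Q: superalgebra_homomorphism ?A L Q
    by (intro superalgebra_homomorphism.intro superalgebra_homomorphism_axioms.intro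
        superalgebra_free_nonassoc superalgebra_axioms Q)
  have Q_onto: "\<exists>f \<in> grade ?A q. Q f = x" if x: "x \<in> grade L q" for x q
  proof -
    obtain f where "f \<in> carrier ?A" "x = Q f"
      using x Q(2) grade_in by blast
    then show ?thesis
      using Q.grade_lift[of f q] x by auto
  qed
  define x where "x g = Q (unit_fun (Gen g))" for g
  have gen_grade: "unit_fun (Gen g) \<in> grade ?A (par g)" if "g \<in> G" for g
    using unit_fun_in_grade[of "Gen g" G par] that by simp
  have x: "x g \<in> grade L (par g)" if "g \<in> G" for g
    unfolding x_def by (rule Q.homD(5)[OF gen_grade[OF that]])
  have "\<exists>c d. g \<in> G \<longrightarrow> (c \<noteq> 0 \<longrightarrow> par g = p) \<and> (d \<noteq> 0 \<longrightarrow> par g = 0) \<and> x g \<ominus> (c \<odot> t \<oplus> d \<odot> (t \<otimes> t)) \<in> I" for g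
    using span[OF x] by blast
  then obtain \<gamma> \<delta> where \<gamma>\<delta>: "\<And>g. g \<in> G \<Longrightarrow> (\<gamma> g \<noteq> 0 \<longrightarrow> par g = p)"
    "\<And>g. g \<in> G \<Longrightarrow> (\<delta> g \<noteq> 0 \<longrightarrow> par g = 0)"
    "\<And>g. g \<in> G \<Longrightarrow> x g \<ominus> (\<gamma> g \<odot> t \<oplus> \<delta> g \<odot> (t \<otimes> t)) \<in> I"
    by metis
  \<comment> \<open>\<open>\<theta> g\<close> is the part of the generator visible modulo
    \<open>I\<close>; the rest \<open>b g\<close> lies in \<open>I\<close> and has the same
    parity.\<close>
  define \<theta> where "\<theta> g = \<gamma> g \<odot> t \<oplus> \<delta> g \<odot> (t \<otimes> t)" for g
  define b where "b g = x g \<ominus> \<theta> g" for g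
  have \<theta>: "\<theta> g \<in> grade L (par g)" if "g \<in> G" for g
  proof -
    have "\<gamma> g \<odot> t \<in> grade L (par g)"
      using \<gamma>\<delta>(1)[OF that] t tc gradeD(3,5) by (cases "\<gamma> g = 0") auto
    moreover have "\<delta> g \<odot> (t \<otimes> t) \<in> grade L (par g)"
      using \<gamma>\<delta>(2)[OF that] grade_mult[OF t t] tc gradeD(3,5) by (cases "\<delta> g = 0") auto
    ultimately show ?thesis
      unfolding \<theta>_def by (rule gradeD(4))
  qed
  have b: "b g \<in> I" "b g \<in> grade L (par g)" if "g \<in> G" for g
    using \<gamma>\<delta>(3)[OF that] gradeD(7)[OF x[OF that] \<theta>[OF that]] by (simp_all add: b_def \<theta>_def)
  have x_eq: "x g = \<theta> g \<oplus> b g" if "g \<in> G" for g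
    using grade_in[OF x[OF that]] grade_in[OF \<theta>[OF that]]
    by (simp add: b_def a_minus_def M.a_lcomm[of "\<theta> g" "x g"] M.r_neg)
  define ad where "ad j g = ((\<otimes>) t ^^ j) (b g)" for j g
  define q where "q j g = ((+) p ^^ j) (par g)" for j and g :: nat
  have ad_Suc: "ad (Suc j) g = t \<otimes> ad j g" "q (Suc j) g = p + q j g" for j g
    by (simp_all add: ad_def q_def)
  have ad: "ad j g \<in> I" "ad j g \<in> grade L (q j g)" if "g \<in> G" for j g
  proof -
    have "ad j g \<in> I \<and> ad j g \<in> grade L (q j g)"
      by (induction j) (use b[OF that] sI(3) tc grade_mult[OF t] in \<open>simp_all add: ad_Suc, simp_all add: ad_def q_def\<close>)
    then show "ad j g \<in> I" "ad j g \<in> grade L (q j g)"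
      by auto
  qed
  \<comment> \<open>All brackets of order at most \<open>n\<close> with \<open>t\<close>, of all the
    elements \<open>b g\<close>; finite because \<open>G\<close> is.\<close>
  define S where "S n = (\<lambda>(j, g). ad j g) ` ({..n} \<times> G)" for n :: nat
  define C where "C n = subalgebra_gen L (S n)" for n
  have S: "finite (S n)" "S n \<subseteq> I" "S n \<subseteq> homogeneous L" "S n \<subseteq> carrier L" for n
  proof -
    show "finite (S n)"
      using G by (simp add: S_def)
    show "S n \<subseteq> I"
      using ad(1) by (auto simp: S_def)
    then show "S n \<subseteq> carrier L"
      using uI(1) by blast
    show "S n \<subseteq> homogeneous L"
    proof
      fix y assume "y \<in> S n"
      then obtain r where "y \<in> grade L r"
        using ad(2) by (auto simp: S_def)
      then show "y \<in> homogeneous L"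
        by (cases r) (auto simp: homogeneous_def)
    qed
  qed
  have S_C: "S n \<subseteq> C n" for n
    unfolding C_def by (rule subset_subalgebra_gen)
  have C: "subsuperalgebra (C n) L" for n
    unfolding C_def by (rule subalgebra_gen[OF S(4)])
  have C_least: "C n \<subseteq> T" if "subsuperalgebra T L" "S n \<subseteq> T" for n T
    unfolding C_def using that by (rule subalgebra_gen_least)
  have C_I: "C n \<subseteq> I" for n
    by (rule C_least[OF superideal_subsuperalgebra[OF I] S(2)])
  have C_mono: "mono C"
  proof (rule monoI)
    fix m n :: nat assume "m \<le> n"
    then have "S m \<subseteq> S n"
      by (auto simp: S_def)
    then show "C m \<subseteq> C n"
      using S_C by (intro C_least[OF C]) blast
  qed
  have tS: "t \<otimes> s \<in> C (Suc n)" if "s \<in> S n" for s n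
  proof -
    have "t \<otimes> s \<in> S (Suc n)"
      using that unfolding S_def by (force simp flip: ad_Suc(1))
    then show ?thesis
      using S_C by blast
  qed
  have tC: "t \<otimes> y \<in> C (Suc n)" if y: "y \<in> C n" for y n
    by (rule subalgebra_gen_bracket[OF t S(4)[of n] C[of "Suc n"] _ tS y[unfolded C_def]])
      (use monoD[OF C_mono, of n "Suc n"] in \<open>simp_all add: C_def\<close>)
  have b_C: "b g \<in> C 0" if "g \<in> G" for g
    using S_C[of 0] that by (force simp: S_def ad_def)
  show ?thesis
  proof (cases "\<exists>n. C n = C (Suc n)")
    case True
    then obtain n where n: "C n = C (Suc n)"
      by blast
    \<comment> \<open>\<open>C n\<close> is now stable under bracketing with \<open>t\<close>. With
      \<open>A = B = C n\<close> the constant chain admits monomials of every size, so each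
      homogeneous element of \<open>I\<close> is assigned over \<open>C n\<close> and, having no
      part along \<open>t\<close> or \<open>[t,t]\<close>, lies in it.\<close>
    let ?B = "C n"
    have tB: "t \<otimes> y \<in> ?B" if "y \<in> ?B" for y
      using tC[OF that] n by simp
    obtain \<B> \<kappa> r where hnn: "hnn_basis L p t ?B ?B \<B> \<kappa> r"
      by (rule hnn_basis_exists[OF L char t C[of n] C[of n] order.refl tB, of "{}"]) auto
    interpret hnn_basis L p t ?B ?B \<B> \<kappa> r
      by (rule hnn)
    define h where "h g = scl (\<gamma> g) tT + scl (\<delta> g) sT + emb (par g) (b g)" for g
    have b_B: "b g \<in> ?B" if "g \<in> G" for g
      using b_C[OF that] monoD[OF C_mono, of 0 n] by auto
    have gen: "assignment ?B (par g) (Q (unit_fun (Gen g))) (h g)" if g: "g \<in> G" for g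
      unfolding x_def[symmetric] x_eq[OF g] h_def \<theta>_def
      by (intro assignment.gen_add[OF assignment_lin] assignment.gen_emb \<gamma>\<delta>(1,2) b_B b g)
    have "y \<in> ?B" if y: "y \<in> I" "y \<in> grade L q'" for y q'
    proof -
      obtain v where v: "v \<in> grade ?A q'" "Q v = y"
        using Q_onto[OF y(2)] by blast
      then have fin: "finite {m. v m \<noteq> 0}"
        by (simp add: free_nonassoc_simps)
      let ?N = "Max (insert 0 ((\<lambda>m. 2 * size m) ` {m. v m \<noteq> 0}))"
      have "assignment ?B q' (Q v) (assoc_eval par h v)"
      proof (rule assignment_eval[OF Q(1), where C = "\<lambda>_. ?B" and N = ?N])
        show "2 * size m \<le> ?N" if "v m \<noteq> 0" for m
          using fin that by (intro Max_ge) auto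
      qed (use C tB gen v(1) in \<open>auto simp: mono_def\<close>)
      then show ?thesis
        using assignment_eq_emb[OF _ indep sI(1) C_I, of q' "Q v"] y(1) v(2) by blast
    qed
    then have "I \<subseteq> ?B"
    proof -
      assume hom: "\<And>y q'. y \<in> I \<Longrightarrow> y \<in> grade L q' \<Longrightarrow> y \<in> ?B"
      show "I \<subseteq> ?B"
      proof
        fix y assume y: "y \<in> I"
        obtain y0 y1 where yy: "y = y0 \<oplus> y1" "y0 \<in> grade L 0" "y1 \<in> grade L 1"
          by (rule decomp[OF uI(2)[OF y]])
        then have "y0 \<in> I \<and> y1 \<in> I"
          using sI(4) y by blast
        then show "y \<in> ?B"
          unfolding yy(1) using hom yy(2,3) by (intro subspaceD(4)[OF subsuperalgebraD(1)[OF C]]) auto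
      qed
    qed
    then have "subalgebra_gen L (S n) = I"
      using C_I[of n] unfolding C_def by blast
    then show ?thesis
      using finitely_generated_restrict[OF superalgebra_axioms superideal_subsuperalgebra[OF I] S(1,3)] by blast
  next
    case False
    \<comment> \<open>An expression of \<open>t\<close> in the generators. It is treated like a
      relator, so that its evaluation can be compared with the letter \<open>None\<close>.\<close>
    obtain \<tau> where \<tau>: "\<tau> \<in> grade ?A p" "Q \<tau> = t"
      using Q_onto[OF t] by blast
    have fin: "finite {m. v m \<noteq> 0}" if "v \<in> insert \<tau> F" for v
      using that F(2) \<tau>(1) by (auto simp: homogeneous_def free_nonassoc_simps)
    define M where "M = (\<Union>v\<in>insert \<tau> F. {m. v m \<noteq> 0})"
    \<comment> \<open>A stage late enough for evaluating all monomials of \<tau> and of the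
      relators.\<close>
    define N where "N = Max (insert 0 ((\<lambda>m. 2 * size m) ` M))"
    have "finite M"
      unfolding M_def using F(1) fin by blast
    then have N: "2 * size m \<le> N" if "v \<in> insert \<tau> F" "v m \<noteq> 0" for v m
      unfolding N_def using that by (intro Max_ge) (auto simp: M_def)
    \<comment> \<open>The step from stage \<open>N\<close> to \<open>Suc N\<close> is strict, so
      some generator of the latter lies outside \<open>C N\<close>. It must be of the last order
      \<open>Suc N\<close>.\<close>
    have "\<not> S (Suc N) \<subseteq> C N"
      using False C_least[OF C[of N], of "Suc N"] monoD[OF C_mono, of N "Suc N"] by auto
    then obtain j g0 where g0: "j \<le> Suc N" "g0 \<in> G" "ad j g0 \<notin> C N"
      by (auto simp: S_def)
    have ad_C: "ad i g \<in> C n" if "g \<in> G" "i \<le> n" for i g n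
      using S_C[of n] that by (auto simp: S_def)
    have "j = Suc N"
      using ad_C[OF g0(2), of j N] g0(1,3) by (cases "j = Suc N") auto
    define b0 where "b0 = ad (Suc N) g0"
    have b0: "b0 \<in> C (Suc N)" "b0 \<notin> C N" "b0 \<in> grade L (q (Suc N) g0)"
      using ad_C[OF g0(2), of "Suc N" "Suc N"] g0(3) ad(2)[OF g0(2)] \<open>j = Suc N\<close> by (simp_all add: b0_def)
    have b0_hom: "b0 \<in> homogeneous L"
      using S(3)[of "Suc N"] g0(2) by (force simp: S_def b0_def)
    obtain \<B> \<kappa> r where hnn: "hnn_basis L p t (C N) (C (Suc N)) \<B> \<kappa> r" and E: "{b0} \<subseteq> \<B> 0 \<union> \<B> 1"
      by (rule hnn_basis_exists[OF L char t C[of N] C[of "Suc N"] monoD[OF C_mono, of N "Suc N"] tC, of "{b0}"])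
        (use b0 b0_hom in auto)
    interpret hnn_basis L p t "C N" "C (Suc N)" \<B> \<kappa> r
      by (rule hnn)
    note J = two_sided_idealD[OF J_ideal] two_sided_ideal_scl[OF J_ideal]
    define h where "h g = scl (\<gamma> g) tT + scl (\<delta> g) sT + emb (par g) (b g)" for g
    have gen: "assignment (C 0) (par g) (Q (unit_fun (Gen g))) (h g)" if g: "g \<in> G" for g
      unfolding x_def[symmetric] x_eq[OF g] h_def \<theta>_def
      by (intro assignment.gen_add[OF assignment_lin] assignment.gen_emb \<gamma>\<delta>(1,2) b_C b g)
    have eval: "assignment (C (Suc N)) q' (Q v) (assoc_eval par h v)"
      if "v \<in> insert \<tau> F" "v \<in> grade ?A q'" for v q'
      by (rule assignment_eval[OF Q(1) C C_mono tC refl refl gen that(2) N[OF that(1)]])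
    have eq_emb: "a - emb q' y \<in> J" if "assignment (C (Suc N)) q' y a" "y \<in> I" for q' y a
      using assignment_eq_emb[OF that(1) indep sI(1) C_I that(2)] by blast
    \<comment> \<open>A relator is assigned to zero, an element of \<open>I\<close>; by uniqueness
      its value is zero modulo \<open>J\<close>.\<close>
    have F_J: "assoc_eval par h v \<in> J" if v: "v \<in> F" for v
    proof -
      obtain q' where "v \<in> grade ?A q'"
        using F(2) v by (auto simp: homogeneous_def)
      then have "assignment (C (Suc N)) q' \<zero> (assoc_eval par h v)"
        using eval[of v q'] QF[OF v] v by simp
      then show ?thesis
        using eq_emb[of q' \<zero>] uI(3) by (simp add: emb_zero)
    qed
    have \<tau>_J: "tT - assoc_eval par h \<tau> \<in> J"
    proof -
      have "assignment (C (Suc N)) p (t \<oplus> (- 1) \<odot> t) (assoc_eval par h \<tau> + scl (- 1) tT)"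
        using eval[of \<tau> p] \<tau> by (intro assignment.gen_add assignment.gen_smult assignment.gen_t) auto
      moreover have "t \<oplus> (- 1) \<odot> t = \<zero>"
        using tc by (simp add: M.r_neg flip: a_inv_eq)
      ultimately have "assoc_eval par h \<tau> + scl (- 1) tT \<in> J"
        using eq_emb[of p \<zero>] uI(3) by (simp add: emb_zero)
      then have "- (assoc_eval par h \<tau> + scl (- 1) tT) \<in> J"
        by (rule J(5))
      moreover have "- (assoc_eval par h \<tau> + scl (- 1) tT) = tT - assoc_eval par h \<tau>"
        by (simp add: single_uminus)
      ultimately show ?thesis
        by (simp only:)
    qed
    obtain K where K: "superideal K ?A" "lie_relators ?A \<subseteq> K"
      "\<And>f q. f \<in> grade ?A q \<Longrightarrow> f \<in> K \<longleftrightarrow> assoc_eval par h f \<in> J"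
      by (rule assoc_kernel_superideal[OF J_ideal, of G par h]) (rule that, assumption+)
    have "F \<subseteq> K"
      using F(2) F_J K(3) by (auto simp: homogeneous_def)
    then have ker: "assoc_eval par h v \<in> J" if "v \<in> grade ?A q'" "Q v = \<zero>" for v q'
      using kerQ[OF K(1,2)] K(3)[OF that(1)] Q.L.grade_in[OF that(1)] that(2) by blast
    \<comment> \<open>The induced homomorphism from \<open>L\<close> to the envelope modulo
      \<open>J\<close>, as a graph.\<close>
    define H where "H q' y a \<longleftrightarrow> (\<exists>v \<in> grade ?A q'. Q v = y \<and> a - assoc_eval par h v \<in> J)" for q' y a
    have rep: "super_rep L J H"
      unfolding H_def by (rule super_rep_presentation[OF superalgebra_axioms J_ideal Q(1) ker])
    interpret R: super_rep L J H
      by (rule rep)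
    have H_congr: "H q' y a'" if a: "H q' y a" "a' - a \<in> J" for q' y a a'
    proof -
      obtain v where v: "v \<in> grade ?A q'" "Q v = y" "a - assoc_eval par h v \<in> J"
        using a(1) unfolding H_def by blast
      have "a' - assoc_eval par h v \<in> J"
        using J(2)[OF a(2) v(3)] by simp
      then show ?thesis
        unfolding H_def using v by blast
    qed
    have Ht: "H p t tT"
      unfolding H_def using \<tau> \<tau>_J by blast
    have H_b: "H (par g) (b g) (emb (par g) (b g))" if g: "g \<in> G" for g
    proof -
      have "H (par g) (x g) (h g)"
        unfolding H_def x_def using gen_grade[OF g] J(1) by (intro bexI[of _ "unit_fun (Gen g)"]) (simp_all add: assoc_eval_unit_fun)
      moreover have "H (par g) (\<theta> g) (scl (\<gamma> g) tT + scl (\<delta> g) sT)"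
        unfolding \<theta>_def
      proof (rule R.H_add)
        show "H (par g) (\<gamma> g \<odot> t) (scl (\<gamma> g) tT)"
          using \<gamma>\<delta>(1)[OF g] R.H_smult[OF Ht, of "\<gamma> g"] R.H_zero tc by (cases "\<gamma> g = 0") auto
        show "H (par g) (\<delta> g \<odot> (t \<otimes> t)) (scl (\<delta> g) sT)"
          using \<gamma>\<delta>(2)[OF g] R.H_smult[OF R.H_mult[OF Ht Ht], of "\<delta> g"] R.H_zero tc by (cases "\<delta> g = 0") auto
      qed
      ultimately have "H (par g) (b g) (h g - (scl (\<gamma> g) tT + scl (\<delta> g) sT))"
        unfolding b_def by (rule R.H_diff)
      then show ?thesis
        by (simp add: h_def)
    qed
    \<comment> \<open>Below stage \<open>Suc N\<close> the iterated brackets lie in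
      \<open>A\<close>, where the bracket with the letter \<open>None\<close> is prescribed. Hence
      \<open>b0\<close>, the last of them, is represented by its own letter although it is not in
      \<open>A\<close>.\<close>
    have H_ad: "i \<le> Suc N \<Longrightarrow> H (q i g0) (ad i g0) (emb (q i g0) (ad i g0))" for i
    proof (induction i)
      case 0
      then show ?case
        using H_b[OF g0(2)] by (simp add: q_def ad_def)
    next
      case (Suc i)
      have "ad i g0 \<in> C N \<inter> grade L (q i g0)"
        using ad_C[OF g0(2), of i N] ad(2)[OF g0(2)] Suc.prems by simp
      then have "supercomm p (q i g0) tT (emb (q i g0) (ad i g0)) - emb (p + q i g0) (t \<otimes> ad i g0) \<in> J"
        by (rule supercomm_emb_None)
      then have "emb (p + q i g0) (t \<otimes> ad i g0) - supercomm p (q i g0) tT (emb (q i g0) (ad i g0)) \<in> J"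
        using J(5) by fastforce
      then show ?case
        unfolding ad_Suc using Suc by (intro H_congr[OF R.H_mult[OF Ht]]) auto
    qed
    have b0_basis: "b0 \<in> \<B> (q (Suc N) g0)"
    proof -
      have "b0 \<noteq> \<zero>"
        using b0(2) subspaceD(3)[OF subsuperalgebraD(1)[OF C[of N]]] by auto
      then have "q (Suc N) g0 = q'" if "b0 \<in> \<B> q'" for q'
        using grade_disjoint[OF b0(3), of q'] basis_subset[of q'] that by blast
      then show ?thesis
        using E by auto
    qed
    then have Hb: "H (q (Suc N) g0) b0 (word [Some b0])"
      using H_ad[of "Suc N"] by (simp add: b0_def emb_basis)
    show ?thesis
      using contains_free[OF rep b0_basis b0(2) Ht Hb L] not_soluble[OF rep b0_basis b0(2) Ht Hb] by blast
  qed
qed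

theorem theoremB:
  fixes L :: "('k::field, 'a) superalgebra"
    and I :: "'a set"
  assumes "CHAR('k) \<noteq> 2" and "CHAR('k) \<noteq> 3"
    and "lie_superalgebra L"
    and "finitely_presented L"
    and "superideal I L"
    and "free_on_one_generator (quotient_superalgebra L I)"
  shows "(\<not> contains_nonabelian_free L \<longrightarrow> finitely_generated (restrict_to L I))
       \<and> (soluble L \<longrightarrow> finitely_generated (restrict_to L I))"
proof -
  \<comment> \<open>If \<open>m\<close> were zero in the field, the characteristic would divide the
    prime \<open>m\<close>, and it is neither 1 nor \<open>m\<close>.\<close>
  have not_zero: "(of_nat m :: 'k) \<noteq> 0" if "prime m" "CHAR('k) \<noteq> m" for m
    using that prime_nat_iff[of m] CHAR_not_1'[where 'a = 'k] unfolding of_nat_eq_0_iff_char_dvd One_nat_def by metis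
  have "(2::'k) \<noteq> 0" "(3::'k) \<noteq> 0"
    using not_zero[OF two_is_prime_nat] not_zero[of 3] assms(1,2) by simp_all
  then show ?thesis
    using finitely_generated_or_contains_free[OF assms(3) _ _ assms(4-6)] by blast
qed

end
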